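(* Assume $u_4<u_3<u_2<u_1$ are real with $u_1+u_2+u_3+u_4=0$, $u_1+u_2\ne0$, $u_1+u_3\ne0$, $u_2+u_3\ne0$. Let $$u(x)=u_4+\frac{(u_1-u_4)(u_2-u_4)}{(u_2-u_4)+(u_1-u_2)\,\mathrm{sn}^2(\nu x;\kappa)},\qquad 4\nu^2=(u_1-u_3)(u_2-u_4),\quad 4\nu^2\kappa^2=(u_1-u_2)(u_3-u_4),$$ with $\nu>0$, $\kappa\in(0,1)$, let $u(x,t)=u(x-ct)$ be the corresponding travelling wave of the mKdV equation, and let $\lambda_1=\frac12(u_1+u_2)$, $\lambda_2=\frac12(u_1+u_3)$, $\lambda_3=\frac12(u_2+u_3)$. Assume the three non-degeneracy conditions $$\oint\frac{\lambda_1^2(u_1u_2+u_3u_4+2u^2)}{(e+4\lambda_1^2u)^2}dy\ne0,\quad \oint\frac{\lambda_2^2(u_1u_3+u_2u_4+2u^2)}{(e+4\lambda_2^2u)^2}dy\ne0,\quad \oint\frac{\lambda_3^2(u_1u_4+u_2u_3+2u^2)}{(e+4\lambda_3^2u)^2}dy\ne0 .$$ Then there exist $c_1,c_2,c_3\ne c$ such that for each $j=1,2,3$ the second solution to the Lax system for the eigenvalue $\lambda_j$ is linearly growing in $x$ and $t$ everywhere on the $(x,t)$ plane except for the straight line $x-c_jt=\xi_j$, where $\xi_1,\xi_2,\xi_3$ are phase parameters which are not uniquely defined. Moreover: (1) for each $j$, the one-fold Darboux transformation with the second solution for $\lambda_j$ adds an algebraic soliton with speed $c_j$ on the background of the periodic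 wave $u$ transformed by the symmetry $(Sj)$ and the reflection $u\mapsto-u$; (2) the two-fold Darboux transformation with the second solutions for any two eigenvalues $\lambda_i,\lambda_j$, $i\ne j$, adds two algebraic solitons with the wave speeds $c_i,c_j$ on the background of the periodic wave $u$ transformed by the complementary symmetry $(Sk)$, $\{i,j,k\}=\{1,2,3\}$; (3) the three-fold Darboux transformation with the second solutions for all three eigenvalues adds three algebraic solitons with the wave speeds $c_1,c_2,c_3$ on the background of the periodic wave $u$ reflected with $u\mapsto-u$.
   Context: $\mathrm{sn}(\cdot;\kappa)$ is the Jacobian elliptic function with modulus $\kappa$; $\oint$ denotes the mean value of the integrand over one period of the periodic profile $u(y)$. The symmetry transformations are exchanges of parameters in the formula for $u$: $(S1)$ $u_1\leftrightarrow u_2$, $u_3\leftrightarrow u_4$; $(S2)$ $u_1\leftrightarrow u_3$, $u_2\leftrightarrow u_4$; $(S3)$ $u_1\leftrightarrow u_4$, $u_2\leftrightarrow u_3$. The mKdV equation is $u_t+6u^2u_x+u_{xxx}=0$. Put $c=-(u_1u_2+u_1u_3+u_1u_4+u_2u_3+u_2u_4+u_3u_4)$ and $2e=u_1u_2u_3+u_1u_2u_4+u_1u_3u_4+u_2u_3u_4$. The Lax system is $\varphi_x=\begin{pmatrix}\lambda&u\\-u&-\lambda\end{pmatrix}\varphi$ and $$\varphi_t=\begin{pmatrix}-4\lambda^3-2\lambda u^2&-4\lambda^2u-2\lambda u_x-2u^3-u_{xx}\\4\lambda^2u-2\lambda u_x+2u^3+u_{xx}&4\lambda^3+2\lambda u^2\end{pmatrix}\varphi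 .$$ For $\lambda=\lambda_j$ it has a bounded solution $(p_j,q_j)^t$ depending on $x-ct$ only (the "periodic eigenfunction"), real, with $$p_j^2+q_j^2=m_j(e+4\lambda_j^2u),\quad p_j^2-q_j^2=2m_j\lambda_ju_x,\quad 2p_jq_j=m_j\lambda_j(c-4\lambda_j^2-2u^2)$$ for a nonzero constant $m_j$. The second solution for $\lambda_j$ is the linearly independent solution normalized by $p_j\hat q_j-\hat p_jq_j=2$, namely $$\hat p_j=p_j\phi_j-\frac{2q_j}{p_j^2+q_j^2},\quad \hat q_j=q_j\phi_j+\frac{2p_j}{p_j^2+q_j^2},\quad \phi_j(x,t)=-\frac4{m_j}\left[\lambda_j^2\int_0^{x-ct}\frac{c-4\lambda_j^2-2u(y)^2}{(e+4\lambda_j^2u(y))^2}dy+t+\psi_j\right],$$ with a real constant $\psi_j$. "Linearly growing everywhere except for the line $x-c_jt=\xi_j$" means that $(\hat p_j,\hat q_j)$ grows linearly along every ray of the $(x,t)$ plane not parallel to this line and remains bounded on the line. Darboux transformations of $u$ with solutions $(p_j,q_j)$ of the Lax system for $\lambda_j$ (to be applied with $(\hat p_j,\hat q_j)$ in place of $(p_j,q_j)$; indices stand for the chosen eigenvalues): one-fold $u+\frac{4\lambda_1p_1q_1}{p_1^2+q_1^2}$; two-fold $$u+\frac{4(\lambda_1^2-\lambda_2^2)[\lambda_1p_1q_1(p_2^2+q_2^2)-\lambda_2p_2q_2(p_1^2+q_1^2)]}{(\lambda_1^2+\lambda_2^2)(p_1^2+q_1^2)(p_2^2+q_2^2)-2\lambda_1\lambda_2[4p_1q_1p_2q_2+(p_1^2-q_1^2)(p_2^2-q_2^2)]};$$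 three-fold $u+4N/D$ with $$\begin{aligned}N=&(\lambda_3^2-\lambda_1^2)(\lambda_3^2-\lambda_2^2)\lambda_3p_3q_3[(\lambda_1^2+\lambda_2^2)(p_1^2+q_1^2)(p_2^2+q_2^2)-2\lambda_1\lambda_2(p_1^2-q_1^2)(p_2^2-q_2^2)]\\&+(\lambda_2^2-\lambda_1^2)(\lambda_2^2-\lambda_3^2)\lambda_2p_2q_2[(\lambda_1^2+\lambda_3^2)(p_1^2+q_1^2)(p_3^2+q_3^2)-2\lambda_1\lambda_3(p_1^2-q_1^2)(p_3^2-q_3^2)]\\&+(\lambda_1^2-\lambda_2^2)(\lambda_1^2-\lambda_3^2)\lambda_1p_1q_1[(\lambda_2^2+\lambda_3^2)(p_2^2+q_2^2)(p_3^2+q_3^2)-2\lambda_2\lambda_3(p_2^2-q_2^2)(p_3^2-q_3^2)]\\&-8(\lambda_1^4+\lambda_2^4+\lambda_3^4-\lambda_1^2\lambda_2^2-\lambda_1^2\lambda_3^2-\lambda_2^2\lambda_3^2)\lambda_1\lambda_2\lambda_3p_1p_2p_3q_1q_2q_3,\end{aligned}$$ $$\begin{aligned}D=&(\lambda_1+\lambda_2)^2(\lambda_1+\lambda_3)^2(\lambda_2-\lambda_3)^2(p_1^2q_2^2q_3^2+q_1^2p_2^2p_3^2)+(\lambda_1+\lambda_2)^2(\lambda_2+\lambda_3)^2(\lambda_1-\lambda_3)^2(p_2^2q_1^2q_3^2+q_2^2p_1^2p_3^2)\\&+(\lambda_1+\lambda_3)^2(\lambda_2+\lambda_3)^2(\lambda_1-\lambda_2)^2(p_3^2q_1^2q_2^2+q_3^2p_1^2p_2^2)+(\lambda_1-\lambda_2)^2(\lambda_1-\lambda_3)^2(\lambda_2-\lambda_3)^2(p_1^2p_2^2p_3^2+q_1^2q_2^2q_3^2)\\&-8(\lambda_3^2-\lambda_1^2)(\lambda_3^2-\lambda_2^2)\lambda_1\lambda_2p_1p_2q_1q_2(p_3^2+q_3^2)-8(\lambda_2^2-\lambda_1^2)(\lambda_2^2-\lambda_3^2)\lambda_1\lambda_3p_1p_3q_1q_3(p_2^2+q_2^2)\\&-8(\lambda_1^2-\lambda_2^2)(\lambda_1^2-\lambda_3^2)\lambda_2\lambda_3p_2p_3q_2q_3(p_1^2+q_1^2).\end{aligned}$$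 A transformation "adds algebraic solitons with given speeds on the background $\tilde u$" means: the new mKdV solution $\hat u(x,t)$ approaches $\tilde u(x-ct)$ as $|x|+|t|\to\infty$ everywhere on the $(x,t)$ plane except along the corresponding lines $x-c_jt=\xi_j$ (that is, $\hat u-\tilde u\to0$ as the distances to all these lines tend to infinity), whereas $\hat u-\tilde u$ does not tend to zero uniformly on sufficiently wide strips of bounded width around each of these lines as $|t|\to\infty$. *)

theory Defs
  imports "HOL-Analysis.Analysis" "HOL-Library.Landau_Symbols"
begin

section \<open>Jacobian elliptic sine\<close>

text \<open>
  All elliptic functions take the modulus \<open>\<kappa>\<close> (not the parameter \<open>\<kappa>\<^sup>2\<close>) and are meant for
  \<open>0 < \<kappa> < 1\<close>; then \<open>elliptic_F \<kappa>\<close> is an increasing bijection of the real line, so the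
  definite description in the amplitude is proper. The integrals \<open>LBINT y=a..b\<close> are oriented.
\<close>

definition elliptic_F :: "real \<Rightarrow> real \<Rightarrow> real" where
  "elliptic_F \<kappa> \<phi> = (LBINT \<theta>=0..\<phi>. 1 / sqrt (1 - \<kappa>\<^sup>2 * (sin \<theta>)\<^sup>2))"

definition elliptic_K :: "real \<Rightarrow> real" where
  "elliptic_K \<kappa> = elliptic_F \<kappa> (pi / 2)"

definition jacobi_am :: "real \<Rightarrow> real \<Rightarrow> real" where
  "jacobi_am \<kappa> x = (THE \<phi>. elliptic_F \<kappa> \<phi> = x)"

definition jacobi_sn :: "real \<Rightarrow> real \<Rightarrow> real" where
  "jacobi_sn \<kappa> x = sin (jacobi_am \<kappa> x)"


section \<open>The periodic wave\<close>

definition wave_\<nu> :: "real \<Rightarrow> real \<Rightarrow> real \<Rightarrow> real \<Rightarrow> real" where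
  "wave_\<nu> u1 u2 u3 u4 = sqrt ((u1 - u3) * (u2 - u4)) / 2"

definition wave_\<kappa> :: "real \<Rightarrow> real \<Rightarrow> real \<Rightarrow> real \<Rightarrow> real" where
  "wave_\<kappa> u1 u2 u3 u4 = sqrt ((u1 - u2) * (u3 - u4) / ((u1 - u3) * (u2 - u4)))"

definition wave :: "real \<Rightarrow> real \<Rightarrow> real \<Rightarrow> real \<Rightarrow> real \<Rightarrow> real" where
  "wave u1 u2 u3 u4 x =
     u4 + (u1 - u4) * (u2 - u4) /
       ((u2 - u4) + (u1 - u2) *
          (jacobi_sn (wave_\<kappa> u1 u2 u3 u4) (wave_\<nu> u1 u2 u3 u4 * x))\<^sup>2)"

text \<open>\<open>sn\<close> has period \<open>4 K\<close>, but \<open>sn\<^sup>2\<close>, hence the wave, has period \<open>2 K\<close> in \<open>\<nu> x\<close>.\<close>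

definition wave_period :: "real \<Rightarrow> real \<Rightarrow> real \<Rightarrow> real \<Rightarrow> real" where
  "wave_period u1 u2 u3 u4 = 2 * elliptic_K (wave_\<kappa> u1 u2 u3 u4) / wave_\<nu> u1 u2 u3 u4"

definition period_mean :: "real \<Rightarrow> (real \<Rightarrow> real) \<Rightarrow> real" where
  "period_mean L f = (LBINT y=0..L. f y) / L"

definition wave_c :: "real \<Rightarrow> real \<Rightarrow> real \<Rightarrow> real \<Rightarrow> real" where
  "wave_c u1 u2 u3 u4 = - (u1*u2 + u1*u3 + u1*u4 + u2*u3 + u2*u4 + u3*u4)"

definition wave_e :: "real \<Rightarrow> real \<Rightarrow> real \<Rightarrow> real \<Rightarrow> real" where
  "wave_e u1 u2 u3 u4 = (u1*u2*u3 + u1*u2*u4 + u1*u3*u4 + u2*u3*u4) / 2"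

text \<open>
  The wave transformed by the symmetry \<open>(S1)\<close>, \<open>(S2)\<close> or \<open>(S3)\<close>; only the indices 1, 2, 3 are
  meaningful. The products defining \<open>\<nu>\<close> and \<open>\<kappa>\<close> are invariant under these exchanges.
\<close>

definition sym_wave :: "nat \<Rightarrow> real \<Rightarrow> real \<Rightarrow> real \<Rightarrow> real \<Rightarrow> real \<Rightarrow> real" where
  "sym_wave k u1 u2 u3 u4 =
     (if k = 1 then wave u2 u1 u4 u3
      else if k = 2 then wave u3 u4 u1 u2
      else wave u4 u3 u2 u1)"


section \<open>The mKdV equation and its Lax system\<close>

text \<open>Functions of \<open>(x, t)\<close> are curried, with \<open>x\<close> as the first argument.\<close>

definition mkdv_solution :: "(real \<Rightarrow> real \<Rightarrow> real) \<Rightarrow> bool" where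
  "mkdv_solution w \<longleftrightarrow>
     (\<exists>wt wx wxx wxxx. \<forall>x t.
        ((\<lambda>s. w x s) has_real_derivative wt x t) (at t) \<and>
        ((\<lambda>y. w y t) has_real_derivative wx x t) (at x) \<and>
        ((\<lambda>y. wx y t) has_real_derivative wxx x t) (at x) \<and>
        ((\<lambda>y. wxx y t) has_real_derivative wxxx x t) (at x) \<and>
        wt x t + 6 * (w x t)\<^sup>2 * wx x t + wxxx x t = 0)"

definition lax_solution ::
  "(real \<Rightarrow> real \<Rightarrow> real) \<Rightarrow> real \<Rightarrow> (real \<Rightarrow> real \<Rightarrow> real) \<Rightarrow> (real \<Rightarrow> real \<Rightarrow> real) \<Rightarrow> bool" where
  "lax_solution u lam p q \<longleftrightarrow>
     (\<forall>x t. let v = u x t; vx = deriv (\<lambda>y. u y t) x; vxx = deriv (deriv (\<lambda>y. u y t)) x in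
        ((\<lambda>y. p y t) has_real_derivative lam * p x t + v * q x t) (at x) \<and>
        ((\<lambda>y. q y t) has_real_derivative - v * p x t - lam * q x t) (at x) \<and>
        ((\<lambda>s. p x s) has_real_derivative
            (- 4 * lam^3 - 2 * lam * v\<^sup>2) * p x t
            + (- 4 * lam\<^sup>2 * v - 2 * lam * vx - 2 * v^3 - vxx) * q x t) (at t) \<and>
        ((\<lambda>s. q x s) has_real_derivative
            (4 * lam\<^sup>2 * v - 2 * lam * vx + 2 * v^3 + vxx) * p x t
            + (4 * lam^3 + 2 * lam * v\<^sup>2) * q x t) (at t))"

text \<open>
  In the next two definitions \<open>u\<close>, \<open>P\<close>, \<open>Q\<close> are profiles, that is, functions of \<open>x - c t\<close>.
  The constant \<open>m\<close> is only determined up to a positive factor, and \<open>(P, Q)\<close> up to a sign.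
\<close>

definition periodic_eigenfunction ::
  "(real \<Rightarrow> real) \<Rightarrow> real \<Rightarrow> real \<Rightarrow> real \<Rightarrow> real \<Rightarrow> (real \<Rightarrow> real) \<Rightarrow> (real \<Rightarrow> real) \<Rightarrow> bool" where
  "periodic_eigenfunction u c e lam m P Q \<longleftrightarrow>
     m \<noteq> 0 \<and> bounded (range P) \<and> bounded (range Q) \<and>
     lax_solution (\<lambda>x t. u (x - c * t)) lam (\<lambda>x t. P (x - c * t)) (\<lambda>x t. Q (x - c * t)) \<and>
     (\<forall>z. (P z)\<^sup>2 + (Q z)\<^sup>2 = m * (e + 4 * lam\<^sup>2 * u z) \<and>
          (P z)\<^sup>2 - (Q z)\<^sup>2 = 2 * m * lam * deriv u z \<and>
          2 * P z * Q z = m * lam * (c - 4 * lam\<^sup>2 - 2 * (u z)\<^sup>2))"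

text \<open>
  The second solution, linearly independent of \<open>(P, Q)\<close> since \<open>p q\<^sub>2 - p\<^sub>2 q = 2\<close> holds for it
  identically. Neither \<open>m\<close> nor the phase \<open>\<psi>\<close> is prescribed.
\<close>

definition second_solution ::
  "(real \<Rightarrow> real) \<Rightarrow> real \<Rightarrow> real \<Rightarrow> real \<Rightarrow>
     (real \<Rightarrow> real \<Rightarrow> real) \<Rightarrow> (real \<Rightarrow> real \<Rightarrow> real) \<Rightarrow> bool" where
  "second_solution u c e lam p\<^sub>2 q\<^sub>2 \<longleftrightarrow>
     (\<exists>m P Q \<psi>. periodic_eigenfunction u c e lam m P Q \<and>
       (\<forall>x t. let p = P (x - c * t); q = Q (x - c * t);
                  \<phi> = - (4 / m) *
                    (lam\<^sup>2 * (LBINT y=0..x - c * t.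
                        (c - 4 * lam\<^sup>2 - 2 * (u y)\<^sup>2) / (e + 4 * lam\<^sup>2 * u y)\<^sup>2)
                     + t + \<psi>)
              in p\<^sub>2 x t = p * \<phi> - 2 * q / (p\<^sup>2 + q\<^sup>2) \<and>
                 q\<^sub>2 x t = q * \<phi> + 2 * p / (p\<^sup>2 + q\<^sup>2)))"

text \<open>
  A ray starting at \<open>(x0, t0)\<close> in direction \<open>(a, b)\<close> is not parallel to the line
  \<open>x - s t = \<xi>\<close> iff \<open>a - s b \<noteq> 0\<close>; this also excludes the zero direction.
\<close>

definition linearly_growing_except_line ::
  "(real \<Rightarrow> real \<Rightarrow> real) \<Rightarrow> (real \<Rightarrow> real \<Rightarrow> real) \<Rightarrow> real \<Rightarrow> real \<Rightarrow> bool" where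
  "linearly_growing_except_line p q s \<xi> \<longleftrightarrow>
     (\<forall>x0 t0 a b. a - s * b \<noteq> 0 \<longrightarrow>
        (\<lambda>r. norm (p (x0 + r * a) (t0 + r * b), q (x0 + r * a) (t0 + r * b)))
          \<in> \<Theta>[at_top](\<lambda>r. r)) \<and>
     bounded {(p x t, q x t) | x t. x - s * t = \<xi>}"


section \<open>Darboux transformations\<close>

definition darboux1 :: "real \<Rightarrow> real \<Rightarrow> real \<Rightarrow> real \<Rightarrow> real" where
  "darboux1 u l1 p1 q1 = u + 4 * l1 * p1 * q1 / (p1\<^sup>2 + q1\<^sup>2)"

definition darboux2 ::
  "real \<Rightarrow> real \<Rightarrow> real \<Rightarrow> real \<Rightarrow> real \<Rightarrow> real \<Rightarrow> real \<Rightarrow> real" where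
  "darboux2 u l1 l2 p1 q1 p2 q2 =
     u + 4 * (l1\<^sup>2 - l2\<^sup>2) * (l1 * p1 * q1 * (p2\<^sup>2 + q2\<^sup>2) - l2 * p2 * q2 * (p1\<^sup>2 + q1\<^sup>2)) /
       ((l1\<^sup>2 + l2\<^sup>2) * (p1\<^sup>2 + q1\<^sup>2) * (p2\<^sup>2 + q2\<^sup>2)
        - 2 * l1 * l2 * (4 * p1 * q1 * p2 * q2 + (p1\<^sup>2 - q1\<^sup>2) * (p2\<^sup>2 - q2\<^sup>2)))"

definition darboux3_num ::
  "real \<Rightarrow> real \<Rightarrow> real \<Rightarrow> real \<Rightarrow> real \<Rightarrow> real \<Rightarrow> real \<Rightarrow> real \<Rightarrow> real \<Rightarrow> real" where
  "darboux3_num l1 l2 l3 p1 q1 p2 q2 p3 q3 =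
     (l3\<^sup>2 - l1\<^sup>2) * (l3\<^sup>2 - l2\<^sup>2) * l3 * p3 * q3 *
       ((l1\<^sup>2 + l2\<^sup>2) * (p1\<^sup>2 + q1\<^sup>2) * (p2\<^sup>2 + q2\<^sup>2) - 2 * l1 * l2 * (p1\<^sup>2 - q1\<^sup>2) * (p2\<^sup>2 - q2\<^sup>2))
   + (l2\<^sup>2 - l1\<^sup>2) * (l2\<^sup>2 - l3\<^sup>2) * l2 * p2 * q2 *
       ((l1\<^sup>2 + l3\<^sup>2) * (p1\<^sup>2 + q1\<^sup>2) * (p3\<^sup>2 + q3\<^sup>2) - 2 * l1 * l3 * (p1\<^sup>2 - q1\<^sup>2) * (p3\<^sup>2 - q3\<^sup>2))
   + (l1\<^sup>2 - l2\<^sup>2) * (l1\<^sup>2 - l3\<^sup>2) * l1 * p1 * q1 *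
       ((l2\<^sup>2 + l3\<^sup>2) * (p2\<^sup>2 + q2\<^sup>2) * (p3\<^sup>2 + q3\<^sup>2) - 2 * l2 * l3 * (p2\<^sup>2 - q2\<^sup>2) * (p3\<^sup>2 - q3\<^sup>2))
   - 8 * (l1^4 + l2^4 + l3^4 - l1\<^sup>2 * l2\<^sup>2 - l1\<^sup>2 * l3\<^sup>2 - l2\<^sup>2 * l3\<^sup>2) *
       l1 * l2 * l3 * p1 * p2 * p3 * q1 * q2 * q3"

definition darboux3_den ::
  "real \<Rightarrow> real \<Rightarrow> real \<Rightarrow> real \<Rightarrow> real \<Rightarrow> real \<Rightarrow> real \<Rightarrow> real \<Rightarrow> real \<Rightarrow> real" where
  "darboux3_den l1 l2 l3 p1 q1 p2 q2 p3 q3 =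
     (l1 + l2)\<^sup>2 * (l1 + l3)\<^sup>2 * (l2 - l3)\<^sup>2 * (p1\<^sup>2 * q2\<^sup>2 * q3\<^sup>2 + q1\<^sup>2 * p2\<^sup>2 * p3\<^sup>2)
   + (l1 + l2)\<^sup>2 * (l2 + l3)\<^sup>2 * (l1 - l3)\<^sup>2 * (p2\<^sup>2 * q1\<^sup>2 * q3\<^sup>2 + q2\<^sup>2 * p1\<^sup>2 * p3\<^sup>2)
   + (l1 + l3)\<^sup>2 * (l2 + l3)\<^sup>2 * (l1 - l2)\<^sup>2 * (p3\<^sup>2 * q1\<^sup>2 * q2\<^sup>2 + q3\<^sup>2 * p1\<^sup>2 * p2\<^sup>2)
   + (l1 - l2)\<^sup>2 * (l1 - l3)\<^sup>2 * (l2 - l3)\<^sup>2 * (p1\<^sup>2 * p2\<^sup>2 * p3\<^sup>2 + q1\<^sup>2 * q2\<^sup>2 * q3\<^sup>2)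
   - 8 * (l3\<^sup>2 - l1\<^sup>2) * (l3\<^sup>2 - l2\<^sup>2) * l1 * l2 * p1 * p2 * q1 * q2 * (p3\<^sup>2 + q3\<^sup>2)
   - 8 * (l2\<^sup>2 - l1\<^sup>2) * (l2\<^sup>2 - l3\<^sup>2) * l1 * l3 * p1 * p3 * q1 * q3 * (p2\<^sup>2 + q2\<^sup>2)
   - 8 * (l1\<^sup>2 - l2\<^sup>2) * (l1\<^sup>2 - l3\<^sup>2) * l2 * l3 * p2 * p3 * q2 * q3 * (p1\<^sup>2 + q1\<^sup>2)"

definition darboux3 ::
  "real \<Rightarrow> real \<Rightarrow> real \<Rightarrow> real \<Rightarrow> real \<Rightarrow> real \<Rightarrow> real \<Rightarrow> real \<Rightarrow> real \<Rightarrow> real \<Rightarrow> real" where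
  "darboux3 u l1 l2 l3 p1 q1 p2 q2 p3 q3 =
     u + 4 * darboux3_num l1 l2 l3 p1 q1 p2 q2 p3 q3 / darboux3_den l1 l2 l3 p1 q1 p2 q2 p3 q3"


section \<open>Algebraic solitons on a background\<close>

definition soliton_line :: "real \<Rightarrow> real \<Rightarrow> (real \<times> real) set" where
  "soliton_line s \<xi> = {(x, t). x - s * t = \<xi>}"

text \<open>
  \<open>w\<close> is the new solution, \<open>v\<close> the background (both as functions of \<open>(x, t)\<close>), and the lines
  \<open>x - s j t = \<xi> j\<close> are indexed by \<open>J\<close>. The filter \<open>at_infinity\<close> on the reals is
  \<open>\<bar>t\<bar> \<rightarrow> \<infinity>\<close>.
\<close>

definition adds_algebraic_solitons ::
  "(real \<Rightarrow> real \<Rightarrow> real) \<Rightarrow> (real \<Rightarrow> real \<Rightarrow> real) \<Rightarrow>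
     nat set \<Rightarrow> (nat \<Rightarrow> real) \<Rightarrow> (nat \<Rightarrow> real) \<Rightarrow> bool" where
  "adds_algebraic_solitons w v J s \<xi> \<longleftrightarrow>
     mkdv_solution w \<and>
     (\<forall>\<epsilon>>0. \<exists>R. \<forall>x t. (\<forall>j\<in>J. infdist (x, t) (soliton_line (s j) (\<xi> j)) > R)
        \<longrightarrow> \<bar>w x t - v x t\<bar> < \<epsilon>) \<and>
     (\<forall>j\<in>J. \<exists>d0. \<forall>d\<ge>d0.
        \<not> (\<forall>\<epsilon>>0. \<forall>\<^sub>F t in at_infinity. \<forall>x. \<bar>x - s j * t - \<xi> j\<bar> \<le> d
              \<longrightarrow> \<bar>w x t - v x t\<bar> < \<epsilon>))"

end

theory Submission
  imports Defs
begin

text \<open>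
  In terms of the double angle \<open>\<theta>\<close> of \<open>(p, q)\<close>, with \<open>cos \<theta> = (p\<^sup>2 - q\<^sup>2) / (p\<^sup>2 + q\<^sup>2)\<close> and
  \<open>sin \<theta> = 2 p q / (p\<^sup>2 + q\<^sup>2)\<close>, the one-fold Darboux transformation is \<open>u + 2 \<lambda> sin \<theta>\<close> and
  \<open>\<theta>\<^sub>x = - 2 (u + \<lambda> sin \<theta>)\<close>, so that preservation of the mKdV equation is a polynomial identity on the
  unit circle. The two- and three-fold formulas are iterates of the one-fold one.

  The second solution is the periodic eigenfunction rotated: \<open>p\<^sub>2 + i q\<^sub>2\<close> is a positive multiple of
  \<open>(p + i q) (\<tau> + i)\<close> with \<open>\<tau> = - 2 (e + 4 \<lambda>\<^sup>2 u) (\<Phi>(x - c t) + t + \<psi>)\<close>, where \<open>\<Phi>(z) = M z\<close> up to a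
  bounded term. Hence \<open>\<theta>\<close> tends to the angle of \<open>(p, q)\<close> as \<open>x - (c - 1 / M) t\<close> tends to infinity,
  which gives the speed \<open>c - 1 / M\<close> and, by a Moebius identity in \<open>u\<close>, the background. On the curve
  \<open>\<tau> = 0\<close> the direction is reversed; at the points of this curve with \<open>x - c t\<close> a multiple of
  the period all the cosines vanish and the transformed solution is \<open>u + 2 \<Sum> \<lambda>\<^sub>j sin \<theta>\<^sub>j\<close>, which
  visibly changes when one sine changes its sign.

  That curve meets the other soliton lines only in a bounded set because the three speeds differ. Indeed
  \<open>M\<^sub>j = (\<mu> - \<lambda>\<^sub>j\<^sup>2) / (4 \<Prod>\<^sub>k\<^sub>\<noteq>\<^sub>j (\<lambda>\<^sub>j\<^sup>2 - \<lambda>\<^sub>k\<^sup>2))\<close>, where \<open>\<mu>\<close> is the mean of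
  \<open>\<lambda>\<^sub>3\<^sup>2 + (\<lambda>\<^sub>2\<^sup>2 - \<lambda>\<^sub>3\<^sup>2) sn\<^sup>2\<close>, and \<open>M\<^sub>1 < 0 < M\<^sub>3 < M\<^sub>2\<close>.
\<close>

text \<open>Each Darboux formula is homogeneous of degree zero in every pair (p_j, q_j), so it is a
  function on a product of unit circles. Its normalized denominator is strictly positive there,
  which the expanded formulas hide and their factorization along Darboux steps reveals. Compactness
  then gives uniform continuity, and convergence of directions becomes uniform convergence of
  solutions. The curve on which a direction is reversed is not straight, but it stays at bounded
  distance from every line of the right slope. This is why the phases are arbitrary and why the
  strips have to be wide enough. Parametrizing by the eigenvalues instead of u1, ..., u4 removes the
  zero-sum constraint and makes the wave identities polynomial, with c = 2 (l1^2 + l2^2 + l3^2) and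
  e = -4 l1 l2 l3. The differential equation of u is not derived from sn: the three quadratic
  relations for the periodic eigenfunction force it. The delicate inequality between the slopes is
  the one between the two positive ones.\<close>

lemma DERIV_LBINT:
  fixes f :: "real \<Rightarrow> real"
  assumes "\<And>x. isCont f x"
  shows "((\<lambda>x. LBINT y=0..x. f y) has_real_derivative f x) (at x)"
proof -
  let ?a = "- \<bar>x\<bar> - 1" and ?b = "\<bar>x\<bar> + 1"
  have "((\<lambda>u. LBINT y=0..u. f y) has_vector_derivative f x) (at x within {?a..?b})"
    unfolding zero_ereal_def
    by (rule interval_integral_FTC2) (simp_all add: continuous_at_imp_continuous_on assms)
  then have "((\<lambda>u. LBINT y=0..u. f y) has_real_derivative f x) (at x within {?a..?b})"
    by (simp add: has_real_derivative_iff_has_vector_derivative)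
  moreover have "at x within {?a..?b} = at x" by (rule at_within_interior) auto
  ultimately show ?thesis by simp
qed

lemma LBINT_0 [simp]: "(LBINT y=0..ereal 0. f y) = (0::real)"
  unfolding zero_ereal_def by (rule interval_integral_endpoints_same)

lemma deriv_eq_imp_const_diff:
  fixes f g :: "real \<Rightarrow> real"
  assumes "\<And>x. (f has_real_derivative d x) (at x)"
    and "\<And>x. (g has_real_derivative d x) (at x)"
  shows "f x - f y = g x - g y"
proof -
  have "((\<lambda>x. f x - g x) has_real_derivative 0) (at x)" for x
    using DERIV_diff[OF assms(1,2)[of x]] by simp
  then have "f x - g x = f y - g y" by (intro DERIV_isconst_all[of "\<lambda>x. f x - g x"]) simp
  then show ?thesis by simp
qed

lemma periodic_add_of_nat:
  fixes f :: "real \<Rightarrow> 'a"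
  assumes "\<And>x. f (x + L) = f x"
  shows "f (x + real n * L) = f x"
proof (induction n)
  case (Suc n)
  have "f (x + real (Suc n) * L) = f ((x + real n * L) + L)" by (simp add: algebra_simps)
  then show ?case using assms Suc by simp
qed simp

lemma periodic_add_of_int:
  fixes f :: "real \<Rightarrow> 'a"
  assumes "\<And>x. f (x + L) = f x"
  shows "f (x + of_int n * L) = f x"
proof (cases "n \<ge> 0")
  case True
  then show ?thesis using periodic_add_of_nat[of f L x "nat n"] assms by simp
next
  case False
  then show ?thesis using periodic_add_of_nat[of f L "x + of_int n * L" "nat (- n)"] assms by simp
qed

lemma periodic_continuous_bounded:
  fixes f :: "real \<Rightarrow> real"
  assumes per: "\<And>x. f (x + L) = f x" and "L > 0" and cont: "\<And>x. isCont f x"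
  obtains B where "\<And>x. \<bar>f x\<bar> \<le> B"
proof -
  have "compact (f ` {0..L})"
    by (intro compact_continuous_image continuous_at_imp_continuous_on ballI cont) auto
  then obtain B where B: "\<And>y. y \<in> f ` {0..L} \<Longrightarrow> norm y \<le> B"
    using compact_imp_bounded[of "f ` {0..L}"] unfolding bounded_iff by blast
  show ?thesis
  proof
    fix x
    let ?n = "\<lfloor>x / L\<rfloor>"
    have "x + of_int (- ?n) * L \<in> {0..L}"
    proof -
      have "of_int ?n \<le> x / L" "x / L < of_int ?n + 1" by linarith+
      then show ?thesis using \<open>L > 0\<close>
        unfolding pos_le_divide_eq[OF \<open>L > 0\<close>] pos_divide_less_eq[OF \<open>L > 0\<close>]
        by (simp add: algebra_simps)
    qed
    then have "norm (f (x + of_int (- ?n) * L)) \<le> B" using B by blast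
    then show "\<bar>f x\<bar> \<le> B"
      using periodic_add_of_int[of f L x "- ?n", OF per] by simp
  qed
qed

section \<open>Jacobian elliptic functions\<close>

locale elliptic_modulus =
  fixes \<kappa> :: real
  assumes modulus: "0 < \<kappa>" "\<kappa> < 1"
begin

lemma modulus_sin_pos: "0 < 1 - \<kappa>\<^sup>2 * (sin \<theta>)\<^sup>2"
proof -
  have "\<kappa>\<^sup>2 < 1" using modulus by (simp add: power_less_one_iff)
  moreover have "\<kappa>\<^sup>2 * (sin \<theta>)\<^sup>2 \<le> \<kappa>\<^sup>2 * 1"
    by (intro mult_left_mono) (auto simp: abs_square_le_1)
  ultimately show ?thesis by simp
qed

lemma elliptic_F_deriv:
  "(elliptic_F \<kappa> has_real_derivative 1 / sqrt (1 - \<kappa>\<^sup>2 * (sin \<phi>)\<^sup>2)) (at \<phi>)"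
proof -
  have "isCont (\<lambda>\<theta>. 1 / sqrt (1 - \<kappa>\<^sup>2 * (sin \<theta>)\<^sup>2)) x" for x
    using modulus_sin_pos[of x] by (intro continuous_intros) auto
  from DERIV_LBINT[of "\<lambda>\<theta>. 1 / sqrt (1 - \<kappa>\<^sup>2 * (sin \<theta>)\<^sup>2)", OF this]
  show ?thesis unfolding elliptic_F_def .
qed

lemma elliptic_F_0 [simp]: "elliptic_F \<kappa> 0 = 0"
  unfolding elliptic_F_def by simp

text \<open>The integrand of F is at least 1. This gives strict monotonicity and unboundedness at
  once, hence the bijectivity behind the definite description in \<open>jacobi_am\<close>.\<close>

lemma elliptic_F_expanding:
  assumes "a \<le> b"
  shows "b - a \<le> elliptic_F \<kappa> b - elliptic_F \<kappa> a"
proof -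
  have "elliptic_F \<kappa> a - a \<le> elliptic_F \<kappa> b - b"
  proof (rule DERIV_nonneg_imp_nondecreasing[OF assms])
    fix x
    have "sqrt (1 - \<kappa>\<^sup>2 * (sin x)\<^sup>2) \<le> 1" by simp
    then have "1 / sqrt (1 - \<kappa>\<^sup>2 * (sin x)\<^sup>2) - 1 \<ge> 0"
      using modulus_sin_pos[of x] by (simp add: divide_simps)
    moreover have "((\<lambda>x. elliptic_F \<kappa> x - x) has_real_derivative
        1 / sqrt (1 - \<kappa>\<^sup>2 * (sin x)\<^sup>2) - 1) (at x)"
      by (intro derivative_intros elliptic_F_deriv)
    ultimately show "\<exists>y. ((\<lambda>x. elliptic_F \<kappa> x - x) has_real_derivative y) (at x) \<and> 0 \<le> y" by blast
  qed
  then show ?thesis by simp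
qed

lemma elliptic_F_strict_mono: "strict_mono (elliptic_F \<kappa>)"
proof
  fix a b :: real assume "a < b"
  then show "elliptic_F \<kappa> a < elliptic_F \<kappa> b" using elliptic_F_expanding[of a b] by linarith
qed

lemma elliptic_F_surj: "\<exists>\<phi>. elliptic_F \<kappa> \<phi> = x"
proof -
  have c: "isCont (elliptic_F \<kappa>) y" for y by (rule DERIV_isCont[OF elliptic_F_deriv])
  have "elliptic_F \<kappa> (- \<bar>x\<bar>) \<le> x" "x \<le> elliptic_F \<kappa> \<bar>x\<bar>"
    using elliptic_F_expanding[of "- \<bar>x\<bar>" 0] elliptic_F_expanding[of 0 "\<bar>x\<bar>"]
      elliptic_F_0 by linarith+
  with IVT[of "elliptic_F \<kappa>" "- \<bar>x\<bar>" x "\<bar>x\<bar>"]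
  show ?thesis using c by fastforce
qed

lemma elliptic_F_eq_iff: "elliptic_F \<kappa> a = elliptic_F \<kappa> b \<longleftrightarrow> a = b"
  by (rule strict_mono_eq[OF elliptic_F_strict_mono])

lemma am_F [simp]: "jacobi_am \<kappa> (elliptic_F \<kappa> \<phi>) = \<phi>"
  unfolding jacobi_am_def elliptic_F_eq_iff by (rule the_eq_trivial)

lemma F_am [simp]: "elliptic_F \<kappa> (jacobi_am \<kappa> x) = x"
proof -
  obtain \<phi> where "elliptic_F \<kappa> \<phi> = x" using elliptic_F_surj by blast
  then show ?thesis using am_F[of \<phi>] by simp
qed

lemma am_0 [simp]: "jacobi_am \<kappa> 0 = 0"
  using am_F[of 0] by simp

lemma am_deriv:
  "(jacobi_am \<kappa> has_real_derivative sqrt (1 - \<kappa>\<^sup>2 * (sin (jacobi_am \<kappa> x))\<^sup>2)) (at x)"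
proof -
  have "isCont (jacobi_am \<kappa>) (elliptic_F \<kappa> (jacobi_am \<kappa> x))"
    by (rule isCont_inverse_function[where f = "elliptic_F \<kappa>" and d = 1])
      (simp_all only: am_F DERIV_isCont[OF elliptic_F_deriv] zero_less_one)
  then have cont: "isCont (jacobi_am \<kappa>) x" unfolding F_am .
  have "sqrt (1 - \<kappa>\<^sup>2 * (sin (jacobi_am \<kappa> x))\<^sup>2) \<noteq> 0"
    using real_sqrt_gt_zero[OF modulus_sin_pos, of "jacobi_am \<kappa> x"] by linarith
  then have "(jacobi_am \<kappa> has_real_derivative
      inverse (1 / sqrt (1 - \<kappa>\<^sup>2 * (sin (jacobi_am \<kappa> x))\<^sup>2))) (at x)"
    using DERIV_inverse_function[where f = "elliptic_F \<kappa>" and g = "jacobi_am \<kappa>" and a = "x - 1" and b = "x + 1" and x = x,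
        OF elliptic_F_deriv _ _ _ _ cont] F_am by (simp only: divide_eq_0_iff) auto
  then show ?thesis by simp
qed

text \<open>The derivative of F is even and has period pi. So F is odd, and its increments are
  invariant under translation by pi.\<close>

lemma elliptic_F_add_pi: "elliptic_F \<kappa> (\<phi> + pi) = elliptic_F \<kappa> \<phi> + 2 * elliptic_K \<kappa>"
proof -
  have 1: "((\<lambda>x. elliptic_F \<kappa> (x + pi)) has_real_derivative 1 / sqrt (1 - \<kappa>\<^sup>2 * (sin x)\<^sup>2)) (at x)" for x
    using DERIV_shift[of "elliptic_F \<kappa>" _ x pi] elliptic_F_deriv[of "x + pi"] by simp
  have a: "elliptic_F \<kappa> (x + pi) - elliptic_F \<kappa> (y + pi) = elliptic_F \<kappa> x - elliptic_F \<kappa> y" for x y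
    using deriv_eq_imp_const_diff[OF 1 elliptic_F_deriv] .
  have 2: "((\<lambda>x. - elliptic_F \<kappa> (- x)) has_real_derivative 1 / sqrt (1 - \<kappa>\<^sup>2 * (sin x)\<^sup>2)) (at x)" for x
  proof -
    have "((\<lambda>x. elliptic_F \<kappa> (- x)) has_real_derivative
        1 / sqrt (1 - \<kappa>\<^sup>2 * (sin (- x))\<^sup>2) * (- 1)) (at x)"
      by (rule DERIV_chain2[OF elliptic_F_deriv]) (rule derivative_eq_intros refl)+
    from DERIV_minus[OF this] show ?thesis by simp
  qed
  have "elliptic_F \<kappa> (- (pi/2)) = - elliptic_F \<kappa> (pi/2)"
    using deriv_eq_imp_const_diff[OF 2 elliptic_F_deriv, of "pi/2" 0] by simp
  \<comment> \<open>In \<open>a\<close> the point -pi/2 is shifted to pi/2; by oddness the two end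
    values differ by twice the quarter period.\<close>
  moreover have "elliptic_F \<kappa> (pi/2) - elliptic_F \<kappa> (\<phi> + pi) = elliptic_F \<kappa> (- (pi/2)) - elliptic_F \<kappa> \<phi>"
    using a[of "-(pi/2)" \<phi>] by simp
  ultimately show ?thesis unfolding elliptic_K_def by simp
qed

lemma am_add_2K: "jacobi_am \<kappa> (x + 2 * elliptic_K \<kappa>) = jacobi_am \<kappa> x + pi"
  using am_F[of "jacobi_am \<kappa> x + pi"] unfolding elliptic_F_add_pi by simp

lemma elliptic_K_pos: "elliptic_K \<kappa> > 0"
  using elliptic_F_strict_mono[THEN strict_monoD, of 0 "pi/2"] unfolding elliptic_K_def by simp

definition "cn x = cos (jacobi_am \<kappa> x)"
definition "dn x = sqrt (1 - \<kappa>\<^sup>2 * (jacobi_sn \<kappa> x)\<^sup>2)"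

lemma dn_pos: "dn x > 0"
  unfolding dn_def jacobi_sn_def by (rule real_sqrt_gt_zero[OF modulus_sin_pos])

lemma dn_sq: "(dn x)\<^sup>2 = 1 - \<kappa>\<^sup>2 * (jacobi_sn \<kappa> x)\<^sup>2"
  unfolding dn_def jacobi_sn_def by (rule real_sqrt_pow2[OF less_imp_le[OF modulus_sin_pos]])

lemma cn_sq: "(cn x)\<^sup>2 = 1 - (jacobi_sn \<kappa> x)\<^sup>2"
  unfolding cn_def jacobi_sn_def by (simp add: cos_squared_eq)

lemma sn_deriv: "(jacobi_sn \<kappa> has_real_derivative cn x * dn x) (at x)"
  unfolding jacobi_sn_def[abs_def] cn_def dn_def
  by (rule DERIV_chain2[OF DERIV_sin am_deriv])

lemma cn_deriv: "(cn has_real_derivative - jacobi_sn \<kappa> x * dn x) (at x)"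
  unfolding jacobi_sn_def cn_def[abs_def] dn_def
  by (rule DERIV_chain2[OF DERIV_cos am_deriv])

lemma dn_deriv: "(dn has_real_derivative - \<kappa>\<^sup>2 * jacobi_sn \<kappa> x * cn x) (at x)"
proof -
  have pos: "0 < 1 - \<kappa>\<^sup>2 * (jacobi_sn \<kappa> x)\<^sup>2"
    unfolding jacobi_sn_def by (rule modulus_sin_pos)
  have "((\<lambda>x. 1 - \<kappa>\<^sup>2 * (jacobi_sn \<kappa> x)\<^sup>2) has_real_derivative
      - (\<kappa>\<^sup>2 * (2 * jacobi_sn \<kappa> x * (cn x * dn x)))) (at x)"
    by (rule derivative_eq_intros sn_deriv refl)+ simp
  from DERIV_chain2[OF DERIV_real_sqrt[OF pos] this]
  show ?thesis
    using dn_pos[of x] unfolding dn_def[symmetric] dn_def[abs_def, symmetric]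
    by (simp add: field_simps)
qed

lemma sn_add_2K: "jacobi_sn \<kappa> (x + 2 * elliptic_K \<kappa>) = - jacobi_sn \<kappa> x"
  unfolding jacobi_sn_def am_add_2K by simp

lemma cn_add_2K: "cn (x + 2 * elliptic_K \<kappa>) = - cn x"
  unfolding cn_def am_add_2K by simp

lemma dn_add_2K: "dn (x + 2 * elliptic_K \<kappa>) = dn x"
  unfolding dn_def sn_add_2K by simp

lemma sn_0 [simp]: "jacobi_sn \<kappa> 0 = 0"
  unfolding jacobi_sn_def by simp

lemma sn_sq_le_1: "(jacobi_sn \<kappa> x)\<^sup>2 \<le> 1"
  unfolding jacobi_sn_def by (simp add: abs_square_le_1)

end

section \<open>Darboux transformations\<close>

text \<open>If p + i q has argument theta / 2, then \<open>sig\<close> is sin theta and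
  \<open>gam\<close> is cos theta. At p = q = 0 both are 0 by division, so the circle law needs a
  nonzero vector.\<close>

definition sig :: "real \<Rightarrow> real \<Rightarrow> real" where
  "sig p q = 2 * p * q / (p\<^sup>2 + q\<^sup>2)"

definition gam :: "real \<Rightarrow> real \<Rightarrow> real" where
  "gam p q = (p\<^sup>2 - q\<^sup>2) / (p\<^sup>2 + q\<^sup>2)"

lemma sig_gam_circle:
  assumes "p\<^sup>2 + q\<^sup>2 \<noteq> 0"
  shows "(gam p q)\<^sup>2 + (sig p q)\<^sup>2 = 1"
proof -
  have "(p\<^sup>2 - q\<^sup>2)\<^sup>2 + (2 * p * q)\<^sup>2 = (p\<^sup>2 + q\<^sup>2)\<^sup>2" by algebra
  then show ?thesis
    unfolding sig_def gam_def power_divide add_divide_distrib[symmetric] using assms by simp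
qed

section \<open>One Darboux step for the mKdV equation and its Lax system\<close>

text \<open>The derivatives are explicit arguments because a Lax system contains u_x and u_xx: the
  next Darboux step must be able to name those of the transformed solution.\<close>

definition jet_solution ::
  "(real \<Rightarrow> real \<Rightarrow> real) \<Rightarrow> (real \<Rightarrow> real \<Rightarrow> real) \<Rightarrow> (real \<Rightarrow> real \<Rightarrow> real) \<Rightarrow>
    (real \<Rightarrow> real \<Rightarrow> real) \<Rightarrow> (real \<Rightarrow> real \<Rightarrow> real) \<Rightarrow> bool" where
  "jet_solution w wt wx wxx wxxx \<longleftrightarrow>
     (\<forall>x t.
        ((\<lambda>s. w x s) has_real_derivative wt x t) (at t) \<and>
        ((\<lambda>y. w y t) has_real_derivative wx x t) (at x) \<and>
        ((\<lambda>y. wx y t) has_real_derivative wxx x t) (at x) \<and>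
        ((\<lambda>y. wxx y t) has_real_derivative wxxx x t) (at x) \<and>
        wt x t + 6 * (w x t)\<^sup>2 * wx x t + wxxx x t = 0)"

lemma mkdv_solution_iff_jet: "mkdv_solution w \<longleftrightarrow> (\<exists>wt wx wxx wxxx. jet_solution w wt wx wxx wxxx)"
  unfolding mkdv_solution_def jet_solution_def ..

lemma lax_solution_jet:
  assumes "jet_solution u ut ux uxx uxxx"
  shows "lax_solution u l p q \<longleftrightarrow> (\<forall>x t.
        ((\<lambda>y. p y t) has_real_derivative l * p x t + u x t * q x t) (at x) \<and>
        ((\<lambda>y. q y t) has_real_derivative - u x t * p x t - l * q x t) (at x) \<and>
        ((\<lambda>s. p x s) has_real_derivative
            (- 4 * l^3 - 2 * l * (u x t)\<^sup>2) * p x t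
            + (- 4 * l\<^sup>2 * u x t - 2 * l * ux x t - 2 * (u x t)^3 - uxx x t) * q x t) (at t) \<and>
        ((\<lambda>s. q x s) has_real_derivative
            (4 * l\<^sup>2 * u x t - 2 * l * ux x t + 2 * (u x t)^3 + uxx x t) * p x t
            + (4 * l^3 + 2 * l * (u x t)\<^sup>2) * q x t) (at t))"
proof -
  have 1: "deriv (\<lambda>y. u y t) = (\<lambda>y. ux y t)" for t
    using assms unfolding jet_solution_def by (intro ext DERIV_imp_deriv) blast
  have 2: "deriv (\<lambda>y. ux y t) x = uxx x t" for x t
    using assms unfolding jet_solution_def by (intro DERIV_imp_deriv) blast
  show ?thesis unfolding lax_solution_def Let_def 1 2 ..
qed

locale darboux_step =
  fixes u ut ux uxx uxxx p q :: "real \<Rightarrow> real \<Rightarrow> real" and l :: real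
  assumes jet: "jet_solution u ut ux uxx uxxx"
    and lax: "lax_solution u l p q"
    and nz: "\<And>x t. (p x t)\<^sup>2 + (q x t)\<^sup>2 \<noteq> 0"
begin

abbreviation "S x t \<equiv> sig (p x t) (q x t)"
abbreviation "C x t \<equiv> gam (p x t) (q x t)"
text \<open>Rates of the double angle theta: the lemmas \<open>S_x\<close> to \<open>C_t\<close> say
  theta_x = -2 \<open>g\<close> and theta_t = \<open>R\<close>.\<close>

abbreviation "g x t \<equiv> u x t + l * S x t"
abbreviation "R x t \<equiv> - 4 * l * ux x t * C x t + 8 * l\<^sup>2 * u x t + 4 * (u x t)^3 + 2 * uxx x t
    + 2 * (4 * l^3 + 2 * l * (u x t)\<^sup>2) * S x t"

lemmas jets = jet[unfolded jet_solution_def, rule_format]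
lemmas laxs = lax[unfolded lax_solution_jet[OF jet], rule_format]

lemma ux_deriv: "((\<lambda>y. u y t) has_real_derivative ux x t) (at x)"
  and uxx_deriv: "((\<lambda>y. ux y t) has_real_derivative uxx x t) (at x)"
  and uxxx_deriv: "((\<lambda>y. uxx y t) has_real_derivative uxxx x t) (at x)"
  and ut_deriv: "((\<lambda>s. u x s) has_real_derivative ut x t) (at t)"
  and mkdv: "ut x t + 6 * (u x t)\<^sup>2 * ux x t + uxxx x t = 0"
  using jets by blast+

lemma circ: "(C x t)\<^sup>2 + (S x t)\<^sup>2 = 1"
  by (rule sig_gam_circle[OF nz])

lemma S_x: "((\<lambda>y. S y t) has_real_derivative - 2 * C x t * g x t) (at x)"
proof -
  note d [derivative_intros] = conjunct1[OF laxs] conjunct1[OF conjunct2[OF laxs]]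
  show ?thesis
    unfolding sig_def gam_def
    apply (rule derivative_eq_intros refl nz)+
    using nz[of x t]
    apply (simp add: divide_simps power2_eq_square)
    apply algebra
    done
qed

lemma C_x: "((\<lambda>y. C y t) has_real_derivative 2 * S x t * g x t) (at x)"
proof -
  note d [derivative_intros] = conjunct1[OF laxs] conjunct1[OF conjunct2[OF laxs]]
  show ?thesis
    unfolding sig_def gam_def
    apply (rule derivative_eq_intros refl nz)+
    using nz[of x t]
    apply (simp add: divide_simps power2_eq_square)
    apply algebra
    done
qed

lemma S_t: "((\<lambda>s. S x s) has_real_derivative C x t * R x t) (at t)"
proof -
  note d [derivative_intros] = conjunct1[OF conjunct2[OF conjunct2[OF laxs]]] conjunct2[OF conjunct2[OF conjunct2[OF laxs]]]
  show ?thesis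
    unfolding sig_def gam_def
    apply (rule derivative_eq_intros refl nz)+
    using nz[of x t]
    apply (simp add: divide_simps power2_eq_square power3_eq_cube)
    apply algebra
    done
qed

lemma C_t: "((\<lambda>s. C x s) has_real_derivative - S x t * R x t) (at t)"
proof -
  note d [derivative_intros] = conjunct1[OF conjunct2[OF conjunct2[OF laxs]]] conjunct2[OF conjunct2[OF conjunct2[OF laxs]]]
  show ?thesis
    unfolding sig_def gam_def
    apply (rule derivative_eq_intros refl nz)+
    using nz[of x t]
    apply (simp add: divide_simps power2_eq_square power3_eq_cube)
    apply algebra
    done
qed

text \<open>\<open>v\<close> is the one-fold transform and the others are its derivatives, computed
  with theta_x = -2 \<open>g\<close>; the recurring bracket
  \<open>ux x t - 2 * l * C x t * g x t\<close> is the x-derivative of \<open>g\<close>.\<close>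

definition "v x t = u x t + 2 * l * S x t"
definition "vx x t = ux x t - 4 * l * C x t * g x t"
definition "vxx x t = uxx x t - 4 * l * (2 * S x t * (g x t)\<^sup>2 + C x t * (ux x t - 2 * l * C x t * g x t))"
definition "vxxx x t = uxxx x t - 4 * l *
  (- 4 * C x t * (g x t)^3 + 4 * S x t * g x t * (ux x t - 2 * l * C x t * g x t)
   + 2 * S x t * g x t * (ux x t - 2 * l * C x t * g x t)
   + C x t * (uxx x t - 2 * l * (2 * S x t * (g x t)\<^sup>2 + C x t * (ux x t - 2 * l * C x t * g x t))))"
definition "vt x t = ut x t + 2 * l * C x t * R x t"

lemma jet_v: "jet_solution v vt vx vxx vxxx"
  unfolding jet_solution_def
proof (intro allI conjI)
  fix x t
  note d [derivative_intros] = S_x C_x ux_deriv uxx_deriv uxxx_deriv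
  show "((\<lambda>s. v x s) has_real_derivative vt x t) (at t)"
    unfolding v_def vt_def
    by (rule derivative_eq_intros refl S_t ut_deriv)+ (simp add: algebra_simps)
  show "((\<lambda>y. v y t) has_real_derivative vx x t) (at x)"
    unfolding v_def vx_def
    by (rule derivative_eq_intros refl)+ (simp add: algebra_simps)
  show "((\<lambda>y. vx y t) has_real_derivative vxx x t) (at x)"
    unfolding vx_def vxx_def
    by (rule derivative_eq_intros refl)+ algebra
  show "((\<lambda>y. vxx y t) has_real_derivative vxxx x t) (at x)"
    unfolding vxx_def vxxx_def
    apply (rule derivative_eq_intros refl)+
    apply simp
    apply algebra
    done
  \<comment> \<open>The equation for u eliminates u_xxx; what remains is a polynomial consequence of
    the circle law.\<close>
  have "uxxx x t = - ut x t - 6 * (u x t)\<^sup>2 * ux x t" using mkdv[of x t] by simp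
  with circ[of x t]
  show "vt x t + 6 * (v x t)\<^sup>2 * vx x t + vxxx x t = 0"
    unfolding v_def vt_def vx_def vxxx_def
    by algebra
qed

text \<open>The Darboux matrix \<open>k - l R\<close>, where \<open>R\<close> is the reflection with \<open>R (p, q) = (p, q)\<close>; its
  determinant is \<open>k\<^sup>2 - l\<^sup>2\<close>.\<close>

definition "Tp k a b x t = (k - l * C x t) * a x t - l * S x t * b x t"
definition "Tq k a b x t = - l * S x t * a x t + (k + l * C x t) * b x t"

text \<open>The Darboux matrix intertwines the Lax systems of u and v for every spectral parameter
  k. The remaining eigenfunctions can thus be carried along, and a further Darboux step can start
  from v.\<close>

lemma lax_T:
  assumes "lax_solution u k a b"
  shows "lax_solution v k (Tp k a b) (Tq k a b)"
  unfolding lax_solution_jet[OF jet_v]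
proof (intro allI conjI)
  fix x t
  note L = assms[unfolded lax_solution_jet[OF jet], rule_format]
  note d [derivative_intros] = S_x C_x conjunct1[OF L] conjunct1[OF conjunct2[OF L]]
  note dt [derivative_intros] = S_t C_t conjunct1[OF conjunct2[OF conjunct2[OF L]]]
    conjunct2[OF conjunct2[OF conjunct2[OF L]]]
  show "((\<lambda>y. Tp k a b y t) has_real_derivative
      k * Tp k a b x t + v x t * Tq k a b x t) (at x)"
    unfolding Tp_def Tq_def v_def
    by (rule derivative_eq_intros refl)+ (simp add: algebra_simps)
  show "((\<lambda>y. Tq k a b y t) has_real_derivative
      - v x t * Tp k a b x t - k * Tq k a b x t) (at x)"
    unfolding Tp_def Tq_def v_def
    by (rule derivative_eq_intros refl)+ (simp add: algebra_simps)
  show "((\<lambda>s. Tp k a b x s) has_real_derivative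
      (- 4 * k^3 - 2 * k * (v x t)\<^sup>2) * Tp k a b x t
        + (- 4 * k\<^sup>2 * v x t - 2 * k * vx x t - 2 * (v x t)^3 - vxx x t) * Tq k a b x t) (at t)"
    unfolding Tp_def Tq_def v_def vx_def vxx_def
    apply (rule derivative_eq_intros refl)+
    using circ[of x t] apply algebra
    done
  show "((\<lambda>s. Tq k a b x s) has_real_derivative
      (4 * k\<^sup>2 * v x t - 2 * k * vx x t + 2 * (v x t)^3 + vxx x t) * Tp k a b x t
        + (4 * k^3 + 2 * k * (v x t)\<^sup>2) * Tq k a b x t) (at t)"
    unfolding Tp_def Tq_def v_def vx_def vxx_def
    apply (rule derivative_eq_intros refl)+
    using circ[of x t] apply algebra
    done
qed

text \<open>As R^2 = 1, the product of k + l R and k - l R is the scalar k^2 - l^2. So the Darboux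
  matrix has trivial kernel whenever k^2 and l^2 differ.\<close>

lemma T_inverse:
  "(k + l * C x t) * Tp k a b x t + l * S x t * Tq k a b x t = (k\<^sup>2 - l\<^sup>2) * a x t"
  "l * S x t * Tp k a b x t + (k - l * C x t) * Tq k a b x t = (k\<^sup>2 - l\<^sup>2) * b x t"
  unfolding Tp_def Tq_def using circ[of x t] by algebra+

lemma T_nonzero:
  assumes "k\<^sup>2 \<noteq> l\<^sup>2" and "(a x t)\<^sup>2 + (b x t)\<^sup>2 \<noteq> 0"
  shows "(Tp k a b x t)\<^sup>2 + (Tq k a b x t)\<^sup>2 \<noteq> 0"
proof
  assume "(Tp k a b x t)\<^sup>2 + (Tq k a b x t)\<^sup>2 = 0"
  then have "Tp k a b x t = 0" "Tq k a b x t = 0"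
    by (simp_all add: sum_power2_eq_zero_iff)
  with T_inverse[where k = k and a = a and b = b and x = x and t = t] assms show False by simp
qed

end

section \<open>Darboux matrices acting on double angles\<close>

text \<open>The Darboux matrix in terms of double angles: it takes the direction \<open>(g', s')\<close> to
  \<open>(Tgam, Tsig)\<close> and multiplies the squared norm by \<open>den2\<close>.\<close>

definition den2 :: "real \<Rightarrow> real \<Rightarrow> real \<Rightarrow> real \<Rightarrow> real \<Rightarrow> real \<Rightarrow> real" where
  "den2 l k g s g' s' = l\<^sup>2 + k\<^sup>2 - 2 * l * k * (g * g' + s * s')"

definition Tgam :: "real \<Rightarrow> real \<Rightarrow> real \<Rightarrow> real \<Rightarrow> real \<Rightarrow> real \<Rightarrow> real" where
  "Tgam l k g s g' s' =
     (- 2 * l * k * g + (k\<^sup>2 + l\<^sup>2 * g\<^sup>2 - l\<^sup>2 * s\<^sup>2) * g' + 2 * l\<^sup>2 * g * s * s') / den2 l k g s g' s'"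

definition Tsig :: "real \<Rightarrow> real \<Rightarrow> real \<Rightarrow> real \<Rightarrow> real \<Rightarrow> real \<Rightarrow> real" where
  "Tsig l k g s g' s' =
     (- 2 * l * k * s + 2 * l\<^sup>2 * s * g * g' + (k\<^sup>2 - l\<^sup>2 * g\<^sup>2 + l\<^sup>2 * s\<^sup>2) * s') / den2 l k g s g' s'"

text \<open>The directions are unit vectors, so their scalar product is at most 1 in absolute value
  and \<open>den2\<close> is at least (|l| - |k|)^2.\<close>

lemma den2_pos:
  assumes c1: "g\<^sup>2 + s\<^sup>2 = 1" and c2: "g'\<^sup>2 + s'\<^sup>2 = 1" and ne: "l\<^sup>2 \<noteq> k\<^sup>2"
  shows "den2 l k g s g' s' > 0"
proof -
  define r where "r = g * g' + s * s'"
  \<comment> \<open>Lagrange's identity, the exact form of Cauchy-Schwarz in the plane.\<close>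
  have "r\<^sup>2 + (g * s' - s * g')\<^sup>2 = (g\<^sup>2 + s\<^sup>2) * (g'\<^sup>2 + s'\<^sup>2)"
    unfolding r_def by algebra
  then have "r\<^sup>2 + (g * s' - s * g')\<^sup>2 = 1" using c1 c2 by simp
  then have "r\<^sup>2 \<le> 1" using zero_le_power2[of "g * s' - s * g'"] by linarith
  then have "\<bar>r\<bar> \<le> 1" by (simp add: abs_square_le_1)
  then have "\<bar>l\<bar> * \<bar>k\<bar> * \<bar>r\<bar> \<le> \<bar>l\<bar> * \<bar>k\<bar> * 1" by (intro mult_left_mono) auto
  moreover have "l * k * r \<le> \<bar>l\<bar> * \<bar>k\<bar> * \<bar>r\<bar>" by (metis abs_ge_self abs_mult)
  ultimately have "l * k * r \<le> \<bar>l\<bar> * \<bar>k\<bar>" by simp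
  moreover have "\<bar>l\<bar> \<noteq> \<bar>k\<bar>" using ne by (metis power2_abs)
  then have "(\<bar>l\<bar> - \<bar>k\<bar>)\<^sup>2 > 0" by simp
  then have "l\<^sup>2 + k\<^sup>2 - 2 * (\<bar>l\<bar> * \<bar>k\<bar>) > 0" by (simp add: power2_diff)
  ultimately show ?thesis unfolding den2_def r_def[symmetric] by linarith
qed

lemma T_circle:
  assumes c1: "g\<^sup>2 + s\<^sup>2 = 1" and c2: "g'\<^sup>2 + s'\<^sup>2 = 1" and ne: "l\<^sup>2 \<noteq> k\<^sup>2"
  shows "(Tgam l k g s g' s')\<^sup>2 + (Tsig l k g s g' s')\<^sup>2 = 1"
proof -
  have d: "den2 l k g s g' s' \<noteq> 0" using den2_pos[OF assms] by simp
  have "(- 2 * l * k * g + (k\<^sup>2 + l\<^sup>2 * g\<^sup>2 - l\<^sup>2 * s\<^sup>2) * g' + 2 * l\<^sup>2 * g * s * s')\<^sup>2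
      + (- 2 * l * k * s + 2 * l\<^sup>2 * s * g * g' + (k\<^sup>2 - l\<^sup>2 * g\<^sup>2 + l\<^sup>2 * s\<^sup>2) * s')\<^sup>2
      = (den2 l k g s g' s')\<^sup>2"
    using c1 c2 unfolding den2_def by algebra
  then show ?thesis
    unfolding Tgam_def Tsig_def power_divide add_divide_distrib[symmetric] using d by simp
qed

text \<open>The quadratic forms of the image are linear in a^2 + b^2, a^2 - b^2 and 2 a b, that is,
  in 1, g' and s' up to the common factor \<open>N\<close>, which cancels in both quotients.\<close>

lemma darboux_matrix_sig_gam:
  fixes a b g s k l :: real
  assumes c1: "g\<^sup>2 + s\<^sup>2 = 1" and nz: "a\<^sup>2 + b\<^sup>2 \<noteq> 0" and ne: "l\<^sup>2 \<noteq> k\<^sup>2"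
  defines "a' \<equiv> (k - l * g) * a - l * s * b" and "b' \<equiv> - l * s * a + (k + l * g) * b"
  shows "sig a' b' = Tsig l k g s (gam a b) (sig a b)"
    and "gam a' b' = Tgam l k g s (gam a b) (sig a b)"
proof -
  define N g' s' where "N = a\<^sup>2 + b\<^sup>2" and "g' = gam a b" and "s' = sig a b"
  have N: "N \<noteq> 0" "a\<^sup>2 + b\<^sup>2 = N" "g' * N = a\<^sup>2 - b\<^sup>2" "s' * N = 2 * a * b"
    using nz unfolding g'_def s'_def gam_def sig_def N_def by simp_all
  have d: "den2 l k g s g' s' \<noteq> 0"
    using den2_pos[OF c1 _ ne] sig_gam_circle[OF nz] unfolding g'_def s'_def by (metis less_irrefl)
  have "a'\<^sup>2 + b'\<^sup>2 = (k\<^sup>2 + l\<^sup>2 * (g\<^sup>2 + s\<^sup>2)) * (a\<^sup>2 + b\<^sup>2)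
      - 2 * l * k * (g * (a\<^sup>2 - b\<^sup>2) + s * (2 * a * b))"
    unfolding a'_def b'_def by algebra
  then have n: "a'\<^sup>2 + b'\<^sup>2 = den2 l k g s g' s' * N"
    unfolding c1 N(2) N(3,4)[symmetric] den2_def by (simp add: algebra_simps)
  have e1: "2 * a' * b' = (- 2 * l * k * s + 2 * l\<^sup>2 * s * g * g' + (k\<^sup>2 - l\<^sup>2 * g\<^sup>2 + l\<^sup>2 * s\<^sup>2) * s') * N"
  proof -
    have "2 * a' * b' = - 2 * l * k * s * (a\<^sup>2 + b\<^sup>2) + 2 * l\<^sup>2 * s * g * (a\<^sup>2 - b\<^sup>2)
        + (k\<^sup>2 - l\<^sup>2 * g\<^sup>2 + l\<^sup>2 * s\<^sup>2) * (2 * a * b)"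
      unfolding a'_def b'_def by algebra
    then show ?thesis unfolding N(2) N(3,4)[symmetric] by (simp add: algebra_simps)
  qed
  have e2: "a'\<^sup>2 - b'\<^sup>2 = (- 2 * l * k * g + (k\<^sup>2 + l\<^sup>2 * g\<^sup>2 - l\<^sup>2 * s\<^sup>2) * g' + 2 * l\<^sup>2 * g * s * s') * N"
  proof -
    have "a'\<^sup>2 - b'\<^sup>2 = - 2 * l * k * g * (a\<^sup>2 + b\<^sup>2) + (k\<^sup>2 + l\<^sup>2 * g\<^sup>2 - l\<^sup>2 * s\<^sup>2) * (a\<^sup>2 - b\<^sup>2)
        + 2 * l\<^sup>2 * g * s * (2 * a * b)"
      unfolding a'_def b'_def by algebra
    then show ?thesis unfolding N(2) N(3,4)[symmetric] by (simp add: algebra_simps)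
  qed
  show "sig a' b' = Tsig l k g s (gam a b) (sig a b)"
    unfolding Tsig_def g'_def[symmetric] s'_def[symmetric] sig_def[of a'] n e1 using N(1) by simp
  show "gam a' b' = Tgam l k g s (gam a b) (sig a b)"
    unfolding Tgam_def g'_def[symmetric] s'_def[symmetric] gam_def[of a'] n e2 using N(1) by simp
qed

section \<open>The two- and three-fold formulas as iterated Darboux steps\<close>

definition darboux2_shift :: "real \<Rightarrow> real \<Rightarrow> real \<Rightarrow> real \<Rightarrow> real \<Rightarrow> real \<Rightarrow> real" where
  "darboux2_shift l1 l2 g1 s1 g2 s2 = 2 * (l1\<^sup>2 - l2\<^sup>2) * (l1 * s1 - l2 * s2) / den2 l1 l2 g1 s1 g2 s2"

text \<open>For nonzero vectors \<open>den3\<close> is \<open>darboux3_den\<close> divided by the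
  product of the three squared norms, and \<open>num3\<close> is twice \<open>darboux3_num\<close>
  divided by it; hence the factor 2 in \<open>darboux3_shift\<close>.\<close>

definition den3 :: "real \<Rightarrow> real \<Rightarrow> real \<Rightarrow> real \<Rightarrow> real \<Rightarrow> real \<Rightarrow> real \<Rightarrow> real \<Rightarrow> real \<Rightarrow> real" where
  "den3 l1 l2 l3 g1 s1 g2 s2 g3 s3 =
     (l1\<^sup>2 + l2\<^sup>2) * (l1\<^sup>2 + l3\<^sup>2) * (l2\<^sup>2 + l3\<^sup>2) - 8 * l1\<^sup>2 * l2\<^sup>2 * l3\<^sup>2
     - 2 * (l3\<^sup>2 - l1\<^sup>2) * (l3\<^sup>2 - l2\<^sup>2) * l1 * l2 * (g1 * g2 + s1 * s2)
     - 2 * (l2\<^sup>2 - l1\<^sup>2) * (l2\<^sup>2 - l3\<^sup>2) * l1 * l3 * (g1 * g3 + s1 * s3)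
     - 2 * (l1\<^sup>2 - l2\<^sup>2) * (l1\<^sup>2 - l3\<^sup>2) * l2 * l3 * (g2 * g3 + s2 * s3)"

definition num3 :: "real \<Rightarrow> real \<Rightarrow> real \<Rightarrow> real \<Rightarrow> real \<Rightarrow> real \<Rightarrow> real \<Rightarrow> real \<Rightarrow> real \<Rightarrow> real" where
  "num3 l1 l2 l3 g1 s1 g2 s2 g3 s3 =
     (l3\<^sup>2 - l1\<^sup>2) * (l3\<^sup>2 - l2\<^sup>2) * l3 * s3 * (l1\<^sup>2 + l2\<^sup>2 - 2 * l1 * l2 * g1 * g2)
     + (l2\<^sup>2 - l1\<^sup>2) * (l2\<^sup>2 - l3\<^sup>2) * l2 * s2 * (l1\<^sup>2 + l3\<^sup>2 - 2 * l1 * l3 * g1 * g3)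
     + (l1\<^sup>2 - l2\<^sup>2) * (l1\<^sup>2 - l3\<^sup>2) * l1 * s1 * (l2\<^sup>2 + l3\<^sup>2 - 2 * l2 * l3 * g2 * g3)
     - 2 * (l1^4 + l2^4 + l3^4 - l1\<^sup>2 * l2\<^sup>2 - l1\<^sup>2 * l3\<^sup>2 - l2\<^sup>2 * l3\<^sup>2) * l1 * l2 * l3 * s1 * s2 * s3"

definition darboux3_shift :: "real \<Rightarrow> real \<Rightarrow> real \<Rightarrow> real \<Rightarrow> real \<Rightarrow> real \<Rightarrow> real \<Rightarrow> real \<Rightarrow> real \<Rightarrow> real" where
  "darboux3_shift l1 l2 l3 g1 s1 g2 s2 g3 s3 = 2 * num3 l1 l2 l3 g1 s1 g2 s2 g3 s3 / den3 l1 l2 l3 g1 s1 g2 s2 g3 s3"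

lemma darboux1_sig: "darboux1 u l p q = u + 2 * l * sig p q"
  unfolding darboux1_def sig_def by simp

lemma darboux2_eq_shift:
  assumes "p1\<^sup>2 + q1\<^sup>2 \<noteq> 0" and "p2\<^sup>2 + q2\<^sup>2 \<noteq> 0"
  shows "darboux2 u l1 l2 p1 q1 p2 q2 = u + darboux2_shift l1 l2 (gam p1 q1) (sig p1 q1) (gam p2 q2) (sig p2 q2)"
proof -
  define N1 g1 s1 where "N1 = p1\<^sup>2 + q1\<^sup>2" and "g1 = gam p1 q1" and "s1 = sig p1 q1"
  define N2 g2 s2 where "N2 = p2\<^sup>2 + q2\<^sup>2" and "g2 = gam p2 q2" and "s2 = sig p2 q2"
  have N1: "N1 \<noteq> 0" "p1\<^sup>2 + q1\<^sup>2 = N1" "p1\<^sup>2 - q1\<^sup>2 = g1 * N1" "p1 * q1 = s1 * N1 / 2"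
    using assms unfolding g1_def s1_def gam_def sig_def N1_def by simp_all
  have N2: "N2 \<noteq> 0" "p2\<^sup>2 + q2\<^sup>2 = N2" "p2\<^sup>2 - q2\<^sup>2 = g2 * N2" "p2 * q2 = s2 * N2 / 2"
    using assms unfolding g2_def s2_def gam_def sig_def N2_def by simp_all
  have num: "4 * (l1\<^sup>2 - l2\<^sup>2) * (l1 * p1 * q1 * N2 - l2 * p2 * q2 * N1)
      = (2 * (l1\<^sup>2 - l2\<^sup>2) * (l1 * s1 - l2 * s2)) * (N1 * N2)"
    using N1(4) N2(4) by algebra
  have den: "(l1\<^sup>2 + l2\<^sup>2) * N1 * N2 - 2 * l1 * l2 * (4 * p1 * q1 * p2 * q2 + g1 * N1 * (g2 * N2))
      = den2 l1 l2 g1 s1 g2 s2 * (N1 * N2)"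
    unfolding den2_def using N1(4) N2(4) by algebra
  show ?thesis
    unfolding darboux2_def darboux2_shift_def g1_def[symmetric] s1_def[symmetric] g2_def[symmetric] s2_def[symmetric]
      N1(2,3) N2(2,3) num den
    using N1(1) N2(1) by simp
qed

lemma darboux3_eq_shift:
  assumes "p1\<^sup>2 + q1\<^sup>2 \<noteq> 0" and "p2\<^sup>2 + q2\<^sup>2 \<noteq> 0" and "p3\<^sup>2 + q3\<^sup>2 \<noteq> 0"
  shows "darboux3 u l1 l2 l3 p1 q1 p2 q2 p3 q3 =
    u + darboux3_shift l1 l2 l3 (gam p1 q1) (sig p1 q1) (gam p2 q2) (sig p2 q2) (gam p3 q3) (sig p3 q3)"
proof -
  \<comment> \<open>Half norms give p^2 = (1 + g) N, q^2 = (1 - g) N and p q = s N without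
    fractions.\<close>
  define N1 g1 s1 where "N1 = (p1\<^sup>2 + q1\<^sup>2) / 2" and "g1 = gam p1 q1" and "s1 = sig p1 q1"
  define N2 g2 s2 where "N2 = (p2\<^sup>2 + q2\<^sup>2) / 2" and "g2 = gam p2 q2" and "s2 = sig p2 q2"
  define N3 g3 s3 where "N3 = (p3\<^sup>2 + q3\<^sup>2) / 2" and "g3 = gam p3 q3" and "s3 = sig p3 q3"
  have "N1 \<noteq> 0" "p1\<^sup>2 + q1\<^sup>2 = 2 * N1" "p1\<^sup>2 - q1\<^sup>2 = 2 * g1 * N1" "p1 * q1 = s1 * N1"
    using assms unfolding g1_def s1_def gam_def sig_def N1_def by simp_all
  then have N1: "N1 \<noteq> 0" "p1\<^sup>2 = (1 + g1) * N1" "q1\<^sup>2 = (1 - g1) * N1" "p1 * q1 = s1 * N1"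
    by (simp_all add: field_simps)
  have "N2 \<noteq> 0" "p2\<^sup>2 + q2\<^sup>2 = 2 * N2" "p2\<^sup>2 - q2\<^sup>2 = 2 * g2 * N2" "p2 * q2 = s2 * N2"
    using assms unfolding g2_def s2_def gam_def sig_def N2_def by simp_all
  then have N2: "N2 \<noteq> 0" "p2\<^sup>2 = (1 + g2) * N2" "q2\<^sup>2 = (1 - g2) * N2" "p2 * q2 = s2 * N2"
    by (simp_all add: field_simps)
  have "N3 \<noteq> 0" "p3\<^sup>2 + q3\<^sup>2 = 2 * N3" "p3\<^sup>2 - q3\<^sup>2 = 2 * g3 * N3" "p3 * q3 = s3 * N3"
    using assms unfolding g3_def s3_def gam_def sig_def N3_def by simp_all
  then have N3: "N3 \<noteq> 0" "p3\<^sup>2 = (1 + g3) * N3" "q3\<^sup>2 = (1 - g3) * N3" "p3 * q3 = s3 * N3"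
    by (simp_all add: field_simps)
  have num: "darboux3_num l1 l2 l3 p1 q1 p2 q2 p3 q3 =
      num3 l1 l2 l3 g1 s1 g2 s2 g3 s3 * (4 * (N1 * N2 * N3))"
  proof -
    have "darboux3_num l1 l2 l3 p1 q1 p2 q2 p3 q3 =
       (l3\<^sup>2 - l1\<^sup>2) * (l3\<^sup>2 - l2\<^sup>2) * l3 * (p3 * q3) *
         ((l1\<^sup>2 + l2\<^sup>2) * (p1\<^sup>2 + q1\<^sup>2) * (p2\<^sup>2 + q2\<^sup>2) - 2 * l1 * l2 * (p1\<^sup>2 - q1\<^sup>2) * (p2\<^sup>2 - q2\<^sup>2))
     + (l2\<^sup>2 - l1\<^sup>2) * (l2\<^sup>2 - l3\<^sup>2) * l2 * (p2 * q2) *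
         ((l1\<^sup>2 + l3\<^sup>2) * (p1\<^sup>2 + q1\<^sup>2) * (p3\<^sup>2 + q3\<^sup>2) - 2 * l1 * l3 * (p1\<^sup>2 - q1\<^sup>2) * (p3\<^sup>2 - q3\<^sup>2))
     + (l1\<^sup>2 - l2\<^sup>2) * (l1\<^sup>2 - l3\<^sup>2) * l1 * (p1 * q1) *
         ((l2\<^sup>2 + l3\<^sup>2) * (p2\<^sup>2 + q2\<^sup>2) * (p3\<^sup>2 + q3\<^sup>2) - 2 * l2 * l3 * (p2\<^sup>2 - q2\<^sup>2) * (p3\<^sup>2 - q3\<^sup>2))
     - 8 * (l1^4 + l2^4 + l3^4 - l1\<^sup>2 * l2\<^sup>2 - l1\<^sup>2 * l3\<^sup>2 - l2\<^sup>2 * l3\<^sup>2) *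
         l1 * l2 * l3 * ((p1 * q1) * (p2 * q2) * (p3 * q3))"
      unfolding darboux3_num_def by (simp only: mult.assoc mult.left_commute)
    also have "\<dots> = num3 l1 l2 l3 g1 s1 g2 s2 g3 s3 * (4 * (N1 * N2 * N3))"
      unfolding num3_def N1(2-4) N2(2-4) N3(2-4) by algebra
    finally show ?thesis .
  qed
  have den: "darboux3_den l1 l2 l3 p1 q1 p2 q2 p3 q3 =
      den3 l1 l2 l3 g1 s1 g2 s2 g3 s3 * (8 * (N1 * N2 * N3))"
  proof -
    have "darboux3_den l1 l2 l3 p1 q1 p2 q2 p3 q3 =
         (l1 + l2)\<^sup>2 * (l1 + l3)\<^sup>2 * (l2 - l3)\<^sup>2 * (p1\<^sup>2 * q2\<^sup>2 * q3\<^sup>2 + q1\<^sup>2 * p2\<^sup>2 * p3\<^sup>2)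
       + (l1 + l2)\<^sup>2 * (l2 + l3)\<^sup>2 * (l1 - l3)\<^sup>2 * (p2\<^sup>2 * q1\<^sup>2 * q3\<^sup>2 + q2\<^sup>2 * p1\<^sup>2 * p3\<^sup>2)
       + (l1 + l3)\<^sup>2 * (l2 + l3)\<^sup>2 * (l1 - l2)\<^sup>2 * (p3\<^sup>2 * q1\<^sup>2 * q2\<^sup>2 + q3\<^sup>2 * p1\<^sup>2 * p2\<^sup>2)
       + (l1 - l2)\<^sup>2 * (l1 - l3)\<^sup>2 * (l2 - l3)\<^sup>2 * (p1\<^sup>2 * p2\<^sup>2 * p3\<^sup>2 + q1\<^sup>2 * q2\<^sup>2 * q3\<^sup>2)
       - 8 * (l3\<^sup>2 - l1\<^sup>2) * (l3\<^sup>2 - l2\<^sup>2) * l1 * l2 * ((p1 * q1) * (p2 * q2)) * (p3\<^sup>2 + q3\<^sup>2)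
       - 8 * (l2\<^sup>2 - l1\<^sup>2) * (l2\<^sup>2 - l3\<^sup>2) * l1 * l3 * ((p1 * q1) * (p3 * q3)) * (p2\<^sup>2 + q2\<^sup>2)
       - 8 * (l1\<^sup>2 - l2\<^sup>2) * (l1\<^sup>2 - l3\<^sup>2) * l2 * l3 * ((p2 * q2) * (p3 * q3)) * (p1\<^sup>2 + q1\<^sup>2)"
      unfolding darboux3_den_def by (simp only: mult.assoc mult.left_commute)
    also have "\<dots> = den3 l1 l2 l3 g1 s1 g2 s2 g3 s3 * (8 * (N1 * N2 * N3))"
      unfolding den3_def N1(2-4) N2(2-4) N3(2-4) by algebra
    finally show ?thesis .
  qed
  show ?thesis
    unfolding darboux3_def darboux3_shift_def num den
      g1_def[symmetric] s1_def[symmetric] g2_def[symmetric] s2_def[symmetric] g3_def[symmetric] s3_def[symmetric]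
    using N1(1) N2(1) N3(1) by simp
qed

text \<open>The first step contributes the sine of the first eigenfunction, the second step that of
  the second eigenfunction after the first Darboux matrix has acted on it.\<close>

lemma darboux2_shift_iterate:
  assumes c1: "g1\<^sup>2 + s1\<^sup>2 = 1" and c2: "g2\<^sup>2 + s2\<^sup>2 = 1" and ne: "l1\<^sup>2 \<noteq> l2\<^sup>2"
  shows "darboux2_shift l1 l2 g1 s1 g2 s2 = 2 * l1 * s1 + 2 * l2 * Tsig l1 l2 g1 s1 g2 s2"
proof -
  have d: "den2 l1 l2 g1 s1 g2 s2 \<noteq> 0" using den2_pos[OF assms] by simp
  have "2 * (l1\<^sup>2 - l2\<^sup>2) * (l1 * s1 - l2 * s2) = 2 * l1 * s1 * den2 l1 l2 g1 s1 g2 s2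
      + 2 * l2 * (- 2 * l1 * l2 * s1 + 2 * l1\<^sup>2 * s1 * g1 * g2 + (l2\<^sup>2 - l1\<^sup>2 * g1\<^sup>2 + l1\<^sup>2 * s1\<^sup>2) * s2)"
    using c1 unfolding den2_def by algebra
  then show ?thesis unfolding darboux2_shift_def Tsig_def using d by (simp add: field_simps)
qed

text \<open>The first two factors clear the denominators of the transformed directions, the third is
  the two-fold denominator of the transformed pair. Positivity, invisible in the expanded form of
  \<open>den3\<close>, becomes evident.\<close>

lemma den3_iterate:
  assumes c1: "g1\<^sup>2 + s1\<^sup>2 = 1" and c2: "g2\<^sup>2 + s2\<^sup>2 = 1" and c3: "g3\<^sup>2 + s3\<^sup>2 = 1"
    and ne: "l1\<^sup>2 \<noteq> l2\<^sup>2" "l1\<^sup>2 \<noteq> l3\<^sup>2"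
  shows "den3 l1 l2 l3 g1 s1 g2 s2 g3 s3 = den2 l1 l2 g1 s1 g2 s2 * den2 l1 l3 g1 s1 g3 s3
    * den2 l2 l3 (Tgam l1 l2 g1 s1 g2 s2) (Tsig l1 l2 g1 s1 g2 s2)
        (Tgam l1 l3 g1 s1 g3 s3) (Tsig l1 l3 g1 s1 g3 s3)"
proof -
  define d12 d13 where "d12 = den2 l1 l2 g1 s1 g2 s2" and "d13 = den2 l1 l3 g1 s1 g3 s3"
  have d: "d12 \<noteq> 0" "d13 \<noteq> 0"
    using den2_pos[OF c1 c2 ne(1)] den2_pos[OF c1 c3 ne(2)] unfolding d12_def d13_def by auto
  define S2 where "S2 = - 2 * l1 * l2 * s1 + 2 * l1\<^sup>2 * s1 * g1 * g2 + (l2\<^sup>2 - l1\<^sup>2 * g1\<^sup>2 + l1\<^sup>2 * s1\<^sup>2) * s2"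
  define G2 where "G2 = - 2 * l1 * l2 * g1 + (l2\<^sup>2 + l1\<^sup>2 * g1\<^sup>2 - l1\<^sup>2 * s1\<^sup>2) * g2 + 2 * l1\<^sup>2 * g1 * s1 * s2"
  define S3 where "S3 = - 2 * l1 * l3 * s1 + 2 * l1\<^sup>2 * s1 * g1 * g3 + (l3\<^sup>2 - l1\<^sup>2 * g1\<^sup>2 + l1\<^sup>2 * s1\<^sup>2) * s3"
  define G3 where "G3 = - 2 * l1 * l3 * g1 + (l3\<^sup>2 + l1\<^sup>2 * g1\<^sup>2 - l1\<^sup>2 * s1\<^sup>2) * g3 + 2 * l1\<^sup>2 * g1 * s1 * s3"
  have "den3 l1 l2 l3 g1 s1 g2 s2 g3 s3 = (l2\<^sup>2 + l3\<^sup>2) * d12 * d13 - 2 * l2 * l3 * (G2 * G3 + S2 * S3)"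
    using c1 unfolding d12_def d13_def S2_def G2_def S3_def G3_def den3_def den2_def by algebra
  also have "\<dots> = d12 * d13 * den2 l2 l3 (G2 / d12) (S2 / d12) (G3 / d13) (S3 / d13)"
    unfolding den2_def using d by (simp add: field_simps)
  finally show ?thesis
    unfolding Tgam_def Tsig_def d12_def S2_def G2_def d13_def S3_def G3_def .
qed

lemma den3_pos:
  assumes c1: "g1\<^sup>2 + s1\<^sup>2 = 1" and c2: "g2\<^sup>2 + s2\<^sup>2 = 1" and c3: "g3\<^sup>2 + s3\<^sup>2 = 1"
    and ne: "l1\<^sup>2 \<noteq> l2\<^sup>2" "l1\<^sup>2 \<noteq> l3\<^sup>2" "l2\<^sup>2 \<noteq> l3\<^sup>2"
  shows "den3 l1 l2 l3 g1 s1 g2 s2 g3 s3 > 0"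
  unfolding den3_iterate[OF c1 c2 c3 ne(1,2)]
  by (intro mult_pos_pos den2_pos T_circle assms)

lemma darboux3_shift_iterate:
  assumes c1: "g1\<^sup>2 + s1\<^sup>2 = 1" and c2: "g2\<^sup>2 + s2\<^sup>2 = 1" and c3: "g3\<^sup>2 + s3\<^sup>2 = 1"
    and ne: "l1\<^sup>2 \<noteq> l2\<^sup>2" "l1\<^sup>2 \<noteq> l3\<^sup>2" "l2\<^sup>2 \<noteq> l3\<^sup>2"
  shows "darboux3_shift l1 l2 l3 g1 s1 g2 s2 g3 s3 = 2 * l1 * s1 + 2 * l2 * Tsig l1 l2 g1 s1 g2 s2
    + 2 * l3 * Tsig l2 l3 (Tgam l1 l2 g1 s1 g2 s2) (Tsig l1 l2 g1 s1 g2 s2)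
        (Tgam l1 l3 g1 s1 g3 s3) (Tsig l1 l3 g1 s1 g3 s3)"
proof -
  define d12 d13 where "d12 = den2 l1 l2 g1 s1 g2 s2" and "d13 = den2 l1 l3 g1 s1 g3 s3"
  have d: "d12 \<noteq> 0" "d13 \<noteq> 0"
    using den2_pos[OF c1 c2 ne(1)] den2_pos[OF c1 c3 ne(2)] unfolding d12_def d13_def by auto
  define S2 where "S2 = - 2 * l1 * l2 * s1 + 2 * l1\<^sup>2 * s1 * g1 * g2 + (l2\<^sup>2 - l1\<^sup>2 * g1\<^sup>2 + l1\<^sup>2 * s1\<^sup>2) * s2"
  define G2 where "G2 = - 2 * l1 * l2 * g1 + (l2\<^sup>2 + l1\<^sup>2 * g1\<^sup>2 - l1\<^sup>2 * s1\<^sup>2) * g2 + 2 * l1\<^sup>2 * g1 * s1 * s2"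
  define S3 where "S3 = - 2 * l1 * l3 * s1 + 2 * l1\<^sup>2 * s1 * g1 * g3 + (l3\<^sup>2 - l1\<^sup>2 * g1\<^sup>2 + l1\<^sup>2 * s1\<^sup>2) * s3"
  define G3 where "G3 = - 2 * l1 * l3 * g1 + (l3\<^sup>2 + l1\<^sup>2 * g1\<^sup>2 - l1\<^sup>2 * s1\<^sup>2) * g3 + 2 * l1\<^sup>2 * g1 * s1 * s3"
  define D where "D = den3 l1 l2 l3 g1 s1 g2 s2 g3 s3"
  define E where "E = den2 l2 l3 (G2 / d12) (S2 / d12) (G3 / d13) (S3 / d13)"
  have D: "D \<noteq> 0" using den3_pos[OF assms] unfolding D_def by simp
  have "D = d12 * d13 * E"
    using den3_iterate[OF c1 c2 c3 ne(1,2)]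
    unfolding Tgam_def Tsig_def D_def E_def d12_def S2_def G2_def d13_def S3_def G3_def .
  then have E: "E = D / (d12 * d13)" using d by simp
  \<comment> \<open>After the substitution for \<open>E\<close> all terms have the common
    denominator \<open>d12 * D\<close>; this identity compares the numerators.\<close>
  have I: "2 * (l1\<^sup>2 - l2\<^sup>2) * (l1 * s1 - l2 * s2) * D
      + 2 * l3 * (- 2 * l2 * l3 * S2 * d12 * d13 + 2 * l2\<^sup>2 * S2 * G2 * G3
          + (l3\<^sup>2 * d12\<^sup>2 - l2\<^sup>2 * G2\<^sup>2 + l2\<^sup>2 * S2\<^sup>2) * S3)
      = 2 * num3 l1 l2 l3 g1 s1 g2 s2 g3 s3 * d12"
    using c1 c2
    unfolding d12_def d13_def S2_def G2_def S3_def G3_def D_def den3_def num3_def den2_def by algebra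
  have a: "2 * l1 * s1 + 2 * l2 * (S2 / d12) = 2 * (l1\<^sup>2 - l2\<^sup>2) * (l1 * s1 - l2 * s2) / d12"
    using darboux2_shift_iterate[OF c1 c2 ne(1)] unfolding darboux2_shift_def Tsig_def S2_def d12_def by simp
  have b: "Tsig l2 l3 (G2 / d12) (S2 / d12) (G3 / d13) (S3 / d13) =
      (- 2 * l2 * l3 * S2 * d12 * d13 + 2 * l2\<^sup>2 * S2 * G2 * G3
          + (l3\<^sup>2 * d12\<^sup>2 - l2\<^sup>2 * G2\<^sup>2 + l2\<^sup>2 * S2\<^sup>2) * S3) / (d12 * D)"
    unfolding Tsig_def E_def[symmetric] E using d D by (simp add: field_simps power2_eq_square)
  have "2 * l1 * s1 + 2 * l2 * (S2 / d12) + 2 * l3 * Tsig l2 l3 (G2 / d12) (S2 / d12) (G3 / d13) (S3 / d13)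
      = (2 * (l1\<^sup>2 - l2\<^sup>2) * (l1 * s1 - l2 * s2) * D
      + 2 * l3 * (- 2 * l2 * l3 * S2 * d12 * d13 + 2 * l2\<^sup>2 * S2 * G2 * G3
          + (l3\<^sup>2 * d12\<^sup>2 - l2\<^sup>2 * G2\<^sup>2 + l2\<^sup>2 * S2\<^sup>2) * S3)) / (d12 * D)"
  proof -
    have "X / d12 + 2 * l3 * (Y / (d12 * D)) = (X * D + 2 * l3 * Y) / (d12 * D)" for X Y
      using d D by (simp add: field_simps)
    then show ?thesis unfolding a b .
  qed
  also have "\<dots> = 2 * num3 l1 l2 l3 g1 s1 g2 s2 g3 s3 / D"
    unfolding I using d D by simp
  finally show ?thesis
    unfolding darboux3_shift_def Tgam_def Tsig_def D_def d12_def S2_def G2_def d13_def S3_def G3_def by simp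
qed

lemma mkdv_darboux1:
  assumes "mkdv_solution u" and "lax_solution u l p q" and "\<And>x t. (p x t)\<^sup>2 + (q x t)\<^sup>2 \<noteq> 0"
  shows "mkdv_solution (\<lambda>x t. darboux1 (u x t) l (p x t) (q x t))"
proof -
  obtain ut ux uxx uxxx where "jet_solution u ut ux uxx uxxx"
    using assms(1) unfolding mkdv_solution_iff_jet by blast
  then interpret darboux_step u ut ux uxx uxxx p q l using assms by unfold_locales
  show ?thesis using jet_v unfolding mkdv_solution_iff_jet darboux1_sig v_def[abs_def] by blast
qed

lemma mkdv_darboux2:
  assumes "mkdv_solution u"
    and L1: "lax_solution u l1 p1 q1" and n1: "\<And>x t. (p1 x t)\<^sup>2 + (q1 x t)\<^sup>2 \<noteq> 0"
    and L2: "lax_solution u l2 p2 q2" and n2: "\<And>x t. (p2 x t)\<^sup>2 + (q2 x t)\<^sup>2 \<noteq> 0"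
    and ne: "l1\<^sup>2 \<noteq> l2\<^sup>2"
  shows "mkdv_solution (\<lambda>x t. darboux2 (u x t) l1 l2 (p1 x t) (q1 x t) (p2 x t) (q2 x t))"
proof -
  obtain ut ux uxx uxxx where "jet_solution u ut ux uxx uxxx"
    using assms(1) unfolding mkdv_solution_iff_jet by blast
  then interpret A: darboux_step u ut ux uxx uxxx p1 q1 l1 using assms by unfold_locales
  interpret B: darboux_step A.v A.vt A.vx A.vxx A.vxxx "A.Tp l2 p2 q2" "A.Tq l2 p2 q2" l2
    using A.jet_v A.lax_T[OF L2] A.T_nonzero[where k = l2 and a = p2 and b = q2, OF ne[symmetric] n2] by unfold_locales
  have "B.v = (\<lambda>x t. darboux2 (u x t) l1 l2 (p1 x t) (q1 x t) (p2 x t) (q2 x t))"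
  proof (intro ext)
    fix x t
    show "B.v x t = darboux2 (u x t) l1 l2 (p1 x t) (q1 x t) (p2 x t) (q2 x t)"
      unfolding B.v_def A.v_def A.Tp_def A.Tq_def darboux2_eq_shift[OF n1 n2]
        darboux_matrix_sig_gam(1)[OF A.circ n2 ne]
        darboux2_shift_iterate[OF A.circ sig_gam_circle[OF n2] ne] by simp
  qed
  then show ?thesis using B.jet_v unfolding mkdv_solution_iff_jet by metis
qed

text \<open>The third eigenfunction passes through two Darboux matrices before it is used, and stays
  nonzero because its squared eigenvalue differs from the other two.\<close>

lemma mkdv_darboux3:
  assumes "mkdv_solution u"
    and L1: "lax_solution u l1 p1 q1" and n1: "\<And>x t. (p1 x t)\<^sup>2 + (q1 x t)\<^sup>2 \<noteq> 0"
    and L2: "lax_solution u l2 p2 q2" and n2: "\<And>x t. (p2 x t)\<^sup>2 + (q2 x t)\<^sup>2 \<noteq> 0"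
    and L3: "lax_solution u l3 p3 q3" and n3: "\<And>x t. (p3 x t)\<^sup>2 + (q3 x t)\<^sup>2 \<noteq> 0"
    and ne: "l1\<^sup>2 \<noteq> l2\<^sup>2" "l1\<^sup>2 \<noteq> l3\<^sup>2" "l2\<^sup>2 \<noteq> l3\<^sup>2"
  shows "mkdv_solution (\<lambda>x t. darboux3 (u x t) l1 l2 l3 (p1 x t) (q1 x t) (p2 x t) (q2 x t) (p3 x t) (q3 x t))"
proof -
  obtain ut ux uxx uxxx where "jet_solution u ut ux uxx uxxx"
    using assms(1) unfolding mkdv_solution_iff_jet by blast
  then interpret A: darboux_step u ut ux uxx uxxx p1 q1 l1 using assms by unfold_locales
  interpret B: darboux_step A.v A.vt A.vx A.vxx A.vxxx "A.Tp l2 p2 q2" "A.Tq l2 p2 q2" l2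
    using A.jet_v A.lax_T[OF L2] A.T_nonzero[where k = l2 and a = p2 and b = q2, OF ne(1)[symmetric] n2] by unfold_locales
  note n3' = A.T_nonzero[where k = l3 and a = p3 and b = q3, OF ne(2)[symmetric] n3]
  interpret C: darboux_step B.v B.vt B.vx B.vxx B.vxxx
    "B.Tp l3 (A.Tp l3 p3 q3) (A.Tq l3 p3 q3)" "B.Tq l3 (A.Tp l3 p3 q3) (A.Tq l3 p3 q3)" l3
    using B.jet_v B.lax_T[OF A.lax_T[OF L3]] B.T_nonzero[where k = l3 and a = "A.Tp l3 p3 q3" and b = "A.Tq l3 p3 q3", OF ne(3)[symmetric] n3'] by unfold_locales
  have "C.v = (\<lambda>x t. darboux3 (u x t) l1 l2 l3 (p1 x t) (q1 x t) (p2 x t) (q2 x t) (p3 x t) (q3 x t))"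
  proof (intro ext)
    fix x t
    have a: "sig (A.Tp l2 p2 q2 x t) (A.Tq l2 p2 q2 x t) =
        Tsig l1 l2 (gam (p1 x t) (q1 x t)) (sig (p1 x t) (q1 x t)) (gam (p2 x t) (q2 x t)) (sig (p2 x t) (q2 x t))"
      "gam (A.Tp l2 p2 q2 x t) (A.Tq l2 p2 q2 x t) =
        Tgam l1 l2 (gam (p1 x t) (q1 x t)) (sig (p1 x t) (q1 x t)) (gam (p2 x t) (q2 x t)) (sig (p2 x t) (q2 x t))"
      unfolding A.Tp_def A.Tq_def by (rule darboux_matrix_sig_gam[OF A.circ n2 ne(1)])+
    have b: "sig (A.Tp l3 p3 q3 x t) (A.Tq l3 p3 q3 x t) =
        Tsig l1 l3 (gam (p1 x t) (q1 x t)) (sig (p1 x t) (q1 x t)) (gam (p3 x t) (q3 x t)) (sig (p3 x t) (q3 x t))"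
      "gam (A.Tp l3 p3 q3 x t) (A.Tq l3 p3 q3 x t) =
        Tgam l1 l3 (gam (p1 x t) (q1 x t)) (sig (p1 x t) (q1 x t)) (gam (p3 x t) (q3 x t)) (sig (p3 x t) (q3 x t))"
      unfolding A.Tp_def A.Tq_def by (rule darboux_matrix_sig_gam[OF A.circ n3 ne(2)])+
    show "C.v x t = darboux3 (u x t) l1 l2 l3 (p1 x t) (q1 x t) (p2 x t) (q2 x t) (p3 x t) (q3 x t)"
      unfolding C.v_def B.v_def A.v_def B.Tp_def B.Tq_def darboux3_eq_shift[OF n1 n2 n3]
        darboux_matrix_sig_gam(1)[OF B.circ n3' ne(3)]
        darboux3_shift_iterate[OF A.circ sig_gam_circle[OF n2] sig_gam_circle[OF n3] ne]
      unfolding a b by simp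
  qed
  then show ?thesis using C.jet_v unfolding mkdv_solution_iff_jet by metis
qed

section \<open>The second solution\<close>

locale eigenfunction =
  fixes u :: "real \<Rightarrow> real" and c e l m :: real and P Q :: "real \<Rightarrow> real"
  assumes eig: "periodic_eigenfunction u c e l m P Q"
    and l: "l \<noteq> 0"
    and denom_nz: "\<And>z. e + 4 * l\<^sup>2 * u z \<noteq> 0"
begin

definition "n z = e + 4 * l\<^sup>2 * u z"
definition "G z = c - 4 * l\<^sup>2 - 2 * (u z)\<^sup>2"

lemma n_nz: "n z \<noteq> 0"
  unfolding n_def by (rule denom_nz)

lemma m: "m \<noteq> 0"
  using eig unfolding periodic_eigenfunction_def by blast

lemma lax_PQ: "lax_solution (\<lambda>x t. u (x - c * t)) l (\<lambda>x t. P (x - c * t)) (\<lambda>x t. Q (x - c * t))"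
  using eig unfolding periodic_eigenfunction_def by blast

lemma PQ_sum: "(P z)\<^sup>2 + (Q z)\<^sup>2 = m * n z"
  and PQ_diff: "(P z)\<^sup>2 - (Q z)\<^sup>2 = 2 * m * l * deriv u z"
  and PQ_prod: "2 * P z * Q z = m * l * G z"
  using eig unfolding periodic_eigenfunction_def n_def G_def by blast+

lemma P_deriv: "(P has_real_derivative l * P z + u z * Q z) (at z)"
  and Q_deriv: "(Q has_real_derivative - u z * P z - l * Q z) (at z)"
  using lax_PQ[unfolded lax_solution_def Let_def, rule_format, where x = z and t = 0] by simp_all

text \<open>\<open>deriv\<close> is total, so its occurrence in the hypotheses does not give
  differentiability. This comes from solving \<open>PQ_sum\<close> for u, since P and Q are
  differentiable and l is nonzero.\<close>

lemma u_deriv: "(u has_real_derivative deriv u z) (at z)"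
proof -
  have u_eq: "u = (\<lambda>z. ((P z)\<^sup>2 + (Q z)\<^sup>2) / (4 * m * l\<^sup>2) - e / (4 * l\<^sup>2))"
    unfolding PQ_sum n_def using m l by (simp add: fun_eq_iff field_simps)
  have "((\<lambda>z. (P z)\<^sup>2 + (Q z)\<^sup>2) has_real_derivative 2 * l * ((P z)\<^sup>2 - (Q z)\<^sup>2)) (at z)"
    by (rule derivative_eq_intros P_deriv Q_deriv refl)+ (simp add: algebra_simps power2_eq_square)
  from DERIV_diff[OF DERIV_cdivide[OF this] DERIV_const]
  have "\<exists>d. (u has_real_derivative d) (at z)" by (subst u_eq) blast
  then show ?thesis by (metis DERIV_imp_deriv)
qed

text \<open>Differentiating \<open>PQ_diff\<close> by the Lax system expresses u'' through P^2 + Q^2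
  and 2 P Q, hence through u: the second-order equation of the travelling wave.\<close>

lemma deriv_u_deriv: "(deriv u has_real_derivative e + c * u z - 2 * (u z)^3) (at z)"
proof -
  have eq: "deriv u = (\<lambda>z. ((P z)\<^sup>2 - (Q z)\<^sup>2) / (2 * m * l))"
  proof
    fix z show "deriv u z = ((P z)\<^sup>2 - (Q z)\<^sup>2) / (2 * m * l)"
      unfolding PQ_diff using m l by simp
  qed
  have "((\<lambda>z. (P z)\<^sup>2 - (Q z)\<^sup>2) has_real_derivative
      2 * l * ((P z)\<^sup>2 + (Q z)\<^sup>2) + 2 * u z * (2 * P z * Q z)) (at z)"
    by (rule derivative_eq_intros P_deriv Q_deriv refl)+ (simp add: algebra_simps power2_eq_square)
  then have "((\<lambda>z. ((P z)\<^sup>2 - (Q z)\<^sup>2) / (2 * m * l)) has_real_derivative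
      (2 * l * ((P z)\<^sup>2 + (Q z)\<^sup>2) + 2 * u z * (2 * P z * Q z)) / (2 * m * l)) (at z)"
    by (rule DERIV_cdivide)
  also have "(2 * l * ((P z)\<^sup>2 + (Q z)\<^sup>2) + 2 * u z * (2 * P z * Q z)) / (2 * m * l)
      = e + c * u z - 2 * (u z)^3"
    unfolding PQ_sum PQ_prod n_def G_def using m l by (simp add: field_simps power2_eq_square power3_eq_cube)
  finally show ?thesis unfolding eq .
qed

text \<open>The identity (P^2 - Q^2)^2 + (2 P Q)^2 = (P^2 + Q^2)^2 written in u. It acts as the
  energy integral of the wave and later yields the quartic for u'^2.\<close>

lemma first_integral: "4 * l\<^sup>2 * (deriv u z)\<^sup>2 + l\<^sup>2 * (G z)\<^sup>2 = (n z)\<^sup>2"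
proof -
  have "((P z)\<^sup>2 - (Q z)\<^sup>2)\<^sup>2 + (2 * P z * Q z)\<^sup>2 = ((P z)\<^sup>2 + (Q z)\<^sup>2)\<^sup>2" by algebra
  then have "(2 * m * l * deriv u z)\<^sup>2 + (m * l * G z)\<^sup>2 = (m * n z)\<^sup>2"
    unfolding PQ_sum PQ_prod PQ_diff .
  then have "m\<^sup>2 * (4 * l\<^sup>2 * (deriv u z)\<^sup>2 + l\<^sup>2 * (G z)\<^sup>2) = m\<^sup>2 * (n z)\<^sup>2"
    by algebra
  then show ?thesis using m by simp
qed

lemma shift_x:
  assumes "(f has_real_derivative d) (at (x - c * t))"
  shows "((\<lambda>y. f (y - c * t)) has_real_derivative d) (at x)"
  using DERIV_shift[of f d x "- (c * t)"] assms by simp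

lemma shift_t:
  assumes "(f has_real_derivative d) (at (x - c * t))"
  shows "((\<lambda>s. f (x - c * s)) has_real_derivative - c * d) (at t)"
proof -
  have "((\<lambda>s. x - c * s) has_real_derivative - c) (at t)"
    by (auto intro!: derivative_eq_intros)
  from DERIV_chain2[OF assms this] show ?thesis by (simp add: mult.commute)
qed

lemma jet_u: "jet_solution (\<lambda>x t. u (x - c * t)) (\<lambda>x t. - c * deriv u (x - c * t))
    (\<lambda>x t. deriv u (x - c * t)) (\<lambda>x t. e + c * u (x - c * t) - 2 * (u (x - c * t))^3)
    (\<lambda>x t. (c - 6 * (u (x - c * t))\<^sup>2) * deriv u (x - c * t))"
  unfolding jet_solution_def
proof (intro allI conjI)
  fix x t
  show "((\<lambda>s. u (x - c * s)) has_real_derivative - c * deriv u (x - c * t)) (at t)"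
    by (rule shift_t[OF u_deriv])
  show "((\<lambda>y. u (y - c * t)) has_real_derivative deriv u (x - c * t)) (at x)"
    by (rule shift_x[OF u_deriv])
  show "((\<lambda>y. deriv u (y - c * t)) has_real_derivative e + c * u (x - c * t) - 2 * u (x - c * t) ^ 3) (at x)"
    by (rule shift_x[OF deriv_u_deriv])
  have "((\<lambda>z. e + c * u z - 2 * (u z)^3) has_real_derivative (c - 6 * (u z)\<^sup>2) * deriv u z) (at z)" for z
    by (rule derivative_eq_intros u_deriv refl)+ (simp add: algebra_simps)
  from shift_x[OF this]
  show "((\<lambda>y. e + c * u (y - c * t) - 2 * u (y - c * t) ^ 3) has_real_derivative
     (c - 6 * (u (x - c * t))\<^sup>2) * deriv u (x - c * t)) (at x)" .
qed (simp add: algebra_simps)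

lemma PQ_sum_nz: "(P z)\<^sup>2 + (Q z)\<^sup>2 \<noteq> 0"
  unfolding PQ_sum using m n_nz by simp

lemma gam_PQ: "gam (P z) (Q z) = 2 * l * deriv u z / n z"
  unfolding gam_def PQ_sum PQ_diff using m n_nz by (simp add: field_simps)

lemma sig_PQ: "sig (P z) (Q z) = l * G z / n z"
  unfolding sig_def PQ_sum PQ_prod using m n_nz by (simp add: field_simps)

definition \<Phi> :: "real \<Rightarrow> real" where "\<Phi> z = l\<^sup>2 * (LBINT y=0..z. G y / (n y)\<^sup>2)"

lemma \<Phi>_deriv: "(\<Phi> has_real_derivative l\<^sup>2 * (G z / (n z)\<^sup>2)) (at z)"
proof -
  have "isCont u x" for x by (rule DERIV_isCont[OF u_deriv])
  then have "isCont (\<lambda>y. G y / (n y)\<^sup>2) x" for x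
    unfolding n_def G_def using denom_nz[of x] by (intro continuous_intros) auto
  from DERIV_cmult[OF DERIV_LBINT[of "\<lambda>y. G y / (n y)\<^sup>2", OF this]]
  show ?thesis unfolding \<Phi>_def[abs_def] .
qed

end

locale growing_solution = eigenfunction +
  fixes \<psi> :: real and p q :: "real \<Rightarrow> real \<Rightarrow> real"
  assumes p_eq: "p x t = P (x - c * t) * (- (4 / m) * (\<Phi> (x - c * t) + t + \<psi>))
      - 2 * Q (x - c * t) / ((P (x - c * t))\<^sup>2 + (Q (x - c * t))\<^sup>2)"
    and q_eq: "q x t = Q (x - c * t) * (- (4 / m) * (\<Phi> (x - c * t) + t + \<psi>))
      + 2 * P (x - c * t) / ((P (x - c * t))\<^sup>2 + (Q (x - c * t))\<^sup>2)"
begin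

definition "\<phi> x t = - (4 / m) * (\<Phi> (x - c * t) + t + \<psi>)"
definition "\<tau> x t = - 2 * n (x - c * t) * (\<Phi> (x - c * t) + t + \<psi>)"

text \<open>Here and in \<open>\<phi>_t\<close> the derivative is expressed through P and Q, as in
  reduction of order. In this form the Lax system for the second solution becomes a polynomial
  identity once the norm is cleared.\<close>

lemma \<phi>_x: "((\<lambda>y. \<phi> y t) has_real_derivative
   - 8 * l * P (x - c * t) * Q (x - c * t) / ((P (x - c * t))\<^sup>2 + (Q (x - c * t))\<^sup>2)\<^sup>2) (at x)"
proof -
  let ?z = "x - c * t"
  have "((\<lambda>y. \<phi> y t) has_real_derivative - (4 / m) * (l\<^sup>2 * (G ?z / (n ?z)\<^sup>2))) (at x)"
    unfolding \<phi>_def by (rule derivative_eq_intros shift_x[OF \<Phi>_deriv] refl)+ (simp add: mult_ac)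
  moreover have num: "- 8 * l * P ?z * Q ?z = - 4 * l * (m * l * G ?z)"
    unfolding PQ_prod[symmetric] by simp
  have "- (4 / m) * (l\<^sup>2 * (G ?z / (n ?z)\<^sup>2)) = - 4 * l * (m * l * G ?z) / (m * n ?z)\<^sup>2"
    using m n_nz[of ?z] by (simp add: field_simps power2_eq_square)
  ultimately show ?thesis unfolding PQ_sum num by simp
qed

lemma \<phi>_t: "((\<lambda>s. \<phi> x s) has_real_derivative
   - 8 * (l * deriv u (x - c * t) * ((P (x - c * t))\<^sup>2 - (Q (x - c * t))\<^sup>2)
      - (4 * l^3 + 2 * l * (u (x - c * t))\<^sup>2) * (P (x - c * t) * Q (x - c * t)))
    / ((P (x - c * t))\<^sup>2 + (Q (x - c * t))\<^sup>2)\<^sup>2) (at t)"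
proof -
  let ?z = "x - c * t"
  have d: "((\<lambda>s. \<phi> x s) has_real_derivative - (4 / m) * (- c * (l\<^sup>2 * (G ?z / (n ?z)\<^sup>2)) + 1)) (at t)"
    unfolding \<phi>_def by (rule derivative_eq_intros shift_t[OF \<Phi>_deriv] refl)+ (simp add: mult_ac)
  have pq: "P ?z * Q ?z = m * l * G ?z / 2" using PQ_prod[of ?z] by simp
  have "- (4 / m) * (- c * (l\<^sup>2 * (G ?z / (n ?z)\<^sup>2)) + 1) = - 4 * m * ((n ?z)\<^sup>2 - c * l\<^sup>2 * G ?z) / (m * n ?z)\<^sup>2"
    using m n_nz[of ?z] by (simp add: field_simps power2_eq_square)
  \<comment> \<open>The explicit t in the phase contributes n^2, which \<open>first_integral\<close>
    trades for u'^2 and G^2.\<close>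
  also have "- 4 * m * ((n ?z)\<^sup>2 - c * l\<^sup>2 * G ?z) =
      - 8 * (l * deriv u ?z * (2 * m * l * deriv u ?z) - (4 * l^3 + 2 * l * (u ?z)\<^sup>2) * (m * l * G ?z / 2))"
    unfolding first_integral[symmetric] G_def by algebra
  finally show ?thesis using d unfolding PQ_sum PQ_diff pq by simp
qed

lemma lax: "lax_solution (\<lambda>x t. u (x - c * t)) l p q"
  unfolding lax_solution_jet[OF jet_u]
proof (intro allI conjI)
  fix x t
  let ?z = "x - c * t"
  have pf: "p = (\<lambda>x t. P (x - c * t) * \<phi> x t - 2 * Q (x - c * t) / ((P (x - c * t))\<^sup>2 + (Q (x - c * t))\<^sup>2))"
    and qf: "q = (\<lambda>x t. Q (x - c * t) * \<phi> x t + 2 * P (x - c * t) / ((P (x - c * t))\<^sup>2 + (Q (x - c * t))\<^sup>2))"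
    unfolding \<phi>_def by (simp_all add: fun_eq_iff p_eq q_eq)
  note L = lax_PQ[unfolded lax_solution_jet[OF jet_u], rule_format]
  note dx = \<phi>_x conjunct1[OF L] conjunct1[OF conjunct2[OF L]]
  note dt = \<phi>_t conjunct1[OF conjunct2[OF conjunct2[OF L]]] conjunct2[OF conjunct2[OF conjunct2[OF L]]]
  note nz = PQ_sum_nz[of ?z]
  define a b f v v1 v2 where ab: "a = P ?z" "b = Q ?z" "f = \<phi> x t" "v = u ?z" "v1 = deriv u ?z"
    "v2 = e + c * v - 2 * v^3"
  show "((\<lambda>y. p y t) has_real_derivative l * p x t + u ?z * q x t) (at x)"
    unfolding pf qf
    apply (rule derivative_eq_intros dx refl nz)+
    using nz unfolding ab[symmetric] apply (simp add: divide_simps)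
    apply algebra
    done
  show "((\<lambda>y. q y t) has_real_derivative - u ?z * p x t - l * q x t) (at x)"
    unfolding pf qf
    apply (rule derivative_eq_intros dx refl nz)+
    using nz unfolding ab[symmetric] apply (simp add: divide_simps)
    apply algebra
    done
  show "((\<lambda>s. p x s) has_real_derivative
      (- 4 * l ^ 3 - 2 * l * (u ?z)\<^sup>2) * p x t +
      (- 4 * l\<^sup>2 * u ?z - 2 * l * deriv u ?z - 2 * u ?z ^ 3 - (e + c * u ?z - 2 * u ?z ^ 3)) * q x t) (at t)"
    unfolding pf qf
    apply (rule derivative_eq_intros dt refl nz)+
    using nz unfolding ab[symmetric] apply (simp add: divide_simps)
    apply algebra
    done
  show "((\<lambda>s. q x s) has_real_derivative
      (4 * l\<^sup>2 * u ?z - 2 * l * deriv u ?z + 2 * u ?z ^ 3 + (e + c * u ?z - 2 * u ?z ^ 3)) * p x t +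
      (4 * l ^ 3 + 2 * l * (u ?z)\<^sup>2) * q x t) (at t)"
    unfolding pf qf
    apply (rule derivative_eq_intros dt refl nz)+
    using nz unfolding ab[symmetric] apply (simp add: divide_simps)
    apply algebra
    done
qed

lemma pq_rot:
  "p x t = 2 * (P (x - c * t) * \<tau> x t - Q (x - c * t)) / (m * n (x - c * t))"
  "q x t = 2 * (Q (x - c * t) * \<tau> x t + P (x - c * t)) / (m * n (x - c * t))"
  unfolding p_eq q_eq \<tau>_def PQ_sum using m n_nz[of "x - c * t"] by (simp_all add: field_simps)

lemma pq_sum: "(p x t)\<^sup>2 + (q x t)\<^sup>2 = 4 / (m * n (x - c * t)) * (1 + (\<tau> x t)\<^sup>2)"
proof -
  let ?z = "x - c * t"
  have "(p x t)\<^sup>2 + (q x t)\<^sup>2 = 4 * (((P ?z)\<^sup>2 + (Q ?z)\<^sup>2) * (1 + (\<tau> x t)\<^sup>2)) / (m * n ?z)\<^sup>2"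
    unfolding pq_rot power_divide add_divide_distrib[symmetric] by (rule arg_cong[where f = "\<lambda>x. x / _"]) algebra
  then show ?thesis unfolding PQ_sum using m n_nz[of ?z] by (simp add: power2_eq_square)
qed

lemma mn_pos: "m * n z > 0"
  unfolding PQ_sum[symmetric] using PQ_sum_nz[of z] by (metis less_eq_real_def sum_power2_ge_zero)

lemma pq_sum_pos: "(p x t)\<^sup>2 + (q x t)\<^sup>2 > 0"
  unfolding pq_sum by (intro mult_pos_pos divide_pos_pos[OF _ mn_pos] add_pos_nonneg) auto

text \<open>The double angle of tau + i has cosine (tau^2 - 1) / (1 + tau^2) and sine 2 tau / (1 +
  tau^2). Both formulas are the addition theorems for turning the direction of (P, Q) by it.\<close>

lemma gam_pq: "gam (p x t) (q x t) = (gam (P (x - c * t)) (Q (x - c * t)) * ((\<tau> x t)\<^sup>2 - 1)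
    - 2 * sig (P (x - c * t)) (Q (x - c * t)) * \<tau> x t) / (1 + (\<tau> x t)\<^sup>2)"
  and sig_pq: "sig (p x t) (q x t) = (sig (P (x - c * t)) (Q (x - c * t)) * ((\<tau> x t)\<^sup>2 - 1)
    + 2 * gam (P (x - c * t)) (Q (x - c * t)) * \<tau> x t) / (1 + (\<tau> x t)\<^sup>2)"
proof -
  let ?z = "x - c * t"
  define a b T M where "a = P ?z" and "b = Q ?z" and "T = \<tau> x t" and "M = m * n ?z"
  have M: "M > 0" "a\<^sup>2 + b\<^sup>2 = M" unfolding M_def a_def b_def PQ_sum using mn_pos by auto
  have T: "1 + T\<^sup>2 > 0" by (simp add: add_pos_nonneg)
  have p: "p x t = 2 * (a * T - b) / M" and q: "q x t = 2 * (b * T + a) / M"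
    unfolding pq_rot a_def b_def T_def M_def by auto
  have s: "(p x t)\<^sup>2 + (q x t)\<^sup>2 = 4 * (1 + T\<^sup>2) / M"
    unfolding pq_sum T_def M_def by simp
  have "(p x t)\<^sup>2 - (q x t)\<^sup>2 = 4 * ((a * T - b)\<^sup>2 - (b * T + a)\<^sup>2) / M\<^sup>2"
    unfolding p q power_divide diff_divide_distrib[symmetric] power_mult_distrib by simp
  also have "(a * T - b)\<^sup>2 - (b * T + a)\<^sup>2 = (a\<^sup>2 - b\<^sup>2) * (T\<^sup>2 - 1) - 2 * (2 * a * b) * T" by algebra
  finally have d: "(p x t)\<^sup>2 - (q x t)\<^sup>2 = 4 * ((a\<^sup>2 - b\<^sup>2) * (T\<^sup>2 - 1) - 2 * (2 * a * b) * T) / M\<^sup>2" .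
  show "gam (p x t) (q x t) = (gam (P ?z) (Q ?z) * ((\<tau> x t)\<^sup>2 - 1) - 2 * sig (P ?z) (Q ?z) * \<tau> x t) / (1 + (\<tau> x t)\<^sup>2)"
    unfolding gam_def sig_def a_def[symmetric] b_def[symmetric] T_def[symmetric] s d M(2)
    using M(1) T by (simp add: divide_simps power2_eq_square) algebra
  have "2 * p x t * q x t = 4 * (2 * ((a * T - b) * (b * T + a))) / M\<^sup>2"
    unfolding p q by (simp add: power2_eq_square) algebra
  also have "2 * ((a * T - b) * (b * T + a)) = (2 * a * b) * (T\<^sup>2 - 1) + 2 * (a\<^sup>2 - b\<^sup>2) * T" by algebra
  finally have d: "2 * p x t * q x t = 4 * ((2 * a * b) * (T\<^sup>2 - 1) + 2 * (a\<^sup>2 - b\<^sup>2) * T) / M\<^sup>2" .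
  show "sig (p x t) (q x t) = (sig (P ?z) (Q ?z) * ((\<tau> x t)\<^sup>2 - 1) + 2 * gam (P ?z) (Q ?z) * \<tau> x t) / (1 + (\<tau> x t)\<^sup>2)"
    unfolding gam_def sig_def a_def[symmetric] b_def[symmetric] T_def[symmetric] s d M(2)
    using M(1) T by (simp add: divide_simps power2_eq_square) algebra
qed

end

lemma growing_solution_if_second_solution:
  assumes "second_solution u c e l p q" and "l \<noteq> 0" and "\<And>z. e + 4 * l\<^sup>2 * u z \<noteq> 0"
  obtains m P Q \<psi> where "growing_solution u c e l m P Q \<psi> p q"
proof -
  obtain m P Q \<psi> where eig: "periodic_eigenfunction u c e l m P Q" and
    pq: "\<And>x t. let p' = P (x - c * t); q' = Q (x - c * t);
                  \<phi> = - (4 / m) *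
                    (l\<^sup>2 * (LBINT y=0..x - c * t.
                        (c - 4 * l\<^sup>2 - 2 * (u y)\<^sup>2) / (e + 4 * l\<^sup>2 * u y)\<^sup>2)
                     + t + \<psi>)
              in p x t = p' * \<phi> - 2 * q' / (p'\<^sup>2 + q'\<^sup>2) \<and>
                 q x t = q' * \<phi> + 2 * p' / (p'\<^sup>2 + q'\<^sup>2)"
    using assms(1) unfolding second_solution_def by blast
  interpret eigenfunction u c e l m P Q using eig assms by unfold_locales
  have "growing_solution u c e l m P Q \<psi> p q"
    using pq unfolding Let_def by unfold_locales (simp_all add: \<Phi>_def n_def G_def)
  then show thesis by (rule that)
qed

section \<open>Growth and limiting direction of the second solution\<close>

text \<open>\<open>M\<close> is the mean slope of the phase integral and \<open>B\<close> bounds its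
  deviation from \<open>M * z\<close>; \<open>lo\<close> and \<open>hi\<close> enclose the absolute
  value of the denominator \<open>n\<close>. The asymptotics thus become independent of elliptic
  functions.\<close>

locale localized_solution = growing_solution +
  fixes M B lo hi :: real
  assumes M: "M \<noteq> 0"
    and \<Phi>_bound: "\<And>z. \<bar>\<Phi> z - M * z\<bar> \<le> B"
    and lo: "0 < lo" "\<And>z. lo \<le> \<bar>n z\<bar>"
    and hi: "\<And>z. \<bar>n z\<bar> \<le> hi"
begin

text \<open>Chosen so that M (x - c t) + t = M (x - speed t).\<close>

abbreviation "speed \<equiv> c - 1 / M"

definition "y x t = \<Phi> (x - c * t) + t + \<psi>"

lemma \<tau>_y: "\<tau> x t = - 2 * n (x - c * t) * y x t"
  unfolding \<tau>_def y_def by simp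

lemma y_bound: "\<bar>y x t - M * (x - speed * t)\<bar> \<le> B + \<bar>\<psi>\<bar>"
proof -
  have "y x t - M * (x - speed * t) = (\<Phi> (x - c * t) - M * (x - c * t)) + \<psi>"
    unfolding y_def using M by (simp add: algebra_simps)
  then show ?thesis using \<Phi>_bound[of "x - c * t"] by linarith
qed

lemma y_lower: "\<bar>M\<bar> * \<bar>x - speed * t\<bar> - (B + \<bar>\<psi>\<bar>) \<le> \<bar>y x t\<bar>"
  using y_bound[of x t] unfolding abs_mult[symmetric] by linarith

lemma y_upper: "\<bar>y x t\<bar> \<le> \<bar>M\<bar> * \<bar>x - speed * t\<bar> + (B + \<bar>\<psi>\<bar>)"
  using y_bound[of x t] unfolding abs_mult[symmetric] by linarith

lemma B_nonneg: "0 \<le> B"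
  using \<Phi>_bound[of 0] by linarith

text \<open>By \<open>pq_sum\<close> the squared norm is 4 / |m n| + 16 |n| y^2 / |m|. The second
  term alone gives this bound; estimating both gives \<open>norm_upper\<close>.\<close>

lemma norm_lower: "4 * sqrt (lo / \<bar>m\<bar>) * \<bar>y x t\<bar> \<le> norm (p x t, q x t)"
proof -
  let ?z = "x - c * t"
  have mn: "m * n ?z = \<bar>m\<bar> * \<bar>n ?z\<bar>" using mn_pos[of ?z] by (simp add: abs_mult[symmetric])
  have "lo / \<bar>m\<bar> * (4 * \<bar>y x t\<bar>)\<^sup>2 \<le> \<bar>n ?z\<bar> / \<bar>m\<bar> * (4 * \<bar>y x t\<bar>)\<^sup>2"
    using lo(2)[of ?z] by (intro mult_right_mono divide_right_mono) auto
  also have "\<dots> \<le> 4 / (\<bar>m\<bar> * \<bar>n ?z\<bar>) + \<bar>n ?z\<bar> / \<bar>m\<bar> * (4 * \<bar>y x t\<bar>)\<^sup>2" by simp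
  also have "\<dots> = (p x t)\<^sup>2 + (q x t)\<^sup>2"
    unfolding pq_sum mn \<tau>_y using m n_nz[of ?z]
    by (simp add: field_simps power2_eq_square abs_mult_self_eq)
  finally have "sqrt (lo / \<bar>m\<bar> * (4 * \<bar>y x t\<bar>)\<^sup>2) \<le> norm (p x t, q x t)"
    unfolding norm_Pair real_norm_def power2_abs by (rule real_sqrt_le_mono)
  then show ?thesis unfolding real_sqrt_mult real_sqrt_abs by (simp add: mult_ac)
qed

lemma norm_upper: "norm (p x t, q x t) \<le> sqrt (4 / (\<bar>m\<bar> * lo)) + 4 * sqrt (hi / \<bar>m\<bar>) * \<bar>y x t\<bar>"
proof -
  let ?z = "x - c * t"
  have mn: "m * n ?z = \<bar>m\<bar> * \<bar>n ?z\<bar>" using mn_pos[of ?z] by (simp add: abs_mult[symmetric])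
  have hi0: "0 \<le> hi" using hi[of ?z] by linarith
  have "(p x t)\<^sup>2 + (q x t)\<^sup>2 = 4 / (\<bar>m\<bar> * \<bar>n ?z\<bar>) + \<bar>n ?z\<bar> / \<bar>m\<bar> * (4 * \<bar>y x t\<bar>)\<^sup>2"
    unfolding pq_sum mn \<tau>_y using m n_nz[of ?z]
    by (simp add: field_simps power2_eq_square abs_mult_self_eq)
  also have "\<dots> \<le> 4 / (\<bar>m\<bar> * lo) + hi / \<bar>m\<bar> * (4 * \<bar>y x t\<bar>)\<^sup>2"
    using m lo(1) lo(2)[of ?z] hi[of ?z]
    by (intro add_mono mult_right_mono divide_right_mono divide_left_mono mult_left_mono mult_pos_pos) auto
  finally have "norm (p x t, q x t) \<le> sqrt (4 / (\<bar>m\<bar> * lo) + hi / \<bar>m\<bar> * (4 * \<bar>y x t\<bar>)\<^sup>2)"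
    unfolding norm_Pair real_norm_def power2_abs by (rule real_sqrt_le_mono)
  also have "\<dots> \<le> sqrt (4 / (\<bar>m\<bar> * lo)) + sqrt (hi / \<bar>m\<bar> * (4 * \<bar>y x t\<bar>)\<^sup>2)"
    using lo(1) hi0 by (intro sqrt_add_le_add_sqrt) auto
  finally show ?thesis unfolding real_sqrt_mult real_sqrt_abs by (simp add: mult_ac)
qed

text \<open>The phase is arbitrary: \<open>y\<close> is bounded on each line of this slope, and
  along a transversal ray it is comparable with the ray parameter.\<close>

lemma linear_growth: "linearly_growing_except_line p q speed \<xi>"
  unfolding linearly_growing_except_line_def
proof (intro conjI allI impI)
  fix x0 t0 a b :: real
  assume ne: "a - speed * b \<noteq> 0"
  define \<beta> where "\<beta> = \<bar>a - speed * b\<bar>"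
  \<comment> \<open>\<open>K\<close> collects what does not grow along the ray: the offset of the
    starting point and the deviation of the phase from its linear part.\<close>
  define K where "K = \<bar>M\<bar> * \<bar>x0 - speed * t0\<bar> + (B + \<bar>\<psi>\<bar>)"
  define c1 C0 C1 where "c1 = 4 * sqrt (lo / \<bar>m\<bar>)" and "C0 = sqrt (4 / (\<bar>m\<bar> * lo))"
    and "C1 = 4 * sqrt (hi / \<bar>m\<bar>)"
  have hi0: "0 < hi" using hi[of 0] lo(1) lo(2)[of 0] by linarith
  have pos: "\<beta> > 0" "c1 > 0" "C0 \<ge> 0" "C1 > 0" "K \<ge> 0" "\<bar>M\<bar> > 0"
    using ne m lo(1) hi0 M B_nonneg unfolding \<beta>_def c1_def C0_def C1_def K_def by auto
  have line: "(x0 + r * a) - speed * (t0 + r * b) = (x0 - speed * t0) + r * (a - speed * b)" for r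
    by (simp add: algebra_simps)
  have "\<forall>\<^sub>F r in at_top. c1 * (\<bar>M\<bar> * \<beta> / 2) * norm r \<le> norm (norm (p (x0 + r * a) (t0 + r * b), q (x0 + r * a) (t0 + r * b)))
      \<and> norm (norm (p (x0 + r * a) (t0 + r * b), q (x0 + r * a) (t0 + r * b))) \<le> (C0 + C1 * (\<bar>M\<bar> * \<beta> + K)) * norm r"
    \<comment> \<open>Beyond this threshold \<open>K\<close> is at most half of the linear term, and
      r >= 1 absorbs the constants of the upper bound into multiples of r.\<close>
    using eventually_ge_at_top[of "max 1 (2 * K / (\<bar>M\<bar> * \<beta>))"]
  proof eventually_elim
    case (elim r)
    then have r: "1 \<le> r" "2 * K / (\<bar>M\<bar> * \<beta>) \<le> r" by auto
    define Y where "Y = \<bar>y (x0 + r * a) (t0 + r * b)\<bar>"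
    have tri: "r * \<beta> - \<bar>x0 - speed * t0\<bar> \<le> \<bar>(x0 + r * a) - speed * (t0 + r * b)\<bar>"
      "\<bar>(x0 + r * a) - speed * (t0 + r * b)\<bar> \<le> \<bar>x0 - speed * t0\<bar> + r * \<beta>"
    proof -
      have "\<bar>r * (a - speed * b)\<bar> = r * \<beta>" unfolding \<beta>_def abs_mult using r(1) by simp
      then show "r * \<beta> - \<bar>x0 - speed * t0\<bar> \<le> \<bar>(x0 + r * a) - speed * (t0 + r * b)\<bar>"
        "\<bar>(x0 + r * a) - speed * (t0 + r * b)\<bar> \<le> \<bar>x0 - speed * t0\<bar> + r * \<beta>"
        unfolding line by linarith+
    qed
    have "\<bar>M\<bar> * (r * \<beta> - \<bar>x0 - speed * t0\<bar>) - (B + \<bar>\<psi>\<bar>) \<le> Y"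
      using y_lower[of "x0 + r * a" "t0 + r * b"] mult_left_mono[OF tri(1), of "\<bar>M\<bar>"]
      unfolding Y_def by linarith
    then have "\<bar>M\<bar> * \<beta> * r - K \<le> Y" unfolding K_def by (simp add: algebra_simps)
    moreover have "K \<le> \<bar>M\<bar> * \<beta> / 2 * r" using r(2) pos by (simp add: field_simps)
    ultimately have low: "\<bar>M\<bar> * \<beta> / 2 * r \<le> Y" by (simp add: field_simps)
    have "Y \<le> \<bar>M\<bar> * (\<bar>x0 - speed * t0\<bar> + r * \<beta>) + (B + \<bar>\<psi>\<bar>)"
      using y_upper[of "x0 + r * a" "t0 + r * b"] mult_left_mono[OF tri(2), of "\<bar>M\<bar>"]
      unfolding Y_def by linarith
    then have "Y \<le> \<bar>M\<bar> * \<beta> * r + K * 1" unfolding K_def by (simp add: algebra_simps)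
    also have "\<dots> \<le> \<bar>M\<bar> * \<beta> * r + K * r" using r(1) pos by (intro add_left_mono mult_left_mono) auto
    finally have up: "Y \<le> (\<bar>M\<bar> * \<beta> + K) * r" by (simp add: algebra_simps)
    have "c1 * (\<bar>M\<bar> * \<beta> / 2 * r) \<le> c1 * Y" using low pos by (intro mult_left_mono) auto
    also have "\<dots> \<le> norm (p (x0 + r * a) (t0 + r * b), q (x0 + r * a) (t0 + r * b))"
      unfolding c1_def Y_def by (rule norm_lower)
    finally have 1: "c1 * (\<bar>M\<bar> * \<beta> / 2 * r) \<le> norm (p (x0 + r * a) (t0 + r * b), q (x0 + r * a) (t0 + r * b))" .
    have "norm (p (x0 + r * a) (t0 + r * b), q (x0 + r * a) (t0 + r * b)) \<le> C0 + C1 * Y"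
      unfolding C0_def C1_def Y_def by (rule norm_upper)
    also have "\<dots> \<le> C0 * r + C1 * ((\<bar>M\<bar> * \<beta> + K) * r)"
      using up pos r(1) by (intro add_mono mult_left_mono) (auto simp: mult_le_cancel_left1)
    finally show ?case using 1 r(1) by (simp add: algebra_simps)
  qed
  moreover have "C0 + C1 * (\<bar>M\<bar> * \<beta> + K) > 0"
    using pos by (intro add_nonneg_pos mult_pos_pos add_pos_nonneg) auto
  moreover have "c1 * (\<bar>M\<bar> * \<beta> / 2) > 0" using pos by simp
  ultimately show "(\<lambda>r. norm (p (x0 + r * a) (t0 + r * b), q (x0 + r * a) (t0 + r * b))) \<in> \<Theta>(\<lambda>r. r)"
    by (intro bigthetaI'[where ?c1.0 = "c1 * (\<bar>M\<bar> * \<beta> / 2)" and ?c2.0 = "C0 + C1 * (\<bar>M\<bar> * \<beta> + K)"])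
next
  have hi0: "0 < hi" using hi[of 0] lo(1) lo(2)[of 0] by linarith
  show "bounded {(p x t, q x t) |x t. x - speed * t = \<xi>}"
  proof (rule boundedI)
    fix z assume "z \<in> {(p x t, q x t) |x t. x - speed * t = \<xi>}"
    then obtain x t where z: "z = (p x t, q x t)" and \<xi>: "x - speed * t = \<xi>" by blast
    have "\<bar>y x t\<bar> \<le> \<bar>M\<bar> * \<bar>\<xi>\<bar> + (B + \<bar>\<psi>\<bar>)" using y_upper[of x t] unfolding \<xi> .
    then have "4 * sqrt (hi / \<bar>m\<bar>) * \<bar>y x t\<bar> \<le> 4 * sqrt (hi / \<bar>m\<bar>) * (\<bar>M\<bar> * \<bar>\<xi>\<bar> + (B + \<bar>\<psi>\<bar>))"
      using hi0 by (intro mult_left_mono) auto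
    then show "norm z \<le> sqrt (4 / (\<bar>m\<bar> * lo)) + 4 * sqrt (hi / \<bar>m\<bar>) * (\<bar>M\<bar> * \<bar>\<xi>\<bar> + (B + \<bar>\<psi>\<bar>))"
      using norm_upper[of x t] unfolding z by linarith
  qed
qed

text \<open>The points (cos theta, sin theta) belonging to the eigenfunction and to the second
  solution. The first is written through u, so P and Q disappear.\<close>

definition "periodic_dir z = (2 * l * deriv u z / n z, l * G z / n z)"
definition "growing_dir x t = (gam (p x t) (q x t), sig (p x t) (q x t))"

lemma periodic_dir_circle: "(fst (periodic_dir z))\<^sup>2 + (snd (periodic_dir z))\<^sup>2 = 1"
  unfolding periodic_dir_def fst_conv snd_conv gam_PQ[symmetric] sig_PQ[symmetric]
  by (rule sig_gam_circle[OF PQ_sum_nz])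

lemma growing_dir_circle: "(fst (growing_dir x t))\<^sup>2 + (snd (growing_dir x t))\<^sup>2 = 1"
  unfolding growing_dir_def fst_conv snd_conv
  by (rule sig_gam_circle[OF less_imp_neq[OF pq_sum_pos, symmetric]])

lemma growing_dir_rot:
  "growing_dir x t = ((fst (periodic_dir (x - c * t)) * ((\<tau> x t)\<^sup>2 - 1) - 2 * snd (periodic_dir (x - c * t)) * \<tau> x t) / (1 + (\<tau> x t)\<^sup>2),
    (snd (periodic_dir (x - c * t)) * ((\<tau> x t)\<^sup>2 - 1) + 2 * fst (periodic_dir (x - c * t)) * \<tau> x t) / (1 + (\<tau> x t)\<^sup>2))"
  unfolding growing_dir_def periodic_dir_def gam_pq sig_pq gam_PQ sig_PQ by simp

text \<open>Turning by the double angle of tau + i differs from the identity by O(1 / |tau|); each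
  coordinate contributes 4 to the constant.\<close>

lemma growing_dir_dist: "dist (growing_dir x t) (periodic_dir (x - c * t)) \<le> 8 / (1 + \<bar>\<tau> x t\<bar>)"
proof -
  define g s T where "g = fst (periodic_dir (x - c * t))" and "s = snd (periodic_dir (x - c * t))" and "T = \<tau> x t"
  have gs: "\<bar>g\<bar> \<le> 1" "\<bar>s\<bar> \<le> 1"
  proof -
    have "g\<^sup>2 \<le> 1" "s\<^sup>2 \<le> 1"
      using periodic_dir_circle[of "x - c * t"] zero_le_power2[of g] zero_le_power2[of s]
      unfolding g_def s_def by linarith+
    then show "\<bar>g\<bar> \<le> 1" "\<bar>s\<bar> \<le> 1" by (simp_all add: abs_square_le_1)
  qed
  have T: "1 + T\<^sup>2 > 0" by (simp add: add_pos_nonneg)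
  have key: "\<bar>- 2 * a - 2 * b * T\<bar> / (1 + T\<^sup>2) \<le> 4 / (1 + \<bar>T\<bar>)" if "\<bar>a\<bar> \<le> 1" "\<bar>b\<bar> \<le> 1" for a b
  proof -
    have "\<bar>2 * b * T\<bar> \<le> 2 * \<bar>T\<bar>" unfolding abs_mult using that(2) by (simp add: mult_left_le_one_le)
    moreover have "\<bar>- 2 * a\<bar> \<le> 2" using that(1) by (simp add: abs_mult)
    ultimately have "\<bar>- 2 * a\<bar> + \<bar>2 * b * T\<bar> \<le> 2 + 2 * \<bar>T\<bar>" by (rule add_mono[rotated])
    from order_trans[OF abs_triangle_ineq4 this]
    have 1: "\<bar>- 2 * a - 2 * b * T\<bar> \<le> 2 * (1 + \<bar>T\<bar>)" by simp
    \<comment> \<open>Converts the natural denominator 1 + T^2 into 1 + |T|.\<close>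
    have "(1 + \<bar>T\<bar>)\<^sup>2 \<le> 2 * (1 + T\<^sup>2)"
    proof -
      have "0 \<le> (1 - \<bar>T\<bar>)\<^sup>2" by simp
      also have "\<dots> = 2 * (1 + T\<^sup>2) - (1 + \<bar>T\<bar>)\<^sup>2" by (simp add: power2_eq_square algebra_simps)
      finally show ?thesis by simp
    qed
    then have "2 * (1 + \<bar>T\<bar>) * (1 + \<bar>T\<bar>) \<le> 4 * (1 + T\<^sup>2)"
      unfolding mult.assoc power2_eq_square[symmetric] by linarith
    then have "2 * (1 + \<bar>T\<bar>) / (1 + T\<^sup>2) \<le> 4 / (1 + \<bar>T\<bar>)"
      unfolding pos_divide_le_eq[OF T] times_divide_eq_left
      by (subst pos_le_divide_eq) auto
    moreover have "\<bar>- 2 * a - 2 * b * T\<bar> / (1 + T\<^sup>2) \<le> 2 * (1 + \<bar>T\<bar>) / (1 + T\<^sup>2)"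
      using 1 T by (intro divide_right_mono) auto
    ultimately show ?thesis by linarith
  qed
  have "(g * (T\<^sup>2 - 1) - 2 * s * T) / (1 + T\<^sup>2) - g = (- 2 * g - 2 * s * T) / (1 + T\<^sup>2)"
    using T by (simp add: field_simps)
  then have d1: "\<bar>fst (growing_dir x t) - g\<bar> \<le> 4 / (1 + \<bar>T\<bar>)"
    using key[OF gs] T unfolding growing_dir_rot g_def[symmetric] s_def[symmetric] T_def[symmetric] by simp
  have "(s * (T\<^sup>2 - 1) + 2 * g * T) / (1 + T\<^sup>2) - s = (- 2 * s - 2 * (- g) * T) / (1 + T\<^sup>2)"
    using T by (simp add: field_simps)
  then have d2: "\<bar>snd (growing_dir x t) - s\<bar> \<le> 4 / (1 + \<bar>T\<bar>)"
    using key[of s "- g"] gs T unfolding growing_dir_rot g_def[symmetric] s_def[symmetric] T_def[symmetric] by simp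
  have "dist (growing_dir x t) (periodic_dir (x - c * t)) \<le> \<bar>fst (growing_dir x t) - g\<bar> + \<bar>snd (growing_dir x t) - s\<bar>"
    unfolding dist_prod_def g_def s_def dist_real_def by (rule sqrt_sum_squares_le_sum_abs[THEN order_trans]) simp
  with d1 d2 show ?thesis unfolding T_def by simp
qed

lemma growing_dir_approach:
  assumes "\<delta> > 0"
  obtains R where "\<And>x t. \<bar>x - speed * t\<bar> > R \<Longrightarrow> dist (growing_dir x t) (periodic_dir (x - c * t)) < \<delta>"
proof
  fix x t
  \<comment> \<open>If |y| > \<open>K\<close>, then |tau| >= 2 \<open>lo\<close> |y| > 8 /
    \<open>\<delta>\<close>, as \<open>growing_dir_dist\<close> requires.\<close>
  define K where "K = 4 / (\<delta> * lo)"
  assume "\<bar>x - speed * t\<bar> > (4 / (\<delta> * lo) + (B + \<bar>\<psi>\<bar>)) / \<bar>M\<bar>"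
  then have "K + (B + \<bar>\<psi>\<bar>) < \<bar>x - speed * t\<bar> * \<bar>M\<bar>"
    using M unfolding K_def[symmetric] by (subst (asm) pos_divide_less_eq) auto
  then have "K < \<bar>M\<bar> * \<bar>x - speed * t\<bar> - (B + \<bar>\<psi>\<bar>)"
    by (simp add: mult.commute)
  then have y: "K < \<bar>y x t\<bar>" using y_lower[of x t] by linarith
  have K: "K > 0" unfolding K_def using assms lo(1) by simp
  have "8 / \<delta> = 2 * lo * K" unfolding K_def using assms lo(1) by simp
  also have "\<dots> < 2 * lo * \<bar>y x t\<bar>" using y lo(1) by simp
  also have "\<dots> \<le> 2 * \<bar>n (x - c * t)\<bar> * \<bar>y x t\<bar>"
    using lo(2)[of "x - c * t"] by (intro mult_right_mono) auto
  also have "\<dots> = \<bar>\<tau> x t\<bar>" unfolding \<tau>_y by (simp add: abs_mult)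
  finally have "8 / \<delta> < 1 + \<bar>\<tau> x t\<bar>" by linarith
  then have "8 / (1 + \<bar>\<tau> x t\<bar>) < \<delta>"
    using assms by (simp add: divide_less_eq mult.commute)
  then show "dist (growing_dir x t) (periodic_dir (x - c * t)) < \<delta>" using growing_dir_dist[of x t] by linarith
qed

lemma growing_dir_flip:
  assumes "L > 0"
  obtains X T :: "nat \<Rightarrow> real" and B' where "\<And>k. X k - c * T k = real k * L"
    "\<And>k. growing_dir (X k) (T k) = - periodic_dir (real k * L)" "\<And>k. \<bar>X k - speed * T k\<bar> \<le> B'"
    "filterlim T at_infinity sequentially"
proof
  \<comment> \<open>At this time y, and hence tau, vanishes on the line x - c t = k L; the double
    angle of i is pi, so the direction is reversed. These times are unbounded since
    \<open>\<Phi>\<close> has the nonzero slope \<open>M\<close>.\<close>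
  define T where "T k = - \<Phi> (real k * L) - \<psi>" for k
  define X where "X k = real k * L + c * T k" for k
  show z: "X k - c * T k = real k * L" for k unfolding X_def by simp
  have y: "y (X k) (T k) = 0" for k unfolding y_def z unfolding T_def by simp
  show "growing_dir (X k) (T k) = - periodic_dir (real k * L)" for k
    unfolding growing_dir_rot z \<tau>_y y by (simp add: prod_eq_iff)
  show "\<bar>X k - speed * T k\<bar> \<le> (B + \<bar>\<psi>\<bar>) / \<bar>M\<bar>" for k
    using y_lower[of "X k" "T k"] M unfolding y by (simp add: le_divide_eq mult.commute)
  have "filterlim (\<lambda>k. norm (T k)) at_top sequentially"
  proof (rule filterlim_at_top_mono)
    have "filterlim (\<lambda>k. - (B + \<bar>\<psi>\<bar>) + \<bar>M\<bar> * L * real k) at_top sequentially"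
      using M assms
      by (intro filterlim_tendsto_add_at_top[OF tendsto_const]
          filterlim_tendsto_pos_mult_at_top[OF tendsto_const _ filterlim_real_sequentially]) auto
    then show "filterlim (\<lambda>k. \<bar>M\<bar> * L * real k - (B + \<bar>\<psi>\<bar>)) at_top sequentially"
      by (simp add: algebra_simps)
    show "\<forall>\<^sub>F k in sequentially. \<bar>M\<bar> * L * real k - (B + \<bar>\<psi>\<bar>) \<le> norm (T k)"
    proof (intro always_eventually allI)
      fix k
      have "\<bar>M * (real k * L)\<bar> = \<bar>M\<bar> * L * real k" using assms by (simp add: abs_mult)
      then show "\<bar>M\<bar> * L * real k - (B + \<bar>\<psi>\<bar>) \<le> norm (T k)"
        using \<Phi>_bound[of "real k * L"] unfolding T_def real_norm_def by linarith
    qed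
  qed
  then show "filterlim T at_infinity sequentially"
    by (rule filterlim_norm_at_top_imp_at_infinity)
qed

end

section \<open>Algebraic solitons on a background\<close>

definition circle :: "(real \<times> real) set" where
  "circle = {z. (fst z)\<^sup>2 + (snd z)\<^sup>2 = 1}"

lemma circle_iff: "z \<in> circle \<longleftrightarrow> (fst z)\<^sup>2 + (snd z)\<^sup>2 = 1"
  unfolding circle_def by simp

lemma uminus_circle: "- z \<in> circle \<longleftrightarrow> z \<in> circle"
  unfolding circle_iff by simp

lemma compact_circle: "compact circle"
proof -
  have "circle = sphere 0 1"
    by (auto simp: circle_iff norm_prod_def real_sqrt_eq_1_iff)
  then show ?thesis by (metis compact_sphere)
qed

text \<open>Uniform continuity on a product of circles, stated for families over the naturals so
  that one, two and three directions are treated alike.\<close>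

definition unif_on_circle :: "nat set \<Rightarrow> ((nat \<Rightarrow> real \<times> real) \<Rightarrow> real) \<Rightarrow> bool" where
  "unif_on_circle J F \<longleftrightarrow> (\<forall>\<epsilon>>0. \<exists>\<delta>>0. \<forall>E E'.
     (\<forall>j\<in>J. E j \<in> circle \<and> E' j \<in> circle \<and> dist (E j) (E' j) < \<delta>) \<longrightarrow> \<bar>F E - F E'\<bar> < \<epsilon>)"

lemma unif_on_circleE:
  assumes "unif_on_circle J F" and "\<epsilon> > 0"
  obtains \<delta> where "\<delta> > 0" and "\<And>E E'. (\<And>j. j \<in> J \<Longrightarrow> E j \<in> circle \<and> E' j \<in> circle \<and> dist (E j) (E' j) < \<delta>)
      \<Longrightarrow> \<bar>F E - F E'\<bar> < \<epsilon>"
proof -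
  obtain \<delta> where "\<delta> > 0" and \<delta>: "\<forall>E E'.
     (\<forall>j\<in>J. E j \<in> circle \<and> E' j \<in> circle \<and> dist (E j) (E' j) < \<delta>) \<longrightarrow> \<bar>F E - F E'\<bar> < \<epsilon>"
    using assms(1)[unfolded unif_on_circle_def, rule_format, OF assms(2)] by (elim exE conjE)
  show thesis
    by (rule that[OF \<open>\<delta> > 0\<close>]) (rule \<delta>[rule_format])
qed

lemma unif_on_circle_1: "unif_on_circle {j} (\<lambda>E. k * snd (E j))"
  unfolding unif_on_circle_def
proof (intro allI impI)
  fix \<epsilon> :: real assume "\<epsilon> > 0"
  let ?\<delta> = "\<epsilon> / (1 + \<bar>k\<bar>)"
  have "\<bar>k * snd (E j) - k * snd (E' j)\<bar> < \<epsilon>" if "dist (E j) (E' j) < ?\<delta>" for E E' :: "nat \<Rightarrow> real \<times> real"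
  proof -
    have "\<bar>k * snd (E j) - k * snd (E' j)\<bar> = \<bar>k\<bar> * dist (snd (E j)) (snd (E' j))"
      unfolding dist_real_def abs_mult[symmetric] by (simp add: algebra_simps)
    also have "\<dots> \<le> (1 + \<bar>k\<bar>) * dist (E j) (E' j)"
      by (intro mult_mono dist_snd_le) auto
    also have "\<dots> < \<epsilon>" using that by (simp add: pos_less_divide_eq mult.commute add_pos_nonneg)
    finally show ?thesis .
  qed
  then show "\<exists>\<delta>>0. \<forall>E E'. (\<forall>j\<in>{j}. E j \<in> circle \<and> E' j \<in> circle \<and> dist (E j) (E' j) < \<delta>) \<longrightarrow>
      \<bar>k * snd (E j) - k * snd (E' j)\<bar> < \<epsilon>"
    using \<open>\<epsilon> > 0\<close> by (intro exI[of _ ?\<delta>]) (auto simp: add_pos_nonneg)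
qed

lemma dist_Pair_le: "dist (a, b) (a', b') \<le> dist a a' + dist b b'"
  unfolding dist_prod_def fst_conv snd_conv by (rule sqrt_sum_squares_le_sum) auto

lemma unif_on_circle_2:
  fixes f :: "(real \<times> real) \<times> (real \<times> real) \<Rightarrow> real"
  assumes "continuous_on (circle \<times> circle) f"
  shows "unif_on_circle {i, j} (\<lambda>E. f (E i, E j))"
  unfolding unif_on_circle_def
proof (intro allI impI)
  fix \<epsilon> :: real assume "\<epsilon> > 0"
  have uc: "uniformly_continuous_on (circle \<times> circle) f"
    by (intro compact_uniformly_continuous assms compact_Times compact_circle)
  obtain \<delta> where \<delta>: "\<delta> > 0" "\<And>x x'. x \<in> circle \<times> circle \<Longrightarrow> x' \<in> circle \<times> circle \<Longrightarrow>
      dist x' x < \<delta> \<Longrightarrow> dist (f x') (f x) < \<epsilon>"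
    by (rule uniformly_continuous_onE[OF uc \<open>\<epsilon> > 0\<close>]) blast
  have "\<bar>f (E i, E j) - f (E' i, E' j)\<bar> < \<epsilon>"
    if h: "\<forall>k\<in>{i, j}. E k \<in> circle \<and> E' k \<in> circle \<and> dist (E k) (E' k) < \<delta> / 2"
    for E E' :: "nat \<Rightarrow> real \<times> real"
  proof -
    have "dist (E i, E j) (E' i, E' j) < \<delta>"
      using dist_Pair_le[of "E i" "E j" "E' i" "E' j"] h by fastforce
    then show ?thesis using \<delta>(2)[of "(E' i, E' j)" "(E i, E j)"] h by (auto simp: dist_real_def)
  qed
  then show "\<exists>\<delta>>0. \<forall>E E'. (\<forall>k\<in>{i, j}. E k \<in> circle \<and> E' k \<in> circle \<and> dist (E k) (E' k) < \<delta>) \<longrightarrow>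
      \<bar>f (E i, E j) - f (E' i, E' j)\<bar> < \<epsilon>"
    using \<delta>(1) by (intro exI[of _ "\<delta> / 2"]) auto
qed

lemma unif_on_circle_3:
  fixes f :: "(real \<times> real) \<times> (real \<times> real) \<times> (real \<times> real) \<Rightarrow> real"
  assumes "continuous_on (circle \<times> circle \<times> circle) f"
  shows "unif_on_circle {i, j, k} (\<lambda>E. f (E i, E j, E k))"
  unfolding unif_on_circle_def
proof (intro allI impI)
  fix \<epsilon> :: real assume "\<epsilon> > 0"
  have uc: "uniformly_continuous_on (circle \<times> circle \<times> circle) f"
    by (intro compact_uniformly_continuous assms compact_Times compact_circle)
  obtain \<delta> where \<delta>: "\<delta> > 0" "\<And>x x'. x \<in> circle \<times> circle \<times> circle \<Longrightarrow> x' \<in> circle \<times> circle \<times> circle \<Longrightarrow>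
      dist x' x < \<delta> \<Longrightarrow> dist (f x') (f x) < \<epsilon>"
    by (rule uniformly_continuous_onE[OF uc \<open>\<epsilon> > 0\<close>]) blast
  have "\<bar>f (E i, E j, E k) - f (E' i, E' j, E' k)\<bar> < \<epsilon>"
    if h: "\<forall>n\<in>{i, j, k}. E n \<in> circle \<and> E' n \<in> circle \<and> dist (E n) (E' n) < \<delta> / 3"
    for E E' :: "nat \<Rightarrow> real \<times> real"
  proof -
    have "dist (E i) (E' i) < \<delta> / 3" "dist (E j) (E' j) < \<delta> / 3" "dist (E k) (E' k) < \<delta> / 3"
      using h by auto
    then have "dist (E i, E j, E k) (E' i, E' j, E' k) < \<delta>"
      using dist_Pair_le[of "E i" "(E j, E k)" "E' i" "(E' j, E' k)"]
        dist_Pair_le[of "E j" "E k" "E' j" "E' k"] by linarith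
    then show ?thesis using \<delta>(2)[of "(E' i, E' j, E' k)" "(E i, E j, E k)"] h by (auto simp: dist_real_def)
  qed
  then show "\<exists>\<delta>>0. \<forall>E E'. (\<forall>n\<in>{i, j, k}. E n \<in> circle \<and> E' n \<in> circle \<and> dist (E n) (E' n) < \<delta>) \<longrightarrow>
      \<bar>f (E i, E j, E k) - f (E' i, E' j, E' k)\<bar> < \<epsilon>"
    using \<delta>(1) by (intro exI[of _ "\<delta> / 3"]) auto
qed

lemma unif_darboux2_shift:
  assumes "l1\<^sup>2 \<noteq> l2\<^sup>2"
  shows "unif_on_circle {i, j} (\<lambda>E. darboux2_shift l1 l2 (fst (E i)) (snd (E i)) (fst (E j)) (snd (E j)))"
proof -
  have "continuous_on (circle \<times> circle) (\<lambda>x. darboux2_shift l1 l2 (fst (fst x)) (snd (fst x)) (fst (snd x)) (snd (snd x)))"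
    unfolding darboux2_shift_def den2_def
  proof (intro continuous_intros ballI)
    fix x :: "(real \<times> real) \<times> (real \<times> real)" assume "x \<in> circle \<times> circle"
    then show "l1\<^sup>2 + l2\<^sup>2 - 2 * l1 * l2 * (fst (fst x) * fst (snd x) + snd (fst x) * snd (snd x)) \<noteq> 0"
      using den2_pos[OF _ _ assms, of "fst (fst x)" "snd (fst x)" "fst (snd x)" "snd (snd x)"]
      unfolding den2_def by (auto simp: mem_Times_iff circle_iff)
  qed
  from unif_on_circle_2[OF this, of i j] show ?thesis by simp
qed

lemma unif_darboux3_shift:
  assumes "l1\<^sup>2 \<noteq> l2\<^sup>2" "l1\<^sup>2 \<noteq> l3\<^sup>2" "l2\<^sup>2 \<noteq> l3\<^sup>2"
  shows "unif_on_circle {i, j, k} (\<lambda>E. darboux3_shift l1 l2 l3 (fst (E i)) (snd (E i)) (fst (E j)) (snd (E j)) (fst (E k)) (snd (E k)))"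
proof -
  have "continuous_on (circle \<times> circle \<times> circle) (\<lambda>x. darboux3_shift l1 l2 l3 (fst (fst x)) (snd (fst x))
      (fst (fst (snd x))) (snd (fst (snd x))) (fst (snd (snd x))) (snd (snd (snd x))))"
    unfolding darboux3_shift_def
  proof (rule continuous_on_divide)
    show "\<forall>x\<in>circle \<times> circle \<times> circle. den3 l1 l2 l3 (fst (fst x)) (snd (fst x))
      (fst (fst (snd x))) (snd (fst (snd x))) (fst (snd (snd x))) (snd (snd (snd x))) \<noteq> 0"
      using den3_pos[OF _ _ _ assms] by (auto simp: mem_Times_iff circle_iff less_imp_neq[symmetric])
  qed (unfold num3_def den3_def, (intro continuous_intros)+)
  from unif_on_circle_3[OF this, of i j k] show ?thesis by simp
qed

text \<open>The point of the line at the same time t gives the bound. So a large distance from the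
  line forces |x - s t - xi| to be large.\<close>

lemma infdist_soliton_line: "infdist (x, t) (soliton_line s \<xi>) \<le> \<bar>x - s * t - \<xi>\<bar>"
proof -
  have "(s * t + \<xi>, t) \<in> soliton_line s \<xi>" unfolding soliton_line_def by simp
  from infdist_le[OF this, of "(x, t)"] show ?thesis
    by (simp add: dist_prod_def dist_real_def algebra_simps)
qed

text \<open>Along the points of \<open>flip\<close>, direction j is opposite to its periodic value,
  while the other directions converge to theirs because their lines recede. So w - v tends to the
  difference of two values of F, which \<open>F_flip\<close> makes nonzero.\<close>

lemma adds_algebraic_solitons_criterion:
  fixes growing_dir :: "nat \<Rightarrow> real \<Rightarrow> real \<Rightarrow> real \<times> real" and periodic_dir :: "nat \<Rightarrow> real \<Rightarrow> real \<times> real"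
    and b :: "real \<Rightarrow> real \<Rightarrow> real" and F :: "(nat \<Rightarrow> real \<times> real) \<Rightarrow> real"
  assumes mkdv: "mkdv_solution w" and fin: "finite J" and unif: "unif_on_circle J F"
    and w: "\<And>x t. w x t = b x t + F (\<lambda>j. growing_dir j x t)"
    and v: "\<And>x t. v x t = b x t + F (\<lambda>j. periodic_dir j (x - c * t))"
    and circ: "\<And>j x t. j \<in> J \<Longrightarrow> growing_dir j x t \<in> circle" "\<And>j z. j \<in> J \<Longrightarrow> periodic_dir j z \<in> circle"
    and approach: "\<And>j \<delta>. j \<in> J \<Longrightarrow> \<delta> > 0 \<Longrightarrow>
      \<exists>R. \<forall>x t. \<bar>x - s j * t\<bar> > R \<longrightarrow> dist (growing_dir j x t) (periodic_dir j (x - c * t)) < \<delta>"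
    and flip: "\<And>j. j \<in> J \<Longrightarrow> \<exists>(X :: nat \<Rightarrow> real) T B. (\<forall>n. growing_dir j (X n) (T n) = - periodic_dir j 0 \<and>
      (\<forall>k\<in>J. periodic_dir k (X n - c * T n) = periodic_dir k 0) \<and> \<bar>X n - s j * T n\<bar> \<le> B) \<and> filterlim T at_infinity sequentially"
    and speeds: "\<And>j k. j \<in> J \<Longrightarrow> k \<in> J \<Longrightarrow> j \<noteq> k \<Longrightarrow> s j \<noteq> s k"
    and F_flip: "\<And>j E. j \<in> J \<Longrightarrow> (\<And>k. k \<in> J \<Longrightarrow> E k = (if k = j then - periodic_dir j 0 else periodic_dir k 0)) \<Longrightarrow>
      F E \<noteq> F (\<lambda>k. periodic_dir k 0)"
    and F_cong: "\<And>E E'. (\<And>k. k \<in> J \<Longrightarrow> E k = E' k) \<Longrightarrow> F E = F E'"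
  shows "adds_algebraic_solitons w v J s \<xi>"
  unfolding adds_algebraic_solitons_def
proof (intro conjI mkdv allI impI ballI)
  fix \<epsilon> :: real assume "\<epsilon> > 0"
  obtain \<delta> where \<delta>: "\<delta> > 0" "\<And>E E'. (\<And>j. j \<in> J \<Longrightarrow> E j \<in> circle \<and> E' j \<in> circle \<and> dist (E j) (E' j) < \<delta>)
      \<Longrightarrow> \<bar>F E - F E'\<bar> < \<epsilon>"
    by (rule unif_on_circleE[OF unif \<open>\<epsilon> > 0\<close>]) blast
  obtain R where R: "\<And>j x t. j \<in> J \<Longrightarrow> \<bar>x - s j * t\<bar> > R j \<Longrightarrow> dist (growing_dir j x t) (periodic_dir j (x - c * t)) < \<delta>"
    using approach[OF _ \<delta>(1)] by metis
  \<comment> \<open>The sum over \<open>J\<close> dominates each threshold and phase, so one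
    distance serves all lines.\<close>
  have R0: "\<bar>R j\<bar> + \<bar>\<xi> j\<bar> \<le> (\<Sum>j\<in>J. \<bar>R j\<bar> + \<bar>\<xi> j\<bar>)" if "j \<in> J" for j
    using fin that by (intro member_le_sum) auto
  show "\<exists>R. \<forall>x t. (\<forall>j\<in>J. R < infdist (x, t) (soliton_line (s j) (\<xi> j))) \<longrightarrow> \<bar>w x t - v x t\<bar> < \<epsilon>"
  proof (intro exI[of _ "\<Sum>j\<in>J. \<bar>R j\<bar> + \<bar>\<xi> j\<bar>"] allI impI)
    fix x t assume far: "\<forall>j\<in>J. (\<Sum>j\<in>J. \<bar>R j\<bar> + \<bar>\<xi> j\<bar>) < infdist (x, t) (soliton_line (s j) (\<xi> j))"
    have "dist (growing_dir j x t) (periodic_dir j (x - c * t)) < \<delta>" if "j \<in> J" for j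
    proof -
      have "\<bar>R j\<bar> + \<bar>\<xi> j\<bar> < \<bar>x - s j * t - \<xi> j\<bar>"
        using R0[OF that] far that infdist_soliton_line[of x t "s j" "\<xi> j"] by fastforce
      then show ?thesis by (intro R[OF that]) linarith
    qed
    then show "\<bar>w x t - v x t\<bar> < \<epsilon>"
      unfolding w v using \<delta>(2)[of "\<lambda>j. growing_dir j x t" "\<lambda>j. periodic_dir j (x - c * t)"] circ by auto
  qed
next
  fix j assume j: "j \<in> J"
  obtain X T :: "nat \<Rightarrow> real" and B where XT: "\<And>n. growing_dir j (X n) (T n) = - periodic_dir j 0"
      "\<And>n k. k \<in> J \<Longrightarrow> periodic_dir k (X n - c * T n) = periodic_dir k 0" "\<And>n. \<bar>X n - s j * T n\<bar> \<le> B"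
    and T: "filterlim T at_infinity sequentially"
    using flip[OF j] by blast
  define E' where "E' k = (if k = j then - periodic_dir j 0 else periodic_dir k 0)" for k
  \<comment> \<open>The gap between the flipped and the background value of F; a quantity within D /
    2 of both cannot exist.\<close>
  define D where "D = \<bar>F E' - F (\<lambda>k. periodic_dir k 0)\<bar>"
  have "F E' \<noteq> F (\<lambda>k. periodic_dir k 0)" by (rule F_flip[OF j]) (simp add: E'_def)
  then have D: "D > 0" unfolding D_def by simp
  show "\<exists>d0. \<forall>d\<ge>d0. \<not> (\<forall>\<epsilon>>0. \<forall>\<^sub>F t in at_infinity. \<forall>x. \<bar>x - s j * t - \<xi> j\<bar> \<le> d \<longrightarrow> \<bar>w x t - v x t\<bar> < \<epsilon>)"
  \<comment> \<open>With this width the strip around line j contains all the points (X n, T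
    n).\<close>
  proof (intro exI[of _ "B + \<bar>\<xi> j\<bar>"] allI impI notI)
    fix d assume d: "B + \<bar>\<xi> j\<bar> \<le> d"
    assume small: "\<forall>\<epsilon>>0. \<forall>\<^sub>F t in at_infinity. \<forall>x. \<bar>x - s j * t - \<xi> j\<bar> \<le> d \<longrightarrow> \<bar>w x t - v x t\<bar> < \<epsilon>"
    have "\<forall>\<^sub>F t in at_infinity. \<forall>x. \<bar>x - s j * t - \<xi> j\<bar> \<le> d \<longrightarrow> \<bar>w x t - v x t\<bar> < D / 2"
      by (rule small[rule_format, OF half_gt_zero[OF D]])
    from eventually_compose_filterlim[OF this T]
    have ev1: "\<forall>\<^sub>F n in sequentially. \<bar>w (X n) (T n) - v (X n) (T n)\<bar> < D / 2"
    proof eventually_elim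
      case (elim n)
      moreover have "\<bar>X n - s j * T n - \<xi> j\<bar> \<le> d" using XT(3)[of n] d by linarith
      ultimately show ?case by blast
    qed
    obtain \<delta> where \<delta>: "\<delta> > 0" "\<And>E E'. (\<And>j. j \<in> J \<Longrightarrow> E j \<in> circle \<and> E' j \<in> circle \<and> dist (E j) (E' j) < \<delta>)
        \<Longrightarrow> \<bar>F E - F E'\<bar> < D / 2"
      by (rule unif_on_circleE[OF unif half_gt_zero[OF D]]) blast
    have "\<forall>\<^sub>F n in sequentially. dist (growing_dir k (X n) (T n)) (E' k) < \<delta>" if k: "k \<in> J" for k
    proof (cases "k = j")
      case True
      then show ?thesis using XT(1) \<delta>(1) unfolding E'_def by simp
    next
      case False
      obtain R where R: "\<And>x t. \<bar>x - s k * t\<bar> > R \<Longrightarrow> dist (growing_dir k x t) (periodic_dir k (x - c * t)) < \<delta>"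
        using approach[OF k \<delta>(1)] by blast
      have sk: "\<bar>s j - s k\<bar> > 0" using speeds[OF j k] False by simp
      have "filterlim (\<lambda>n. norm (T n)) at_top sequentially"
        by (rule filterlim_at_infinity_imp_norm_at_top[OF T])
      then have "\<forall>\<^sub>F n in sequentially. (R + B) / \<bar>s j - s k\<bar> < norm (T n)"
        unfolding filterlim_at_top_dense by blast
      then show ?thesis
      proof eventually_elim
        case (elim n)
        then have "R + B < \<bar>s j - s k\<bar> * \<bar>T n\<bar>" using sk by (simp add: divide_less_eq mult.commute)
        \<comment> \<open>The offsets from two lines of different speeds differ by a multiple of the
          time. The offset from line j is bounded, so the other one grows.\<close>
        moreover have "(s j - s k) * T n = (X n - s k * T n) - (X n - s j * T n)" by (simp add: algebra_simps)
        then have "\<bar>s j - s k\<bar> * \<bar>T n\<bar> \<le> \<bar>X n - s k * T n\<bar> + \<bar>X n - s j * T n\<bar>"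
          unfolding abs_mult[symmetric] by linarith
        ultimately have "R < \<bar>X n - s k * T n\<bar>" using XT(3)[of n] by linarith
        from R[OF this] show ?case unfolding XT(2)[OF k] E'_def using False by simp
      qed
    qed
    then have "\<forall>\<^sub>F n in sequentially. \<forall>k\<in>J. dist (growing_dir k (X n) (T n)) (E' k) < \<delta>"
      using fin by (simp add: eventually_ball_finite)
    then have "\<forall>\<^sub>F n in sequentially. False" using ev1
    proof eventually_elim
      case (elim n)
      have "E' k \<in> circle" if "k \<in> J" for k
        using circ(2)[OF j, of 0] circ(2)[OF that, of 0] unfolding E'_def by (auto simp: uminus_circle)
      then have "\<bar>F (\<lambda>k. growing_dir k (X n) (T n)) - F E'\<bar> < D / 2"
        using \<delta>(2)[of "\<lambda>k. growing_dir k (X n) (T n)" E'] elim(1) circ(1) by auto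
      moreover have "F (\<lambda>k. periodic_dir k (X n - c * T n)) = F (\<lambda>k. periodic_dir k 0)"
        by (rule F_cong) (rule XT(2))
      then have "\<bar>F (\<lambda>k. growing_dir k (X n) (T n)) - F (\<lambda>k. periodic_dir k 0)\<bar> < D / 2"
        using elim(2) unfolding w v by simp
      moreover have "D \<le> \<bar>F (\<lambda>k. growing_dir k (X n) (T n)) - F E'\<bar> + \<bar>F (\<lambda>k. growing_dir k (X n) (T n)) - F (\<lambda>k. periodic_dir k 0)\<bar>"
        unfolding D_def by linarith
      ultimately show False by linarith
    qed
    then show False by simp
  qed
qed

section \<open>The periodic wave\<close>

context elliptic_modulus
begin

lemma sn_pos:
  assumes "0 < x" "x < 2 * elliptic_K \<kappa>"
  shows "jacobi_sn \<kappa> x > 0"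
proof -
  have F: "elliptic_F \<kappa> 0 < elliptic_F \<kappa> (jacobi_am \<kappa> x)"
    "elliptic_F \<kappa> (jacobi_am \<kappa> x) < elliptic_F \<kappa> pi"
    using assms elliptic_F_add_pi[of 0] by simp_all
  then have "0 < jacobi_am \<kappa> x" "jacobi_am \<kappa> x < pi"
    by (simp_all only: strict_mono_less[OF elliptic_F_strict_mono])
  then show ?thesis unfolding jacobi_sn_def by (rule sin_gt_zero)
qed

end

text \<open>The ordering u4 < u3 < u2 < u1 in terms of the eigenvalues: l1 - l2, l2 - l3 and l2 + l3
  are half of u2 - u3, u1 - u2 and u3 - u4. The sign of l3 is left open.\<close>

locale wave_parameters =
  fixes l1 l2 l3 :: real
  assumes o12: "l2 < l1" and o23: "l3 < l2" and p23: "0 < l2 + l3" and l3_nz: "l3 \<noteq> 0"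
begin

abbreviation "u1 \<equiv> l1 + l2 - l3"
abbreviation "u2 \<equiv> l1 - l2 + l3"
abbreviation "u3 \<equiv> l2 + l3 - l1"
abbreviation "u4 \<equiv> - l1 - l2 - l3"
abbreviation "\<kappa> \<equiv> wave_\<kappa> u1 u2 u3 u4"
abbreviation "\<nu> \<equiv> wave_\<nu> u1 u2 u3 u4"
abbreviation "L \<equiv> wave_period u1 u2 u3 u4"
abbreviation "u \<equiv> wave u1 u2 u3 u4"

lemma pos: "l1 > 0" "l2 > 0" "l1 + l2 > 0" "l1 + l3 > 0" "l1 - l3 > 0"
  using o12 o23 p23 by linarith+

lemma sq_less: "l2\<^sup>2 < l1\<^sup>2" "l3\<^sup>2 < l2\<^sup>2" "l3\<^sup>2 < l1\<^sup>2"
proof -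
  have "(l1 - l2) * (l1 + l2) > 0" "(l2 - l3) * (l2 + l3) > 0"
    using o12 o23 p23 pos by simp_all
  then show a: "l2\<^sup>2 < l1\<^sup>2" "l3\<^sup>2 < l2\<^sup>2"
    by (simp_all add: power2_eq_square algebra_simps)
  then show "l3\<^sup>2 < l1\<^sup>2" by linarith
qed

lemma wave_c_eq: "wave_c u1 u2 u3 u4 = 2 * (l1\<^sup>2 + l2\<^sup>2 + l3\<^sup>2)"
  unfolding wave_c_def by algebra

lemma wave_e_eq: "wave_e u1 u2 u3 u4 = - 4 * l1 * l2 * l3"
proof -
  have "u1 * u2 * u3 + u1 * u2 * u4 + u1 * u3 * u4 + u2 * u3 * u4 = - 8 * l1 * l2 * l3" by algebra
  then show ?thesis unfolding wave_e_def by simp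
qed

lemma modulus_products: "(u1 - u3) * (u2 - u4) = 4 * (l1\<^sup>2 - l3\<^sup>2)" "(u1 - u2) * (u3 - u4) = 4 * (l2\<^sup>2 - l3\<^sup>2)"
  by algebra+

lemma \<nu>_sq: "\<nu>\<^sup>2 = l1\<^sup>2 - l3\<^sup>2"
  unfolding wave_\<nu>_def modulus_products using sq_less by (simp add: power_divide)

lemma \<nu>_pos: "\<nu> > 0"
  unfolding wave_\<nu>_def modulus_products using sq_less by simp

lemma \<kappa>_eq: "\<kappa> = sqrt ((l2\<^sup>2 - l3\<^sup>2) / (l1\<^sup>2 - l3\<^sup>2))"
  unfolding wave_\<kappa>_def modulus_products by (subst mult_divide_mult_cancel_left) simp_all

lemma \<kappa>_sq: "\<kappa>\<^sup>2 = (l2\<^sup>2 - l3\<^sup>2) / (l1\<^sup>2 - l3\<^sup>2)"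
  unfolding \<kappa>_eq using sq_less by simp

sublocale elliptic_modulus \<kappa>
  by unfold_locales (use sq_less in \<open>simp_all add: \<kappa>_eq\<close>)

lemma L_pos: "L > 0"
  unfolding wave_period_def using elliptic_K_pos \<nu>_pos by simp

lemma \<nu>_shift: "\<nu> * (z + L) = \<nu> * z + 2 * elliptic_K \<kappa>"
  unfolding wave_period_def using \<nu>_pos by (simp add: field_simps)

definition "S z = jacobi_sn \<kappa> (\<nu> * z)"
definition "C z = cn (\<nu> * z)"
definition "D z = dn (\<nu> * z)"
text \<open>\<open>s1\<close> and \<open>s2\<close> are the first two derivatives of
  \<open>s\<close>. Both \<open>s2\<close> and the square of \<open>s1\<close> are polynomials in
  \<open>s\<close>, which keeps later identities polynomial.\<close>

definition "s z = (S z)\<^sup>2"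
definition "s1 z = 2 * \<nu> * S z * C z * D z"
definition "s2 z = 2 * ((l1\<^sup>2 - l3\<^sup>2) - 2 * ((l1\<^sup>2 - l3\<^sup>2) + (l2\<^sup>2 - l3\<^sup>2)) * s z + 3 * (l2\<^sup>2 - l3\<^sup>2) * (s z)\<^sup>2)"

lemma scaled_deriv:
  assumes "(f has_real_derivative d) (at (\<nu> * z))"
  shows "((\<lambda>z. f (\<nu> * z)) has_real_derivative d * \<nu>) (at z)"
proof (rule DERIV_chain2[where g = "\<lambda>z. \<nu> * z"])
  show "((\<lambda>z. \<nu> * z) has_real_derivative \<nu>) (at z)" by (auto intro!: derivative_eq_intros)
qed (rule assms)

lemma S_deriv: "(S has_real_derivative \<nu> * (C z * D z)) (at z)"
  and C_deriv: "(C has_real_derivative - \<nu> * (S z * D z)) (at z)"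
  and D_deriv: "(D has_real_derivative - \<nu> * (\<kappa>\<^sup>2 * S z * C z)) (at z)"
  unfolding S_def[abs_def] C_def[abs_def] D_def[abs_def]
  using scaled_deriv[OF sn_deriv, of z] scaled_deriv[OF cn_deriv, of z] scaled_deriv[OF dn_deriv, of z]
  by (simp_all add: mult_ac)

lemma C_sq: "(C z)\<^sup>2 = 1 - s z" and D_sq: "(D z)\<^sup>2 = 1 - \<kappa>\<^sup>2 * s z" and D_pos: "D z > 0"
  unfolding C_def D_def s_def S_def by (rule cn_sq dn_sq dn_pos)+

lemma \<nu>_\<kappa>_sq: "\<nu>\<^sup>2 * \<kappa>\<^sup>2 = l2\<^sup>2 - l3\<^sup>2"
  unfolding \<nu>_sq \<kappa>_sq using sq_less by simp

lemma \<nu>D_sq: "\<nu>\<^sup>2 * (D z)\<^sup>2 = (l1\<^sup>2 - l3\<^sup>2) - (l2\<^sup>2 - l3\<^sup>2) * s z"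
  unfolding D_sq \<nu>_\<kappa>_sq[symmetric] \<nu>_sq[symmetric] by (simp add: algebra_simps)

lemma s_range: "0 \<le> s z" "s z \<le> 1"
  unfolding s_def S_def using sn_sq_le_1 by auto

lemma s_deriv: "(s has_real_derivative s1 z) (at z)"
  unfolding s_def[abs_def] s1_def
  by (rule derivative_eq_intros S_deriv refl)+ (simp add: algebra_simps)

lemma s1_deriv: "(s1 has_real_derivative s2 z) (at z)"
proof -
  have "(s1 has_real_derivative 2 * \<nu>\<^sup>2 * ((C z)\<^sup>2 * (D z)\<^sup>2 - (S z)\<^sup>2 * (D z)\<^sup>2 - \<kappa>\<^sup>2 * (S z)\<^sup>2 * (C z)\<^sup>2)) (at z)"
    unfolding s1_def[abs_def]
    by (rule derivative_eq_intros S_deriv C_deriv D_deriv refl)+ (simp add: algebra_simps power2_eq_square)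
  also have "2 * \<nu>\<^sup>2 * ((C z)\<^sup>2 * (D z)\<^sup>2 - (S z)\<^sup>2 * (D z)\<^sup>2 - \<kappa>\<^sup>2 * (S z)\<^sup>2 * (C z)\<^sup>2)
      = 2 * ((1 - 2 * s z) * (\<nu>\<^sup>2 * (D z)\<^sup>2) - (\<nu>\<^sup>2 * \<kappa>\<^sup>2) * s z * (1 - s z))"
    unfolding s_def[symmetric] C_sq by (simp add: algebra_simps)
  also have "\<dots> = s2 z" unfolding \<nu>D_sq \<nu>_\<kappa>_sq s2_def by algebra
  finally show ?thesis .
qed

lemma s1_sq: "(s1 z)\<^sup>2 = 4 * s z * (1 - s z) * ((l1\<^sup>2 - l3\<^sup>2) - (l2\<^sup>2 - l3\<^sup>2) * s z)"
proof -
  have "(s1 z)\<^sup>2 = 4 * (S z)\<^sup>2 * (C z)\<^sup>2 * (\<nu>\<^sup>2 * (D z)\<^sup>2)"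
    unfolding s1_def by (simp add: power_mult_distrib mult_ac)
  then show ?thesis unfolding C_sq \<nu>D_sq s_def[symmetric] .
qed

lemma s_periodic: "s (z + L) = s z" "s1 (z + L) = s1 z"
  unfolding s_def s1_def S_def C_def D_def \<nu>_shift sn_add_2K cn_add_2K dn_add_2K by simp_all

lemma s_0: "s 0 = 0" "s1 0 = 0"
  unfolding s_def s1_def S_def by simp_all

lemma s_cont: "isCont s z" "isCont s1 z"
  using s_deriv s1_deriv DERIV_isCont by blast+

section \<open>The period mean behind the speeds\<close>

text \<open>By \<open>\<nu>D_sq\<close>, l1^2 minus this profile is \<nu>^2 dn^2. Its mean
  \<open>\<mu>\<close> is the only transcendental quantity in the speeds.\<close>

definition "sq_profile z = l3\<^sup>2 + (l2\<^sup>2 - l3\<^sup>2) * s z"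
definition X :: "real \<Rightarrow> real" where "X z = (LBINT y=0..z. sq_profile y)"
definition "\<mu> = X L / L"

lemma X_deriv: "(X has_real_derivative sq_profile z) (at z)"
  unfolding X_def[abs_def] by (rule DERIV_LBINT) (simp add: sq_profile_def s_cont)

lemma X_0: "X 0 = 0"
  unfolding X_def by simp

lemma X_periodic: "X (z + L) - \<mu> * (z + L) = X z - \<mu> * z"
proof -
  have "((\<lambda>z. X (z + L)) has_real_derivative sq_profile z) (at z)" for z
    using DERIV_shift[of X "sq_profile z" z L] X_deriv[of "z + L"] unfolding sq_profile_def s_periodic by simp
  from deriv_eq_imp_const_diff[OF this X_deriv, of z 0]
  show ?thesis unfolding X_0 \<mu>_def using L_pos by (simp add: field_simps)
qed

lemma X_bounded: obtains B where "\<And>z. \<bar>X z - \<mu> * z\<bar> \<le> B"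
proof (rule periodic_continuous_bounded[of "\<lambda>z. X z - \<mu> * z" L])
  show "isCont (\<lambda>z. X z - \<mu> * z) z" for z
    by (intro continuous_intros DERIV_isCont[OF X_deriv])
qed (use X_periodic L_pos in auto)

lemma \<mu>_gt: "l3\<^sup>2 < \<mu>"
proof -
  \<comment> \<open>The mean is attained inside the period, where sn is positive; this makes the
    inequality strict.\<close>
  obtain z where z: "0 < z" "z < L" "X L - X 0 = (L - 0) * sq_profile z"
    using MVT2[OF L_pos, of X sq_profile] X_deriv by blast
  then have "\<mu> = sq_profile z" unfolding \<mu>_def X_0 using L_pos by simp
  moreover have "S z > 0" unfolding S_def
  proof (rule sn_pos)
    show "0 < \<nu> * z" using \<nu>_pos z by simp
    have "\<nu> * z < \<nu> * L" using \<nu>_pos z by simp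
    then show "\<nu> * z < 2 * elliptic_K \<kappa>" using \<nu>_shift[of 0] by simp
  qed
  ultimately show ?thesis unfolding sq_profile_def s_def using sq_less by simp
qed

text \<open>The primitive \<open>\<nu> \<kappa>\<^sup>2 sn cn / dn\<close> of \<open>\<nu>\<^sup>2 (dn\<^sup>2 - (1 - \<kappa>\<^sup>2) / dn\<^sup>2)\<close> is periodic, so the mean
  of \<open>dn\<^sup>2\<close> is that of \<open>(dn\<^sup>2 + (1 - \<kappa>\<^sup>2) / dn\<^sup>2) / 2\<close>, which the AM-GM inequality bounds from below.\<close>

lemma \<mu>_le: "sqrt ((l1\<^sup>2 - l2\<^sup>2) * (l1\<^sup>2 - l3\<^sup>2)) \<le> l1\<^sup>2 - \<mu>"
proof -
  define d where "d z = l1\<^sup>2 - sq_profile z" for z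
  define d2 d3 where "d2 = l1\<^sup>2 - l2\<^sup>2" and "d3 = l1\<^sup>2 - l3\<^sup>2"
  define h where "h z = \<nu> * \<kappa>\<^sup>2 * (S z * C z / D z)" for z
  have d: "d z = \<nu>\<^sup>2 * (D z)\<^sup>2" for z unfolding d_def sq_profile_def \<nu>D_sq by simp
  have d_pos: "d z > 0" for z unfolding d using \<nu>_pos D_pos[of z] by (intro mult_pos_pos zero_less_power)
  have h_deriv: "(h has_real_derivative d z - d2 * d3 / d z) (at z)" for z
  proof -
    have D: "D z \<noteq> 0" using D_pos[of z] by simp
    have "(h has_real_derivative \<nu> * \<kappa>\<^sup>2 * (((\<nu> * (C z * D z) * C z + (- \<nu> * (S z * D z)) * S z) * D z
        - (S z * C z) * (- \<nu> * (\<kappa>\<^sup>2 * S z * C z))) / (D z * D z))) (at z)"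
      unfolding h_def[abs_def]
      by (rule DERIV_cmult[OF DERIV_divide[OF DERIV_mult[OF S_deriv C_deriv] D_deriv D]])
    also have "\<nu> * \<kappa>\<^sup>2 * (((\<nu> * (C z * D z) * C z + (- \<nu> * (S z * D z)) * S z) * D z
        - (S z * C z) * (- \<nu> * (\<kappa>\<^sup>2 * S z * C z))) / (D z * D z))
      = \<nu>\<^sup>2 * \<kappa>\<^sup>2 * (((C z)\<^sup>2 - (S z)\<^sup>2) * (D z)\<^sup>2 + \<kappa>\<^sup>2 * (S z)\<^sup>2 * (C z)\<^sup>2) / (D z)\<^sup>2"
      by (simp add: power2_eq_square algebra_simps)
    also have "\<dots> = (\<nu>\<^sup>2 * \<kappa>\<^sup>2) * ((1 - 2 * s z) * (\<nu>\<^sup>2 * (D z)\<^sup>2) + (\<nu>\<^sup>2 * \<kappa>\<^sup>2) * s z * (1 - s z)) / (\<nu>\<^sup>2 * (D z)\<^sup>2)"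
      unfolding s_def[symmetric] C_sq using \<nu>_pos D by (simp add: field_simps)
    also have "\<dots> = ((d z)\<^sup>2 - d2 * d3) / d z"
    proof -
      have "(l2\<^sup>2 - l3\<^sup>2) * ((1 - 2 * s z) * (d3 - (l2\<^sup>2 - l3\<^sup>2) * s z) + (l2\<^sup>2 - l3\<^sup>2) * s z * (1 - s z))
          = (d3 - (l2\<^sup>2 - l3\<^sup>2) * s z)\<^sup>2 - d2 * d3"
        unfolding d2_def d3_def by algebra
      then show ?thesis unfolding d \<nu>D_sq \<nu>_\<kappa>_sq d3_def by simp
    qed
    also have "\<dots> = d z - d2 * d3 / d z"
      using d_pos[of z] by (simp add: field_simps power2_eq_square)
    finally show ?thesis .
  qed
  define Y where "Y z = 2 * (l1\<^sup>2 * z - X z) - h z" for z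
  have Y: "(Y has_real_derivative d z + d2 * d3 / d z) (at z)" for z
  proof -
    have "(Y has_real_derivative 2 * (l1\<^sup>2 - sq_profile z) - (d z - d2 * d3 / d z)) (at z)"
      unfolding Y_def[abs_def] by (rule derivative_eq_intros X_deriv h_deriv refl)+ simp
    then show ?thesis unfolding d_def by (simp add: algebra_simps)
  qed
  \<comment> \<open>The mean value theorem evaluates the average at one point, so a pointwise
    estimate suffices.\<close>
  obtain z where z: "Y L - Y 0 = (L - 0) * (d z + d2 * d3 / d z)"
    using MVT2[OF L_pos, of Y "\<lambda>z. d z + d2 * d3 / d z"] Y by blast
  have "h L = h 0"
    using \<nu>_shift[of 0] unfolding h_def S_def C_def D_def
    using sn_add_2K[of 0] cn_add_2K[of 0] dn_add_2K[of 0] by simp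
  then have "Y L - Y 0 = 2 * L * (l1\<^sup>2 - \<mu>)"
    unfolding Y_def X_0 \<mu>_def using L_pos by (simp add: field_simps)
  then have m: "2 * (l1\<^sup>2 - \<mu>) = d z + d2 * d3 / d z" using z L_pos by simp
  have dd: "d2 * d3 \<ge> 0" unfolding d2_def d3_def using sq_less by simp
  have "0 \<le> (sqrt (d z) - sqrt (d2 * d3 / d z))\<^sup>2" by simp
  also have "\<dots> = d z + d2 * d3 / d z - 2 * (sqrt (d z) * sqrt (d2 * d3 / d z))"
    using d_pos[of z] dd by (simp add: power2_diff)
  also have "sqrt (d z) * sqrt (d2 * d3 / d z) = sqrt (d2 * d3)"
    unfolding real_sqrt_mult[symmetric] using d_pos[of z] by simp
  finally have "sqrt (d2 * d3) \<le> l1\<^sup>2 - \<mu>" unfolding m[symmetric] by simp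
  then show ?thesis unfolding d2_def d3_def .
qed

end

section \<open>Special values and backgrounds of the two- and three-fold formulas\<close>

text \<open>With vanishing cosines all vectors are multiples of (1, 1) or (1, -1). These are
  eigenvectors of every Darboux matrix involved, so no step alters another direction and the
  contributions add.\<close>

lemma darboux2_shift_axis:
  assumes "s1\<^sup>2 = 1" "s2\<^sup>2 = 1" and ne: "l1\<^sup>2 \<noteq> l2\<^sup>2"
  shows "darboux2_shift l1 l2 0 s1 0 s2 = 2 * l1 * s1 + 2 * l2 * s2"
proof -
  have d: "den2 l1 l2 0 s1 0 s2 \<noteq> 0" using den2_pos[of 0 s1 0 s2 l1 l2] assms by simp
  have "2 * (l1\<^sup>2 - l2\<^sup>2) * (l1 * s1 - l2 * s2) = (2 * l1 * s1 + 2 * l2 * s2) * den2 l1 l2 0 s1 0 s2"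
    unfolding den2_def using assms(1,2) by algebra
  then show ?thesis unfolding darboux2_shift_def using d by simp
qed

lemma darboux3_shift_axis:
  assumes s: "s1\<^sup>2 = 1" "s2\<^sup>2 = 1" "s3\<^sup>2 = 1" and ne: "l1\<^sup>2 \<noteq> l2\<^sup>2" "l1\<^sup>2 \<noteq> l3\<^sup>2" "l2\<^sup>2 \<noteq> l3\<^sup>2"
  shows "darboux3_shift l1 l2 l3 0 s1 0 s2 0 s3 = 2 * l1 * s1 + 2 * l2 * s2 + 2 * l3 * s3"
proof -
  have T: "Tsig l k 0 s 0 s' = s'" "Tgam l k 0 s 0 s' = 0"
    if "s\<^sup>2 = 1" "s'\<^sup>2 = 1" "l\<^sup>2 \<noteq> k\<^sup>2" for l k s s' :: real
  proof -
    have d: "den2 l k 0 s 0 s' \<noteq> 0" using den2_pos[of 0 s 0 s' l k] that by simp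
    have "- 2 * l * k * s + 2 * l\<^sup>2 * s * 0 * 0 + (k\<^sup>2 - l\<^sup>2 * 0\<^sup>2 + l\<^sup>2 * s\<^sup>2) * s'
        = s' * den2 l k 0 s 0 s' + l\<^sup>2 * s' * (s\<^sup>2 - 1) + 2 * l * k * s * (s'\<^sup>2 - 1)"
      unfolding den2_def by (simp add: algebra_simps power2_eq_square)
    then show "Tsig l k 0 s 0 s' = s'" unfolding Tsig_def using d that by simp
    show "Tgam l k 0 s 0 s' = 0" unfolding Tgam_def by simp
  qed
  show ?thesis
    by (subst darboux3_shift_iterate) (use s ne in \<open>simp_all add: T\<close>)
qed

text \<open>The background waves, written through \<open>v = u(z)\<close> and \<open>y = u'(z)\<close>: for the eigenvalue \<open>a\<close>
  one has \<open>e + 4 a\<^sup>2 v = 4 a (a v - b c)\<close> and \<open>c - 4 a\<^sup>2 - 2 v\<^sup>2 = 2 (b\<^sup>2 + c\<^sup>2 - a\<^sup>2 - v\<^sup>2)\<close>,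
  where \<open>b\<close>, \<open>c\<close> are the other two eigenvalues.\<close>

definition wave_quartic :: "real \<Rightarrow> real \<Rightarrow> real \<Rightarrow> real \<Rightarrow> real" where
  "wave_quartic a b c v = 4 * (a * v - b * c)\<^sup>2 - (b\<^sup>2 + c\<^sup>2 - a\<^sup>2 - v\<^sup>2)\<^sup>2"

text \<open>The cosines enter only through their product, so y occurs only squared and is replaced
  by the quartic; clearing denominators leaves a polynomial identity in a, b, c and v.\<close>

lemma darboux2_shift_background:
  fixes a b c v y :: real
  defines "ka \<equiv> a * v - b * c" and "kb \<equiv> b * v - a * c" and "kc \<equiv> c * v - a * b"
    and "Aa \<equiv> b\<^sup>2 + c\<^sup>2 - a\<^sup>2 - v\<^sup>2" and "Ab \<equiv> a\<^sup>2 + c\<^sup>2 - b\<^sup>2 - v\<^sup>2"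
  assumes nz: "ka \<noteq> 0" "kb \<noteq> 0" "kc \<noteq> 0" and y: "y\<^sup>2 = wave_quartic a b c v" and ne: "a\<^sup>2 \<noteq> b\<^sup>2"
  shows "v + darboux2_shift a b (y / (2 * ka)) (Aa / (2 * ka)) (y / (2 * kb)) (Ab / (2 * kb))
    = (a * b * v - c * (a\<^sup>2 + b\<^sup>2 - c\<^sup>2)) / kc"
proof -
  define W where "W = wave_quartic a b c v"
  define \<Delta> where "\<Delta> = 2 * (a\<^sup>2 + b\<^sup>2) * ka * kb - a * b * (W + Aa * Ab)"
  have circ: "(y / (2 * ka))\<^sup>2 + (Aa / (2 * ka))\<^sup>2 = 1" "(y / (2 * kb))\<^sup>2 + (Ab / (2 * kb))\<^sup>2 = 1"
  proof -
    have "y\<^sup>2 + Aa\<^sup>2 = (2 * ka)\<^sup>2" "y\<^sup>2 + Ab\<^sup>2 = (2 * kb)\<^sup>2"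
      unfolding y wave_quartic_def Aa_def Ab_def ka_def kb_def by algebra+
    then show "(y / (2 * ka))\<^sup>2 + (Aa / (2 * ka))\<^sup>2 = 1" "(y / (2 * kb))\<^sup>2 + (Ab / (2 * kb))\<^sup>2 = 1"
      unfolding power_divide add_divide_distrib[symmetric] using nz by simp_all
  qed
  have den: "den2 a b (y / (2 * ka)) (Aa / (2 * ka)) (y / (2 * kb)) (Ab / (2 * kb)) = \<Delta> / (2 * ka * kb)"
  proof -
    have "y / (2 * ka) * (y / (2 * kb)) + Aa / (2 * ka) * (Ab / (2 * kb)) = (W + Aa * Ab) / (4 * ka * kb)"
      unfolding W_def y[symmetric] by (simp add: add_divide_distrib power2_eq_square)
    then show ?thesis unfolding den2_def \<Delta>_def using nz by (simp add: field_simps)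
  qed
  have "\<Delta> \<noteq> 0" using den2_pos[OF circ ne] unfolding den by auto
  have "(2 * a * b * v - c * (a\<^sup>2 + b\<^sup>2 - c\<^sup>2 + v\<^sup>2)) * \<Delta> = 2 * (a\<^sup>2 - b\<^sup>2) * (a * Aa * kb - b * Ab * ka) * kc"
    unfolding \<Delta>_def W_def wave_quartic_def ka_def kb_def kc_def Aa_def Ab_def by algebra
  then have "2 * (a\<^sup>2 - b\<^sup>2) * (a * Aa * kb - b * Ab * ka) / \<Delta> = (2 * a * b * v - c * (a\<^sup>2 + b\<^sup>2 - c\<^sup>2 + v\<^sup>2)) / kc"
    using \<open>\<Delta> \<noteq> 0\<close> nz(3) by (simp add: frac_eq_eq)
  moreover have "darboux2_shift a b (y / (2 * ka)) (Aa / (2 * ka)) (y / (2 * kb)) (Ab / (2 * kb))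
      = 2 * (a\<^sup>2 - b\<^sup>2) * (a * Aa * kb - b * Ab * ka) / \<Delta>"
  proof -
    have "a * (Aa / (2 * ka)) - b * (Ab / (2 * kb)) = (a * Aa * kb - b * Ab * ka) / (2 * ka * kb)"
      using nz by (simp add: field_simps)
    then show ?thesis unfolding darboux2_shift_def den using nz by simp
  qed
  moreover have "(2 * a * b * v - c * (a\<^sup>2 + b\<^sup>2 - c\<^sup>2 + v\<^sup>2)) / kc
      = (a * b * v - c * (a\<^sup>2 + b\<^sup>2 - c\<^sup>2)) / kc - v"
  proof -
    have "2 * a * b * v - c * (a\<^sup>2 + b\<^sup>2 - c\<^sup>2 + v\<^sup>2) = (a * b * v - c * (a\<^sup>2 + b\<^sup>2 - c\<^sup>2)) - v * kc"
      unfolding kc_def by algebra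
    then show ?thesis using nz(3) by (simp only: diff_divide_distrib) simp
  qed
  ultimately show ?thesis by simp
qed

text \<open>As for two eigenvalues, cosines occur only in pairs. With the denominators cleared by
  \<open>K\<close> the claim becomes \<open>Nn = - 2 * v * Dn\<close>.\<close>

lemma darboux3_shift_background:
  fixes a b c v y :: real
  defines "ka \<equiv> a * v - b * c" and "kb \<equiv> b * v - a * c" and "kc \<equiv> c * v - a * b"
    and "Aa \<equiv> b\<^sup>2 + c\<^sup>2 - a\<^sup>2 - v\<^sup>2" and "Ab \<equiv> a\<^sup>2 + c\<^sup>2 - b\<^sup>2 - v\<^sup>2" and "Ac \<equiv> a\<^sup>2 + b\<^sup>2 - c\<^sup>2 - v\<^sup>2"
  assumes nz: "ka \<noteq> 0" "kb \<noteq> 0" "kc \<noteq> 0" and y: "y\<^sup>2 = wave_quartic a b c v"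
    and ne: "a\<^sup>2 \<noteq> b\<^sup>2" "a\<^sup>2 \<noteq> c\<^sup>2" "b\<^sup>2 \<noteq> c\<^sup>2"
  shows "v + darboux3_shift a b c (y / (2 * ka)) (Aa / (2 * ka)) (y / (2 * kb)) (Ab / (2 * kb))
      (y / (2 * kc)) (Ac / (2 * kc)) = - v"
proof -
  define W where "W = wave_quartic a b c v"
  have circ: "(y / (2 * ka))\<^sup>2 + (Aa / (2 * ka))\<^sup>2 = 1" "(y / (2 * kb))\<^sup>2 + (Ab / (2 * kb))\<^sup>2 = 1"
    "(y / (2 * kc))\<^sup>2 + (Ac / (2 * kc))\<^sup>2 = 1"
  proof -
    have "y\<^sup>2 + Aa\<^sup>2 = (2 * ka)\<^sup>2" "y\<^sup>2 + Ab\<^sup>2 = (2 * kb)\<^sup>2" "y\<^sup>2 + Ac\<^sup>2 = (2 * kc)\<^sup>2"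
      unfolding y wave_quartic_def Aa_def Ab_def Ac_def ka_def kb_def kc_def by algebra+
    then show "(y / (2 * ka))\<^sup>2 + (Aa / (2 * ka))\<^sup>2 = 1" "(y / (2 * kb))\<^sup>2 + (Ab / (2 * kb))\<^sup>2 = 1"
      "(y / (2 * kc))\<^sup>2 + (Ac / (2 * kc))\<^sup>2 = 1"
      unfolding power_divide add_divide_distrib[symmetric] using nz by simp_all
  qed
  define K where "K = 4 * ka * kb * kc"
  have K: "K \<noteq> 0" unfolding K_def using nz by simp
  have yy: "y / (2 * ka) * (y / (2 * kb)) = W * kc / K" "y / (2 * ka) * (y / (2 * kc)) = W * kb / K"
    "y / (2 * kb) * (y / (2 * kc)) = W * ka / K"
    unfolding W_def y[symmetric] K_def using nz by (simp_all add: power2_eq_square)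
  have numer: "Aa / (2 * ka) * (Ab / (2 * kb)) = Aa * Ab * kc / K" "Aa / (2 * ka) * (Ac / (2 * kc)) = Aa * Ac * kb / K"
    "Ab / (2 * kb) * (Ac / (2 * kc)) = Ab * Ac * ka / K"
    unfolding K_def using nz by simp_all
  define Dn where "Dn = ((a\<^sup>2 + b\<^sup>2) * (a\<^sup>2 + c\<^sup>2) * (b\<^sup>2 + c\<^sup>2) - 8 * a\<^sup>2 * b\<^sup>2 * c\<^sup>2) * K
     - 2 * (c\<^sup>2 - a\<^sup>2) * (c\<^sup>2 - b\<^sup>2) * a * b * (W * kc + Aa * Ab * kc)
     - 2 * (b\<^sup>2 - a\<^sup>2) * (b\<^sup>2 - c\<^sup>2) * a * c * (W * kb + Aa * Ac * kb)
     - 2 * (a\<^sup>2 - b\<^sup>2) * (a\<^sup>2 - c\<^sup>2) * b * c * (W * ka + Ab * Ac * ka)"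
  have den: "den3 a b c (y / (2 * ka)) (Aa / (2 * ka)) (y / (2 * kb)) (Ab / (2 * kb))
      (y / (2 * kc)) (Ac / (2 * kc)) = Dn / K"
  proof -
    have "X - p * (A / K) - q * (B / K) - r * (C / K) = (X * K - p * A - q * B - r * C) / K" for X p q r A B C
      using K by (simp add: field_simps)
    then show ?thesis unfolding den3_def yy numer add_divide_distrib[symmetric] Dn_def .
  qed
  have D: "Dn \<noteq> 0" using den3_pos[OF circ ne] unfolding den by auto
  define Nn where "Nn = (c\<^sup>2 - a\<^sup>2) * (c\<^sup>2 - b\<^sup>2) * c * Ac * ((a\<^sup>2 + b\<^sup>2) * 4 * ka * kb - 2 * a * b * W)
     + (b\<^sup>2 - a\<^sup>2) * (b\<^sup>2 - c\<^sup>2) * b * Ab * ((a\<^sup>2 + c\<^sup>2) * 4 * ka * kc - 2 * a * c * W)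
     + (a\<^sup>2 - b\<^sup>2) * (a\<^sup>2 - c\<^sup>2) * a * Aa * ((b\<^sup>2 + c\<^sup>2) * 4 * kb * kc - 2 * b * c * W)
     - 2 * (a^4 + b^4 + c^4 - a\<^sup>2 * b\<^sup>2 - a\<^sup>2 * c\<^sup>2 - b\<^sup>2 * c\<^sup>2) * a * b * c * Aa * Ab * Ac"
  have num: "num3 a b c (y / (2 * ka)) (Aa / (2 * ka)) (y / (2 * kb)) (Ab / (2 * kb))
      (y / (2 * kc)) (Ac / (2 * kc)) = Nn / (2 * K)"
  proof -
    have t: "d * (A / (2 * k)) * (e - f * (y / (2 * k')) * (y / (2 * k''))) = d * A * (e * 4 * k' * k'' - f * W) / (8 * k * k' * k'')"
      if "k \<noteq> 0" "k' \<noteq> 0" "k'' \<noteq> 0" for d A k e f k' k''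
      unfolding W_def y[symmetric] using that by (simp add: field_simps power2_eq_square)
    have 1: "8 * kc * ka * kb = 2 * K" "8 * kb * ka * kc = 2 * K" "8 * ka * kb * kc = 2 * K"
      unfolding K_def by simp_all
    have 2: "d * (Aa / (2 * ka)) * (Ab / (2 * kb)) * (Ac / (2 * kc)) = d * Aa * Ab * Ac / (2 * K)" for d
      unfolding K_def by simp
    show ?thesis
      unfolding num3_def t[OF nz(3,1,2)] t[OF nz(2,1,3)] t[OF nz(1,2,3)] 1 2
        add_divide_distrib[symmetric] diff_divide_distrib[symmetric] Nn_def ..
  qed
  have "Nn = - 2 * v * Dn"
    unfolding Nn_def Dn_def K_def W_def wave_quartic_def ka_def kb_def kc_def Aa_def Ab_def Ac_def by algebra
  then show ?thesis unfolding darboux3_shift_def num den using D K by simp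
qed

section \<open>The phase integrals and their mean slopes\<close>

context wave_parameters
begin

text \<open>The eigenvalues are indexed by 1, 2 and 3; every other index is treated as 3. In terms of
  \<open>sn\<^sup>2\<close> one has \<open>denom j (u z) = denom_scale j * (\<alpha> j + \<beta> j * s z) / w z\<close>.\<close>

definition "eigenval (j::nat) = (if j = 1 then l1 else if j = 2 then l2 else l3)"
definition "denom (j::nat) v = (if j = 1 then l1 * v - l2 * l3 else if j = 2 then l2 * v - l1 * l3 else l3 * v - l1 * l2)"
definition "numer (j::nat) v = (if j = 1 then l2\<^sup>2 + l3\<^sup>2 - l1\<^sup>2 - v\<^sup>2 else if j = 2 then l1\<^sup>2 + l3\<^sup>2 - l2\<^sup>2 - v\<^sup>2
   else l1\<^sup>2 + l2\<^sup>2 - l3\<^sup>2 - v\<^sup>2)"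
definition "gap_product (j::nat) = (if j = 1 then (l1\<^sup>2 - l2\<^sup>2) * (l1\<^sup>2 - l3\<^sup>2) else if j = 2 then (l2\<^sup>2 - l1\<^sup>2) * (l2\<^sup>2 - l3\<^sup>2)
   else (l3\<^sup>2 - l1\<^sup>2) * (l3\<^sup>2 - l2\<^sup>2))"
definition "denom_scale (j::nat) = (if j = 1 then (l1 + l2) * (l1 + l3) else if j = 2 then (l1 + l2) * (l2 - l3)
   else - ((l1 + l3) * (l2 - l3)))"
definition "\<alpha> (j::nat) = (if j = 2 then l1 + l3 else l1 - l3)"
definition "\<beta> (j::nat) = (if j = 1 then l3 - l2 else if j = 2 then - (l2 + l3) else l2 + l3)"
definition "w z = (l1 + l3) + (l2 - l3) * s z"

lemmas index_defs = eigenval_def denom_def numer_def gap_product_def denom_scale_def \<alpha>_def \<beta>_def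

lemma eigenval_nz: "eigenval j \<noteq> 0"
  unfolding eigenval_def using pos l3_nz by simp

lemma eigenval_sq_ne: "(eigenval 1)\<^sup>2 \<noteq> (eigenval 2)\<^sup>2" "(eigenval 1)\<^sup>2 \<noteq> (eigenval 3)\<^sup>2" "(eigenval 2)\<^sup>2 \<noteq> (eigenval 3)\<^sup>2"
  unfolding eigenval_def using sq_less by auto

lemma n_eq: "wave_e u1 u2 u3 u4 + 4 * (eigenval j)\<^sup>2 * v = 4 * eigenval j * denom j v"
  unfolding wave_e_eq eigenval_def denom_def by (simp add: power2_eq_square algebra_simps)

lemma G_eq: "wave_c u1 u2 u3 u4 - 4 * (eigenval j)\<^sup>2 - 2 * v\<^sup>2 = 2 * numer j v"
  unfolding wave_c_eq eigenval_def numer_def by simp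

lemma w_pos: "w z > 0"
  unfolding w_def using pos(4) s_range(1)[of z] o23 by (simp add: add_pos_nonneg)

lemma denom_scale_nz: "denom_scale j \<noteq> 0"
  unfolding denom_scale_def using pos o23 by simp

lemma gap_product_nz: "gap_product j \<noteq> 0"
  unfolding gap_product_def using sq_less by simp

text \<open>Affine in \<open>s\<close>, which lies in [0, 1]; the value at 0 is l1 - l3 or l1 + l3
  and the value at 1 is l1 - l2 or l1 + l2, all positive.\<close>

lemma \<alpha>\<beta>_pos: "\<alpha> j + \<beta> j * s z > 0"
proof -
  define r r' where "r = (l2 - l3) * s z" and "r' = (l2 + l3) * s z"
  have "r \<le> l2 - l3" "r' \<le> l2 + l3" "0 \<le> r'"
    unfolding r_def r'_def using s_range[of z] o23 p23 by (simp_all add: mult_left_le)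
  then have "0 < l1 - l3 - r" "0 < l1 + l3 - r'" "0 < l1 - l3 + r'"
    using pos o12 by linarith+
  then show ?thesis unfolding r_def r'_def \<alpha>_def \<beta>_def by (auto simp: algebra_simps)
qed

lemma u_eq: "u z = (2 * (l1 + l2) * (l1 + l3) - (l1 + l2 + l3) * w z) / w z"
proof -
  have "u2 - u4 + (u1 - u2) * s z = 2 * w z" "(u1 - u4) * (u2 - u4) = 4 * (l1 + l2) * (l1 + l3)"
    unfolding w_def by algebra+
  then have "u z = u4 + 4 * (l1 + l2) * (l1 + l3) / (2 * w z)"
    unfolding wave_def S_def[symmetric] s_def[symmetric] by (simp only:)
  then show ?thesis using w_pos[of z] by (simp add: field_simps)
qed

lemma denom_eq: "denom j (u z) = denom_scale j * (\<alpha> j + \<beta> j * s z) / w z"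
proof -
  define U where "U = 2 * (l1 + l2) * (l1 + l3) - (l1 + l2 + l3) * w z"
  have "a * (U / w z) - b = (a * U - b * w z) / w z" for a b
    using w_pos[of z] by (simp add: field_simps)
  then have "denom j (u z) = (if j = 1 then l1 * U - l2 * l3 * w z else if j = 2 then l2 * U - l1 * l3 * w z
      else l3 * U - l1 * l2 * w z) / w z"
    unfolding denom_def u_eq U_def[symmetric] by simp
  moreover have "l1 * U - l2 * l3 * w z = (l1 + l2) * (l1 + l3) * (l1 - l3 + (l3 - l2) * s z)"
    "l2 * U - l1 * l3 * w z = (l1 + l2) * (l2 - l3) * (l1 + l3 + - (l2 + l3) * s z)"
    "l3 * U - l1 * l2 * w z = - ((l1 + l3) * (l2 - l3)) * (l1 - l3 + (l2 + l3) * s z)"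
    unfolding U_def w_def by algebra+
  ultimately show ?thesis unfolding denom_scale_def \<alpha>_def \<beta>_def by simp
qed

lemma denom_nz: "denom j (u z) \<noteq> 0"
  unfolding denom_eq using denom_scale_nz[of j] \<alpha>\<beta>_pos[of j z] w_pos[of z] by simp

lemma n_nz: "wave_e u1 u2 u3 u4 + 4 * (eigenval j)\<^sup>2 * u z \<noteq> 0"
  unfolding n_eq using denom_nz eigenval_nz by simp

text \<open>Up to the derivative of a periodic function, the integrand of \<open>\<Phi>\<close> is affine in \<open>sn\<^sup>2\<close>.\<close>

lemma integrand_eq:
  "(eigenval j)\<^sup>2 * ((wave_c u1 u2 u3 u4 - 4 * (eigenval j)\<^sup>2 - 2 * (u z)\<^sup>2) / (wave_e u1 u2 u3 u4 + 4 * (eigenval j)\<^sup>2 * u z)\<^sup>2)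
   = (sq_profile z - (eigenval j)\<^sup>2) / (4 * gap_product j)
     - \<beta> j / (8 * gap_product j) * ((s2 z * (\<alpha> j + \<beta> j * s z) - \<beta> j * (s1 z)\<^sup>2) / (\<alpha> j + \<beta> j * s z)\<^sup>2)"
proof -
  define U where "U = 2 * (l1 + l2) * (l1 + l3) - (l1 + l2 + l3) * w z"
  define V where "V = \<alpha> j + \<beta> j * s z"
  \<comment> \<open>\<open>q / V^2\<close> is the derivative of the periodic function
    \<open>s1 / V\<close>.\<close>
  define q where "q = s2 z * V - \<beta> j * (s1 z)\<^sup>2"
  have nz: "V \<noteq> 0" "w z \<noteq> 0" "denom_scale j \<noteq> 0" "gap_product j \<noteq> 0" "eigenval j \<noteq> 0"
    using \<alpha>\<beta>_pos[of j z] w_pos[of z] denom_scale_nz gap_product_nz eigenval_nz unfolding V_def by auto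
  have N: "numer j (u z) = (numer j 0 * (w z)\<^sup>2 - U\<^sup>2) / (w z)\<^sup>2"
    unfolding u_eq U_def[symmetric] numer_def using nz(2) by (simp add: power_divide diff_divide_distrib)
  \<comment> \<open>Denominators are cleared and \<open>s1_sq\<close> removes the derivative, so
    each index gives a polynomial identity in \<open>s z\<close>.\<close>
  have key: "(numer j 0 * (w z)\<^sup>2 - U\<^sup>2) * gap_product j = (denom_scale j)\<^sup>2 * (2 * (sq_profile z - (eigenval j)\<^sup>2) * V\<^sup>2 - \<beta> j * q)"
  proof -
    consider "j = 1" | "j = 2" | "j \<noteq> 1" "j \<noteq> 2" by blast
    then show ?thesis
    proof cases
      case 1
      show ?thesis unfolding q_def V_def s1_sq U_def w_def sq_profile_def s2_def index_defs 1
        by simp algebra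
    next
      case 2
      show ?thesis unfolding q_def V_def s1_sq U_def w_def sq_profile_def s2_def index_defs 2
        by simp algebra
    next
      case 3
      have v: "eigenval j = l3" "gap_product j = (l3\<^sup>2 - l1\<^sup>2) * (l3\<^sup>2 - l2\<^sup>2)" "denom_scale j = - ((l1 + l3) * (l2 - l3))"
        "\<alpha> j = l1 - l3" "\<beta> j = l2 + l3" "numer j 0 = l1\<^sup>2 + l2\<^sup>2 - l3\<^sup>2"
        unfolding index_defs using 3 by simp_all
      show ?thesis unfolding q_def V_def s1_sq U_def w_def sq_profile_def s2_def v by algebra
    qed
  qed
  have "(eigenval j)\<^sup>2 * (2 * numer j (u z) / (4 * eigenval j * denom j (u z))\<^sup>2) = numer j (u z) / (8 * (denom j (u z))\<^sup>2)"
    using nz(5) by (simp add: power2_eq_square)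
  also have "\<dots> = (numer j 0 * (w z)\<^sup>2 - U\<^sup>2) / (8 * (denom_scale j)\<^sup>2 * V\<^sup>2)"
    unfolding N denom_eq V_def[symmetric] using nz(1,2,3) by (simp add: field_simps)
  also have "\<dots> = (2 * (sq_profile z - (eigenval j)\<^sup>2) * V\<^sup>2 - \<beta> j * q) / (8 * gap_product j * V\<^sup>2)"
    using key nz by (simp add: frac_eq_eq)
  also have "\<dots> = (sq_profile z - (eigenval j)\<^sup>2) / (4 * gap_product j) - \<beta> j / (8 * gap_product j) * (q / V\<^sup>2)"
    using nz by (simp add: diff_divide_distrib)
  finally show ?thesis unfolding n_eq G_eq q_def V_def .
qed

definition "Phi j z = (eigenval j)\<^sup>2 * (LBINT y=0..ereal z.
    (wave_c u1 u2 u3 u4 - 4 * (eigenval j)\<^sup>2 - 2 * (u y)\<^sup>2) / (wave_e u1 u2 u3 u4 + 4 * (eigenval j)\<^sup>2 * u y)\<^sup>2)"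

text \<open>The mean of the integrand: its affine part is averaged, and the derivative of a periodic
  function has mean zero.\<close>

definition "slope j = (\<mu> - (eigenval j)\<^sup>2) / (4 * gap_product j)"

lemma u_cont: "isCont u z"
proof -
  have "u = (\<lambda>z. (2 * (l1 + l2) * (l1 + l3) - (l1 + l2 + l3) * w z) / w z)"
    by (rule ext) (rule u_eq)
  moreover have "isCont (\<lambda>z. (2 * (l1 + l2) * (l1 + l3) - (l1 + l2 + l3) * w z) / w z) z"
    using w_pos[of z] unfolding w_def by (intro continuous_intros s_cont) auto
  ultimately show ?thesis by simp
qed

lemma u_periodic: "u (z + L) = u z"
  unfolding u_eq w_def s_periodic ..

text \<open>Integrating \<open>integrand_eq\<close> writes \<open>Phi\<close> as a combination of
  \<open>X\<close>, a linear term and the periodic \<open>h\<close>, without a constant since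
  \<open>s1\<close> vanishes at 0.\<close>

lemma Phi_bound: obtains B where "\<And>z. \<bar>Phi j z - slope j * z\<bar> \<le> B"
proof -
  let ?f = "\<lambda>y. (wave_c u1 u2 u3 u4 - 4 * (eigenval j)\<^sup>2 - 2 * (u y)\<^sup>2) / (wave_e u1 u2 u3 u4 + 4 * (eigenval j)\<^sup>2 * u y)\<^sup>2"
  define h where "h z = s1 z / (\<alpha> j + \<beta> j * s z)" for z
  have nz: "\<alpha> j + \<beta> j * s z \<noteq> 0" for z using \<alpha>\<beta>_pos[of j z] by simp
  have h: "(h has_real_derivative (s2 z * (\<alpha> j + \<beta> j * s z) - \<beta> j * (s1 z)\<^sup>2) / (\<alpha> j + \<beta> j * s z)\<^sup>2) (at z)" for z
  proof -
    have "((\<lambda>z. \<alpha> j + \<beta> j * s z) has_real_derivative \<beta> j * s1 z) (at z)"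
      by (rule derivative_eq_intros s_deriv refl)+ simp
    from DERIV_divide[OF s1_deriv this nz]
    show ?thesis unfolding h_def[abs_def] by (simp add: power2_eq_square mult_ac)
  qed
  have "isCont ?f z" for z
    using n_nz[of j z] by (intro continuous_intros u_cont) auto
  from DERIV_cmult[OF DERIV_LBINT[of ?f, OF this]]
  have P: "(Phi j has_real_derivative (eigenval j)\<^sup>2 * ?f z) (at z)" for z
    unfolding Phi_def[abs_def] .
  have R: "((\<lambda>z. (X z - (eigenval j)\<^sup>2 * z) / (4 * gap_product j) - \<beta> j / (8 * gap_product j) * h z) has_real_derivative (eigenval j)\<^sup>2 * ?f z) (at z)" for z
    unfolding integrand_eq
    by (intro DERIV_diff DERIV_cmult h DERIV_cdivide X_deriv) (rule derivative_eq_intros refl | simp)+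
  have A: "Phi j z = (X z - (eigenval j)\<^sup>2 * z) / (4 * gap_product j) - \<beta> j / (8 * gap_product j) * h z" for z
    using deriv_eq_imp_const_diff[OF P R, of z 0] unfolding Phi_def h_def by (simp add: X_0 s_0)
  have eq: "Phi j z - slope j * z = (X z - \<mu> * z) / (4 * gap_product j) - \<beta> j / (8 * gap_product j) * h z" for z
    unfolding A slope_def by (simp add: diff_divide_distrib left_diff_distrib)
  obtain B1 where B1: "\<And>z. \<bar>X z - \<mu> * z\<bar> \<le> B1" by (rule X_bounded) blast
  have "h (z + L) = h z" for z unfolding h_def s_periodic ..
  moreover have "isCont h z" for z by (rule DERIV_isCont[OF h])
  ultimately obtain B2 where B2: "\<And>z. \<bar>h z\<bar> \<le> B2"
    using periodic_continuous_bounded[of h L] L_pos by blast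
  show thesis
  proof (rule that)
    fix z
    have "\<bar>Phi j z - slope j * z\<bar> \<le> \<bar>(X z - \<mu> * z) / (4 * gap_product j)\<bar> + \<bar>\<beta> j / (8 * gap_product j) * h z\<bar>"
      unfolding eq by (rule abs_triangle_ineq4)
    also have "\<dots> = \<bar>X z - \<mu> * z\<bar> / \<bar>4 * gap_product j\<bar> + \<bar>\<beta> j / (8 * gap_product j)\<bar> * \<bar>h z\<bar>"
      by (simp only: abs_divide abs_mult)
    also have "\<dots> \<le> B1 / \<bar>4 * gap_product j\<bar> + \<bar>\<beta> j / (8 * gap_product j)\<bar> * B2"
      by (intro add_mono divide_right_mono mult_left_mono B1 B2) auto
    finally show "\<bar>Phi j z - slope j * z\<bar> \<le> B1 / \<bar>4 * gap_product j\<bar> + \<bar>\<beta> j / (8 * gap_product j)\<bar> * B2" .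
  qed
qed

text \<open>The lower bound is the boundedness of the reciprocal, which is again continuous and
  periodic.\<close>

lemma n_bounds:
  obtains lo hi where "0 < lo" "\<And>z. lo \<le> \<bar>wave_e u1 u2 u3 u4 + 4 * (eigenval j)\<^sup>2 * u z\<bar>"
    "\<And>z. \<bar>wave_e u1 u2 u3 u4 + 4 * (eigenval j)\<^sup>2 * u z\<bar> \<le> hi"
proof -
  let ?n = "\<lambda>z. wave_e u1 u2 u3 u4 + 4 * (eigenval j)\<^sup>2 * u z"
  have cont: "isCont ?n z" for z by (intro continuous_intros u_cont)
  then obtain hi where hi: "\<And>z. \<bar>?n z\<bar> \<le> hi"
    using periodic_continuous_bounded[of ?n L] L_pos u_periodic by auto
  have "isCont (\<lambda>z. 1 / ?n z) z" for z
    using n_nz[of j z] by (intro continuous_intros u_cont) auto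
  then obtain B where B: "\<And>z. \<bar>1 / ?n z\<bar> \<le> B"
    using periodic_continuous_bounded[of "\<lambda>z. 1 / ?n z" L] L_pos u_periodic by auto
  have B': "1 \<le> B * \<bar>?n z\<bar>" for z
    using B[of z] n_nz[of j z] by (simp add: abs_divide divide_le_eq)
  have "B > 0"
  proof (rule ccontr)
    assume "\<not> B > 0"
    then have "B * \<bar>?n 0\<bar> \<le> 0" by (intro mult_nonpos_nonneg) auto
    then show False using B'[of 0] by linarith
  qed
  then have "1 / B \<le> \<bar>?n z\<bar>" for z using B'[of z] by (simp add: divide_le_eq mult.commute)
  then show thesis using that[of "1 / B" hi] hi \<open>B > 0\<close> by simp
qed

text \<open>By \<open>\<mu>_le\<close>, since the geometric mean of l1^2 - l2^2 and l1^2 - l3^2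
  exceeds the smaller of the two.\<close>

lemma \<mu>_less: "\<mu> < l2\<^sup>2"
proof -
  have "sqrt ((l1\<^sup>2 - l2\<^sup>2)\<^sup>2) < sqrt ((l1\<^sup>2 - l2\<^sup>2) * (l1\<^sup>2 - l3\<^sup>2))"
    using sq_less unfolding power2_eq_square[of "l1\<^sup>2 - l2\<^sup>2"] by (intro real_sqrt_less_mono mult_strict_left_mono) auto
  then show ?thesis using \<mu>_le sq_less by simp
qed

text \<open>In the notation of the proof, slope 3 < slope 2 says that \<open>D\<close> exceeds the
  harmonic mean 2 d2 d3 / (d2 + d3). By \<open>\<mu>_le\<close>, \<open>D\<close> is at least the
  geometric mean, which is larger since d2 < d3.\<close>

lemma slope_signs: "slope 1 < 0" "0 < slope 3" "slope 3 < slope 2"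
proof -
  define d2 d3 D where "d2 = l1\<^sup>2 - l2\<^sup>2" and "d3 = l1\<^sup>2 - l3\<^sup>2" and "D = l1\<^sup>2 - \<mu>"
  have d: "0 < d2" "d2 < d3" unfolding d2_def d3_def using sq_less by auto
  show "slope 1 < 0" unfolding slope_def eigenval_def gap_product_def
    using \<mu>_less sq_less by (simp add: divide_less_0_iff)
  show "0 < slope 3" unfolding slope_def eigenval_def gap_product_def
    using \<mu>_gt sq_less by (simp add: zero_less_mult_iff)
  have "2 * (d2 * d3) < D * (d2 + d3)"
  proof -
    have "2 * sqrt (d2 * d3) < d2 + d3"
    proof -
      have "0 < (sqrt d3 - sqrt d2)\<^sup>2" using d by simp
      then show ?thesis using d by (simp add: power2_diff real_sqrt_mult mult_ac add_ac)
    qed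
    moreover have "0 < sqrt (d2 * d3)" using d by simp
    ultimately have "2 * sqrt (d2 * d3) * sqrt (d2 * d3) < (d2 + d3) * sqrt (d2 * d3)"
      by (rule mult_strict_right_mono)
    also have "2 * sqrt (d2 * d3) * sqrt (d2 * d3) = 2 * (d2 * d3)" using d by simp
    also have "(d2 + d3) * sqrt (d2 * d3) \<le> (d2 + d3) * D"
      using \<mu>_le d unfolding d2_def d3_def D_def by (intro mult_left_mono) auto
    finally show ?thesis by (simp add: mult.commute)
  qed
  then have less: "(d3 - D) * d2 < (D - d2) * d3" by (simp add: algebra_simps)
  have e2: "slope 2 = (D - d2) / (4 * (d3 - d2) * d2)" "slope 3 = (d3 - D) / (4 * (d3 - d2) * d3)"
  proof -
    have "(\<mu> - l2\<^sup>2) * (4 * (d3 - d2) * d2) = (D - d2) * (4 * ((l2\<^sup>2 - l1\<^sup>2) * (l2\<^sup>2 - l3\<^sup>2)))"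
      "(\<mu> - l3\<^sup>2) * (4 * (d3 - d2) * d3) = (d3 - D) * (4 * ((l3\<^sup>2 - l1\<^sup>2) * (l3\<^sup>2 - l2\<^sup>2)))"
      unfolding d2_def d3_def D_def by algebra+
    then show "slope 2 = (D - d2) / (4 * (d3 - d2) * d2)" "slope 3 = (d3 - D) / (4 * (d3 - d2) * d3)"
      unfolding slope_def eigenval_def gap_product_def using d sq_less by (simp_all add: frac_eq_eq)
  qed
  have "(d3 - D) / d3 < (D - d2) / d2"
  proof -
    have "(d3 - D) / d3 = (d3 - D) * d2 / (d2 * d3)" "(D - d2) / d2 = (D - d2) * d3 / (d2 * d3)"
      using d by simp_all
    then show ?thesis using divide_strict_right_mono[OF less, of "d2 * d3"] d by simp
  qed
  then have "(d3 - D) / d3 / (4 * (d3 - d2)) < (D - d2) / d2 / (4 * (d3 - d2))"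
    using d by (intro divide_strict_right_mono) auto
  then show "slope 3 < slope 2" unfolding e2 divide_divide_eq_left by (simp add: mult.commute)
qed

end

lemma wave_modulus_symmetries:
  "wave_\<kappa> b a d c = wave_\<kappa> a b c d" "wave_\<kappa> c d a b = wave_\<kappa> a b c d" "wave_\<kappa> d c b a = wave_\<kappa> a b c d"
  "wave_\<nu> b a d c = wave_\<nu> a b c d" "wave_\<nu> c d a b = wave_\<nu> a b c d" "wave_\<nu> d c b a = wave_\<nu> a b c d"
proof -
  have "(b - a) * (d - c) = (a - b) * (c - d)" "(c - d) * (a - b) = (a - b) * (c - d)" "(d - c) * (b - a) = (a - b) * (c - d)"
    "(b - d) * (a - c) = (a - c) * (b - d)" "(c - a) * (d - b) = (a - c) * (b - d)" "(d - b) * (c - a) = (a - c) * (b - d)"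
    by algebra+
  then show "wave_\<kappa> b a d c = wave_\<kappa> a b c d" "wave_\<kappa> c d a b = wave_\<kappa> a b c d" "wave_\<kappa> d c b a = wave_\<kappa> a b c d"
    "wave_\<nu> b a d c = wave_\<nu> a b c d" "wave_\<nu> c d a b = wave_\<nu> a b c d" "wave_\<nu> d c b a = wave_\<nu> a b c d"
    unfolding wave_\<kappa>_def wave_\<nu>_def by (simp_all only:)
qed

section \<open>Directions, speeds and backgrounds of the wave\<close>

context wave_parameters
begin

abbreviation "c \<equiv> wave_c u1 u2 u3 u4"
abbreviation "e \<equiv> wave_e u1 u2 u3 u4"

text \<open>The vector of the same name in \<open>localized_solution\<close> with the eigenvalue
  cancelled; this form depends on the wave and the index only.\<close>

definition "periodic_dir j z = (deriv u z / (2 * denom j (u z)), numer j (u z) / (2 * denom j (u z)))"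
definition "growing_dir p q x t = (gam (p x t) (q x t), sig (p x t) (q x t))"
definition "speed j = c - 1 / slope j"

text \<open>Indices other than 1 and 2 behave like 3, so facts about slopes can be stated for every
  natural number.\<close>

lemma index_cases:
  fixes j :: nat
  obtains "j = 1" | "j = 2" | "j \<noteq> 1" "j \<noteq> 2" "eigenval j = eigenval 3" "denom j = denom 3" "numer j = numer 3" "gap_product j = gap_product 3" "slope j = slope 3"
  unfolding slope_def index_defs[abs_def] by fastforce

lemma slope_nz: "slope j \<noteq> 0"
  using slope_signs by (cases j rule: index_cases) auto

lemma speed_ne_c: "speed j \<noteq> c"
  unfolding speed_def using slope_nz by simp

lemma speeds_distinct: "speed 1 \<noteq> speed 2" "speed 1 \<noteq> speed 3" "speed 2 \<noteq> speed 3"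
  unfolding speed_def using slope_signs slope_nz by auto

lemma localized:
  assumes "second_solution u c e (eigenval j) p q"
  obtains m P Q \<psi> B lo hi where "localized_solution u c e (eigenval j) m P Q \<psi> p q (slope j) B lo hi"
proof -
  obtain m P Q \<psi> where g: "growing_solution u c e (eigenval j) m P Q \<psi> p q"
    by (rule growing_solution_if_second_solution[OF assms eigenval_nz n_nz]) blast
  interpret growing_solution u c e "eigenval j" m P Q \<psi> p q by (rule g)
  obtain B where B: "\<And>z. \<bar>Phi j z - slope j * z\<bar> \<le> B" by (rule Phi_bound) blast
  obtain lo hi where n: "0 < lo" "\<And>z. lo \<le> \<bar>e + 4 * (eigenval j)\<^sup>2 * u z\<bar>" "\<And>z. \<bar>e + 4 * (eigenval j)\<^sup>2 * u z\<bar> \<le> hi"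
    by (rule n_bounds[of j]) blast
  have "localized_solution u c e (eigenval j) m P Q \<psi> p q (slope j) B lo hi"
    by unfold_locales (use B n slope_nz in \<open>simp_all add: \<Phi>_def Phi_def n_def G_def\<close>)
  then show thesis by (rule that)
qed

lemma u_0: "u 0 = u1"
  unfolding u_eq w_def s_0 using pos by (simp add: field_simps)

lemma u_mult_L: "u (real k * L) = u 0"
  using periodic_add_of_nat[of u L 0 k] u_periodic by simp

context
  fixes j p q assumes sol: "second_solution u c e (eigenval j) p q"
begin

text \<open>Exported from \<open>localized_solution\<close> without its auxiliary constants, so that
  solutions for several eigenvalues can be handled together.\<close>

lemma solution_lax: "lax_solution (\<lambda>x t. u (x - c * t)) (eigenval j) p q"
  and solution_growth: "linearly_growing_except_line p q (speed j) \<xi>"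
  and background_mkdv: "mkdv_solution (\<lambda>x t. u (x - c * t))"
  and solution_nz: "(p x t)\<^sup>2 + (q x t)\<^sup>2 \<noteq> 0"
  and wave_ode: "(deriv u z)\<^sup>2 = wave_quartic l1 l2 l3 (u z)"
  and periodic_dir_circle: "periodic_dir j z \<in> circle"
  and growing_dir_circle: "growing_dir p q x t \<in> circle"
  and growing_dir_approach: "\<delta> > 0 \<Longrightarrow> \<exists>R. \<forall>x t. \<bar>x - speed j * t\<bar> > R \<longrightarrow> dist (growing_dir p q x t) (periodic_dir j (x - c * t)) < \<delta>"
  and growing_dir_flip: "\<exists>(X :: nat \<Rightarrow> real) T B. (\<forall>k. growing_dir p q (X k) (T k) = - periodic_dir j (real k * L) \<and> X k - c * T k = real k * L
      \<and> \<bar>X k - speed j * T k\<bar> \<le> B) \<and> filterlim T at_infinity sequentially"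
proof -
  obtain m P Q \<psi> B lo hi where "localized_solution u c e (eigenval j) m P Q \<psi> p q (slope j) B lo hi"
    using localized[OF sol] .
  then interpret loc: localized_solution u c e "eigenval j" m P Q \<psi> p q "slope j" B lo hi .
  have nG: "loc.n z = 4 * eigenval j * denom j (u z)" "loc.G z = 2 * numer j (u z)" for z
    unfolding loc.n_def loc.G_def n_eq G_eq by simp_all
  have periodic_dir: "loc.periodic_dir = periodic_dir j"
    unfolding loc.periodic_dir_def periodic_dir_def nG using eigenval_nz[of j] by (simp add: fun_eq_iff)
  have growing_dir: "loc.growing_dir = growing_dir p q"
    unfolding loc.growing_dir_def growing_dir_def by (simp add: fun_eq_iff)
  show "lax_solution (\<lambda>x t. u (x - c * t)) (eigenval j) p q" by (rule loc.lax)
  show "linearly_growing_except_line p q (speed j) \<xi>" unfolding speed_def by (rule loc.linear_growth)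
  show "mkdv_solution (\<lambda>x t. u (x - c * t))" unfolding mkdv_solution_iff_jet using loc.jet_u by blast
  show "(p x t)\<^sup>2 + (q x t)\<^sup>2 \<noteq> 0" using loc.pq_sum_pos[of x t] by (rule less_imp_neq[symmetric])
  \<comment> \<open>The first integral of the eigenfunction supplies the equation of the wave; every
    index leads to the same quartic.\<close>
  show "(deriv u z)\<^sup>2 = wave_quartic l1 l2 l3 (u z)"
  proof -
    have "4 * (eigenval j)\<^sup>2 * ((deriv u z)\<^sup>2 + (numer j (u z))\<^sup>2) = 4 * (eigenval j)\<^sup>2 * (4 * (denom j (u z))\<^sup>2)"
      using loc.first_integral[of z] unfolding nG by (simp add: algebra_simps)
    then have "(deriv u z)\<^sup>2 = 4 * (denom j (u z))\<^sup>2 - (numer j (u z))\<^sup>2"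
      using eigenval_nz[of j] by simp
    also have "\<dots> = wave_quartic l1 l2 l3 (u z)"
      unfolding denom_def numer_def wave_quartic_def by (simp add: power2_eq_square algebra_simps)
    finally show ?thesis .
  qed
  show "periodic_dir j z \<in> circle" using loc.periodic_dir_circle unfolding circle_iff periodic_dir .
  show "growing_dir p q x t \<in> circle" using loc.growing_dir_circle unfolding circle_iff growing_dir .
  show "\<exists>R. \<forall>x t. \<bar>x - speed j * t\<bar> > R \<longrightarrow> dist (growing_dir p q x t) (periodic_dir j (x - c * t)) < \<delta>" if "\<delta> > 0"
    by (rule loc.growing_dir_approach[OF that]) (unfold periodic_dir growing_dir speed_def, blast)
  show "\<exists>(X :: nat \<Rightarrow> real) T B. (\<forall>k. growing_dir p q (X k) (T k) = - periodic_dir j (real k * L) \<and> X k - c * T k = real k * L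
      \<and> \<bar>X k - speed j * T k\<bar> \<le> B) \<and> filterlim T at_infinity sequentially"
    by (rule loc.growing_dir_flip[OF L_pos]) (unfold periodic_dir growing_dir speed_def, blast)
qed

text \<open>At multiples of the period u equals u1, a root of the quartic. Hence all the cosines
  vanish there.\<close>

lemma deriv_u_mult_L: "deriv u (real k * L) = 0"
proof -
  have "wave_quartic l1 l2 l3 u1 = 0" unfolding wave_quartic_def by algebra
  then show ?thesis using wave_ode[of "real k * L"] unfolding u_mult_L u_0 by simp
qed

lemma periodic_dir_mult_L: "periodic_dir i (real k * L) = periodic_dir i 0"
  using deriv_u_mult_L[of k] deriv_u_mult_L[of 0] unfolding periodic_dir_def u_mult_L by simp

lemma periodic_dir_0: "fst (periodic_dir i 0) = 0"
  using deriv_u_mult_L[of 0] unfolding periodic_dir_def by simp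

lemma snd_periodic_dir_0: "(snd (periodic_dir j 0))\<^sup>2 = 1"
  using periodic_dir_circle[of 0] unfolding circle_iff periodic_dir_0 by simp

end

definition "moebius_wave j v = (if j = (1::nat) then (l2 * l3 * v - l1 * (l2\<^sup>2 + l3\<^sup>2 - l1\<^sup>2)) / denom 1 v
  else if j = 2 then (l1 * l3 * v - l2 * (l1\<^sup>2 + l3\<^sup>2 - l2\<^sup>2)) / denom 2 v
  else (l1 * l2 * v - l3 * (l1\<^sup>2 + l2\<^sup>2 - l3\<^sup>2)) / denom 3 v)"

text \<open>The exchanges preserve \<kappa> and \<nu>, so each transformed wave is a Moebius
  function of the same \<open>s\<close>. Its denominator is proportional to
  \<open>\<alpha> j + \<beta> j * s z\<close>, which is also the factor in
  \<open>denom j (u z)\<close>.\<close>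

lemma sym_wave_eq_moebius: "sym_wave j u1 u2 u3 u4 z = moebius_wave j (u z)"
proof -
  define U where "U = 2 * (l1 + l2) * (l1 + l3) - (l1 + l2 + l3) * w z"
  have V: "\<alpha> i + \<beta> i * s z \<noteq> 0" for i using \<alpha>\<beta>_pos[of i z] by simp
  note nz = w_pos[of z, THEN less_imp_neq, symmetric] denom_scale_nz
  have fr: "(a * (U / w z) - b) / (K * V / w z) = (a * U - b * w z) / (K * V)" for a b K V
  proof -
    have "a * (U / w z) - b = (a * U - b * w z) / w z" using nz(1) by (simp add: field_simps)
    then show ?thesis using nz(1) by simp
  qed
  \<comment> \<open>For (S2) and (S3) the exchanged differences carry the common factor -2 instead
    of 2.\<close>
  have neg: "(-2) * A / ((-2) * B) = A / B" for A B :: real by simp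
  have "wave u2 u1 u4 u3 z = u3 + 2 * (l1 - l2) * (l1 - l3) / (\<alpha> 1 + \<beta> 1 * s z)"
  proof -
    have "(u2 - u3) * (u1 - u3) = 2 * (2 * (l1 - l2) * (l1 - l3))"
      "(u1 - u3) + (u2 - u1) * s z = 2 * (\<alpha> 1 + \<beta> 1 * s z)"
      unfolding \<alpha>_def \<beta>_def by (simp_all add: algebra_simps)
    then show ?thesis
      unfolding wave_def wave_modulus_symmetries S_def[symmetric] s_def[symmetric]
      by (simp only: mult_divide_mult_cancel_left)
  qed
  also have "\<dots> = moebius_wave 1 (u z)"
  proof -
    have key: "l2 * l3 * U - l1 * (l2\<^sup>2 + l3\<^sup>2 - l1\<^sup>2) * w z = denom_scale 1 * (u3 * (\<alpha> 1 + \<beta> 1 * s z) + 2 * (l1 - l2) * (l1 - l3))"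
      unfolding U_def w_def index_defs by simp algebra
    have "moebius_wave 1 (u z) = (l2 * l3 * u z - l1 * (l2\<^sup>2 + l3\<^sup>2 - l1\<^sup>2)) / denom 1 (u z)" unfolding moebius_wave_def by simp
    also have "\<dots> = (l2 * l3 * (U / w z) - l1 * (l2\<^sup>2 + l3\<^sup>2 - l1\<^sup>2)) / (denom_scale 1 * (\<alpha> 1 + \<beta> 1 * s z) / w z)"
      unfolding denom_eq unfolding u_eq U_def[symmetric] ..
    also have "\<dots> = denom_scale 1 * (u3 * (\<alpha> 1 + \<beta> 1 * s z) + 2 * (l1 - l2) * (l1 - l3)) / (denom_scale 1 * (\<alpha> 1 + \<beta> 1 * s z))"
      unfolding fr key ..
    finally show ?thesis using denom_scale_nz[of 1] V[of 1] by (simp add: add_divide_distrib)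
  qed
  finally have 1: "wave u2 u1 u4 u3 z = moebius_wave 1 (u z)" .
  have "wave u3 u4 u1 u2 z = u2 - 2 * (l1 - l2) * (l1 + l3) / (\<alpha> 2 + \<beta> 2 * s z)"
  proof -
    have "(u3 - u2) * (u4 - u2) = (-2) * (- 2 * (l1 - l2) * (l1 + l3))"
      "(u4 - u2) + (u3 - u4) * s z = (-2) * (\<alpha> 2 + \<beta> 2 * s z)"
      unfolding \<alpha>_def \<beta>_def by (simp_all add: algebra_simps)
    then show ?thesis
      unfolding wave_def wave_modulus_symmetries S_def[symmetric] s_def[symmetric]
      by (simp only: neg; simp)
  qed
  also have "\<dots> = moebius_wave 2 (u z)"
  proof -
    have key: "l1 * l3 * U - l2 * (l1\<^sup>2 + l3\<^sup>2 - l2\<^sup>2) * w z = denom_scale 2 * (u2 * (\<alpha> 2 + \<beta> 2 * s z) - 2 * (l1 - l2) * (l1 + l3))"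
      unfolding U_def w_def index_defs by simp algebra
    have "moebius_wave 2 (u z) = (l1 * l3 * u z - l2 * (l1\<^sup>2 + l3\<^sup>2 - l2\<^sup>2)) / denom 2 (u z)" unfolding moebius_wave_def by simp
    also have "\<dots> = (l1 * l3 * (U / w z) - l2 * (l1\<^sup>2 + l3\<^sup>2 - l2\<^sup>2)) / (denom_scale 2 * (\<alpha> 2 + \<beta> 2 * s z) / w z)"
      unfolding denom_eq unfolding u_eq U_def[symmetric] ..
    also have "\<dots> = denom_scale 2 * (u2 * (\<alpha> 2 + \<beta> 2 * s z) - 2 * (l1 - l2) * (l1 + l3)) / (denom_scale 2 * (\<alpha> 2 + \<beta> 2 * s z))"
      unfolding fr key ..
    finally show ?thesis using denom_scale_nz[of 2] V[of 2] by (simp add: diff_divide_distrib)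
  qed
  finally have 2: "wave u3 u4 u1 u2 z = moebius_wave 2 (u z)" .
  have "wave u4 u3 u2 u1 z = u1 - 2 * (l1 + l2) * (l1 - l3) / (\<alpha> 3 + \<beta> 3 * s z)"
  proof -
    have "(u4 - u1) * (u3 - u1) = (-2) * (- 2 * (l1 + l2) * (l1 - l3))"
      "(u3 - u1) + (u4 - u3) * s z = (-2) * (\<alpha> 3 + \<beta> 3 * s z)"
      unfolding \<alpha>_def \<beta>_def by (simp_all add: algebra_simps)
    then show ?thesis
      unfolding wave_def wave_modulus_symmetries S_def[symmetric] s_def[symmetric]
      by (simp only: neg; simp)
  qed
  also have "\<dots> = moebius_wave 3 (u z)"
  proof -
    have key: "l1 * l2 * U - l3 * (l1\<^sup>2 + l2\<^sup>2 - l3\<^sup>2) * w z = denom_scale 3 * (u1 * (\<alpha> 3 + \<beta> 3 * s z) - 2 * (l1 + l2) * (l1 - l3))"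
      unfolding U_def w_def index_defs by simp algebra
    have "moebius_wave 3 (u z) = (l1 * l2 * u z - l3 * (l1\<^sup>2 + l2\<^sup>2 - l3\<^sup>2)) / denom 3 (u z)" unfolding moebius_wave_def by simp
    also have "\<dots> = (l1 * l2 * (U / w z) - l3 * (l1\<^sup>2 + l2\<^sup>2 - l3\<^sup>2)) / (denom_scale 3 * (\<alpha> 3 + \<beta> 3 * s z) / w z)"
      unfolding denom_eq unfolding u_eq U_def[symmetric] ..
    also have "\<dots> = denom_scale 3 * (u1 * (\<alpha> 3 + \<beta> 3 * s z) - 2 * (l1 + l2) * (l1 - l3)) / (denom_scale 3 * (\<alpha> 3 + \<beta> 3 * s z))"
      unfolding fr key ..
    finally show ?thesis using denom_scale_nz[of 3] V[of 3] by (simp add: diff_divide_distrib)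
  qed
  finally have 3: "wave u4 u3 u2 u1 z = moebius_wave 3 (u z)" .
  have "sym_wave j u1 u2 u3 u4 z = (if j = 1 then wave u2 u1 u4 u3 z
      else if j = 2 then wave u3 u4 u1 u2 z else wave u4 u3 u2 u1 z)"
    unfolding sym_wave_def by (simp only: if_distrib[of "\<lambda>f. f z"])
  then show ?thesis unfolding 1 2 3 by (simp add: moebius_wave_def)
qed

text \<open>Over the denominator \<open>denom j\<close> the terms quadratic in u cancel, leaving the
  negative of the affine numerator of \<open>moebius_wave j\<close>.\<close>

lemma background_1: "u z + 2 * eigenval j * snd (periodic_dir j z) = - sym_wave j u1 u2 u3 u4 z"
proof -
  have "denom j (u z) * u z + eigenval j * numer j (u z) = - (moebius_wave j (u z) * denom j (u z))"
    using denom_nz[of 1 z] denom_nz[of 2 z] denom_nz[of 3 z] 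
    unfolding moebius_wave_def by (simp add: denom_def numer_def eigenval_def) (auto simp: algebra_simps power2_eq_square)
  then show ?thesis unfolding sym_wave_eq_moebius periodic_dir_def using denom_nz[of j z]
    by (simp add: field_simps)
qed

end

lemma permutation_cases:
  assumes "{i, j, k} = {1, 2, 3 :: nat}"
  obtains "i = 1" "j = 2" "k = 3" | "i = 1" "j = 3" "k = 2" | "i = 2" "j = 1" "k = 3"
    | "i = 2" "j = 3" "k = 1" | "i = 3" "j = 1" "k = 2" | "i = 3" "j = 2" "k = 1"
proof -
  have "i = 1 \<or> i = 2 \<or> i = 3" "j = 1 \<or> j = 2 \<or> j = 3" "k = 1 \<or> k = 2 \<or> k = 3"
    "1 = i \<or> 1 = j \<or> 1 = k" "2 = i \<or> 2 = j \<or> 2 = k" "3 = i \<or> 3 = j \<or> 3 = k"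
    using assms by blast+
  then have "i = 1 \<and> j = 2 \<and> k = 3 \<or> i = 1 \<and> j = 3 \<and> k = 2 \<or> i = 2 \<and> j = 1 \<and> k = 3
      \<or> i = 2 \<and> j = 3 \<and> k = 1 \<or> i = 3 \<and> j = 1 \<and> k = 2 \<or> i = 3 \<and> j = 2 \<and> k = 1"
    by presburger
  then show thesis using that by blast
qed

context wave_parameters
begin

text \<open>Permuting the indices permutes the eigenvalues in all formulas and fixes the quartic.
  This reduces the six orderings to one generic background identity.\<close>

lemma permuted_eigenvalues:
  assumes "{i, j, k} = {1, 2, 3 :: nat}"
  shows "denom i v = eigenval i * v - eigenval j * eigenval k" "denom j v = eigenval j * v - eigenval i * eigenval k" "denom k v = eigenval k * v - eigenval i * eigenval j"
    "numer i v = (eigenval j)\<^sup>2 + (eigenval k)\<^sup>2 - (eigenval i)\<^sup>2 - v\<^sup>2" "numer j v = (eigenval i)\<^sup>2 + (eigenval k)\<^sup>2 - (eigenval j)\<^sup>2 - v\<^sup>2"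
    "moebius_wave k v = (eigenval i * eigenval j * v - eigenval k * ((eigenval i)\<^sup>2 + (eigenval j)\<^sup>2 - (eigenval k)\<^sup>2)) / denom k v"
    "wave_quartic (eigenval i) (eigenval j) (eigenval k) v = wave_quartic l1 l2 l3 v"
    "(eigenval i)\<^sup>2 \<noteq> (eigenval j)\<^sup>2" "speed i \<noteq> speed j"
proof -
  show "denom i v = eigenval i * v - eigenval j * eigenval k" "denom j v = eigenval j * v - eigenval i * eigenval k" "denom k v = eigenval k * v - eigenval i * eigenval j"
    using assms by (elim permutation_cases, simp_all add: denom_def eigenval_def mult.commute)+
  show "numer i v = (eigenval j)\<^sup>2 + (eigenval k)\<^sup>2 - (eigenval i)\<^sup>2 - v\<^sup>2" "numer j v = (eigenval i)\<^sup>2 + (eigenval k)\<^sup>2 - (eigenval j)\<^sup>2 - v\<^sup>2"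
    using assms by (elim permutation_cases, simp_all add: numer_def eigenval_def)+
  show "moebius_wave k v = (eigenval i * eigenval j * v - eigenval k * ((eigenval i)\<^sup>2 + (eigenval j)\<^sup>2 - (eigenval k)\<^sup>2)) / denom k v"
    using assms by (elim permutation_cases) (simp_all add: moebius_wave_def eigenval_def algebra_simps)
  show "wave_quartic (eigenval i) (eigenval j) (eigenval k) v = wave_quartic l1 l2 l3 v"
    using assms by (elim permutation_cases) (simp_all add: eigenval_def wave_quartic_def power2_eq_square algebra_simps)
  show "(eigenval i)\<^sup>2 \<noteq> (eigenval j)\<^sup>2"
    using assms by (elim permutation_cases) (use eigenval_sq_ne in auto)
  show "speed i \<noteq> speed j"
    using assms by (elim permutation_cases) (use speeds_distinct in auto)
qed

lemma background_2:
  assumes ode: "(deriv u z)\<^sup>2 = wave_quartic l1 l2 l3 (u z)" and ijk: "{i, j, k} = {1, 2, 3}"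
  shows "u z + darboux2_shift (eigenval i) (eigenval j) (fst (periodic_dir i z)) (snd (periodic_dir i z)) (fst (periodic_dir j z)) (snd (periodic_dir j z))
    = sym_wave k u1 u2 u3 u4 z"
proof -
  note p = permuted_eigenvalues[OF ijk]
  show ?thesis
    unfolding periodic_dir_def fst_conv snd_conv sym_wave_eq_moebius p(1-6)
    by (rule darboux2_shift_background) (use denom_nz[of i z] denom_nz[of j z] denom_nz[of k z] p ode in simp_all)
qed

lemma background_3:
  assumes ode: "(deriv u z)\<^sup>2 = wave_quartic l1 l2 l3 (u z)"
  shows "u z + darboux3_shift l1 l2 l3 (fst (periodic_dir 1 z)) (snd (periodic_dir 1 z)) (fst (periodic_dir 2 z)) (snd (periodic_dir 2 z)) (fst (periodic_dir 3 z)) (snd (periodic_dir 3 z))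
    = - u z"
proof -
  have v: "denom 1 v = l1 * v - l2 * l3" "denom 2 v = l2 * v - l1 * l3" "denom 3 v = l3 * v - l1 * l2"
    "numer 1 v = l2\<^sup>2 + l3\<^sup>2 - l1\<^sup>2 - v\<^sup>2" "numer 2 v = l1\<^sup>2 + l3\<^sup>2 - l2\<^sup>2 - v\<^sup>2" "numer 3 v = l1\<^sup>2 + l2\<^sup>2 - l3\<^sup>2 - v\<^sup>2" for v
    unfolding denom_def numer_def by simp_all
  show ?thesis
    unfolding periodic_dir_def fst_conv snd_conv v
    by (rule darboux3_shift_background) (use denom_nz[of 1 z] denom_nz[of 2 z] denom_nz[of 3 z] sq_less ode in \<open>simp_all add: v[symmetric]\<close>)
qed

section \<open>The solitons added by one, two and three eigenvalues\<close>

context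
  fixes p q :: "nat \<Rightarrow> real \<Rightarrow> real \<Rightarrow> real"
  assumes sol: "\<And>j. j \<in> {1, 2, 3} \<Longrightarrow> second_solution u c e (eigenval j) (p j) (q j)"
begin

text \<open>Common to all three cases: \<open>F\<close> is the shift of the Darboux formula as a
  function of the directions, and \<open>axis\<close> is its additive value where the cosines
  vanish.\<close>

lemma adds_solitons:
  assumes J: "J \<subseteq> {1, 2, 3}" and mkdv: "mkdv_solution W" and unif: "unif_on_circle J F"
    and W: "\<And>x t. W x t = u (x - c * t) + F (\<lambda>j. growing_dir (p j) (q j) x t)"
    and V: "\<And>z. V z = u z + F (\<lambda>j. periodic_dir j z)"
    and axis: "\<And>E. (\<And>j. j \<in> J \<Longrightarrow> fst (E j) = 0 \<and> (snd (E j))\<^sup>2 = 1) \<Longrightarrow> F E = (\<Sum>j\<in>J. 2 * eigenval j * snd (E j))"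
    and F_cong: "\<And>E E'. (\<And>k. k \<in> J \<Longrightarrow> E k = E' k) \<Longrightarrow> F E = F E'"
  shows "adds_algebraic_solitons W (\<lambda>x t. V (x - c * t)) J speed \<xi>"
proof (rule adds_algebraic_solitons_criterion[where F = F and c = c and b = "\<lambda>x t. u (x - c * t)"
      and growing_dir = "\<lambda>j. growing_dir (p j) (q j)" and periodic_dir = periodic_dir])
  have sol': "second_solution u c e (eigenval j) (p j) (q j)" if "j \<in> J" for j using sol J that by blast
  show fin: "finite J" using J by (rule finite_subset) simp
  show "\<And>j x t. j \<in> J \<Longrightarrow> growing_dir (p j) (q j) x t \<in> circle" by (rule growing_dir_circle[OF sol'])
  show "\<And>j z. j \<in> J \<Longrightarrow> periodic_dir j z \<in> circle" by (rule periodic_dir_circle[OF sol'])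
  show "\<exists>R. \<forall>x t. \<bar>x - speed j * t\<bar> > R \<longrightarrow> dist (growing_dir (p j) (q j) x t) (periodic_dir j (x - c * t)) < \<delta>"
    if "j \<in> J" "\<delta> > 0" for j \<delta> by (rule growing_dir_approach[OF sol'[OF that(1)] that(2)])
  show "speed j \<noteq> speed k" if "j \<in> J" "k \<in> J" "j \<noteq> k" for j k
  proof -
    have "j \<in> {1, 2, 3}" "k \<in> {1, 2, 3}" using J that by auto
    then show ?thesis using that(3) speeds_distinct speeds_distinct[symmetric] by auto
  qed
  show "\<exists>(X :: nat \<Rightarrow> real) T B. (\<forall>n. growing_dir (p j) (q j) (X n) (T n) = - periodic_dir j 0 \<and>
      (\<forall>k\<in>J. periodic_dir k (X n - c * T n) = periodic_dir k 0) \<and> \<bar>X n - speed j * T n\<bar> \<le> B) \<and> filterlim T at_infinity sequentially"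
    if "j \<in> J" for j
    using growing_dir_flip[OF sol'[OF that]] periodic_dir_mult_L[OF sol'[OF that]] by metis
  show "F E \<noteq> F (\<lambda>k. periodic_dir k 0)" if j: "j \<in> J" and E: "\<And>k. k \<in> J \<Longrightarrow> E k = (if k = j then - periodic_dir j 0 else periodic_dir k 0)" for j E
  proof -
    have b: "fst (periodic_dir k 0) = 0" "(snd (periodic_dir k 0))\<^sup>2 = 1" if "k \<in> J" for k
      using periodic_dir_0[OF sol'[OF that]] snd_periodic_dir_0[OF sol'[OF that]] by auto
    have F0: "F (\<lambda>k. periodic_dir k 0) = (\<Sum>k\<in>J. 2 * eigenval k * snd (periodic_dir k 0))" using b by (intro axis) auto
    have "F E = (\<Sum>k\<in>J. 2 * eigenval k * snd (E k))" using b E j by (intro axis) auto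
    \<comment> \<open>Reversing direction j changes the sum by 4 lambda_j times a sine equal to 1 or
      -1, which is nonzero.\<close>
    also have "\<dots> = (\<Sum>k\<in>J. 2 * eigenval k * snd (periodic_dir k 0) - (if k = j then 4 * eigenval j * snd (periodic_dir j 0) else 0))"
      using E by (intro sum.cong) auto
    also have "\<dots> = F (\<lambda>k. periodic_dir k 0) - 4 * eigenval j * snd (periodic_dir j 0)"
      unfolding F0 sum_subtractf using fin j by simp
    finally show ?thesis using eigenval_nz[of j] b(2)[OF j] by auto
  qed
qed (fact mkdv unif W V F_cong)+

lemma solitons_1:
  assumes j: "j \<in> {1, 2, 3}"
  shows "adds_algebraic_solitons (\<lambda>x t. darboux1 (u (x - c * t)) (eigenval j) (p j x t) (q j x t))
    (\<lambda>x t. - sym_wave j u1 u2 u3 u4 (x - c * t)) {j} speed \<xi>"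
proof (rule adds_solitons[where F = "\<lambda>E. 2 * eigenval j * snd (E j)" and V = "\<lambda>z. - sym_wave j u1 u2 u3 u4 z"])
  show "mkdv_solution (\<lambda>x t. darboux1 (u (x - c * t)) (eigenval j) (p j x t) (q j x t))"
    by (rule mkdv_darboux1[OF background_mkdv solution_lax solution_nz, OF sol[OF j] sol[OF j] sol[OF j]])
  show "unif_on_circle {j} (\<lambda>E. 2 * eigenval j * snd (E j))" by (rule unif_on_circle_1)
qed (use j in \<open>simp_all add: darboux1_sig growing_dir_def background_1\<close>)

lemma solitons_2:
  assumes ijk: "{i, j, k} = {1, 2, 3}"
  shows "adds_algebraic_solitons
    (\<lambda>x t. darboux2 (u (x - c * t)) (eigenval i) (eigenval j) (p i x t) (q i x t) (p j x t) (q j x t))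
    (\<lambda>x t. sym_wave k u1 u2 u3 u4 (x - c * t)) {i, j} speed \<xi>"
proof -
  have i: "i \<in> {1, 2, 3}" and j: "j \<in> {1, 2, 3}" using ijk by blast+
  note ne = permuted_eigenvalues(8,9)[OF ijk]
  have ij: "i \<noteq> j" using ne by auto
  show ?thesis
  proof (rule adds_solitons[where F = "\<lambda>E. darboux2_shift (eigenval i) (eigenval j) (fst (E i)) (snd (E i)) (fst (E j)) (snd (E j))"
        and V = "\<lambda>z. sym_wave k u1 u2 u3 u4 z"])
    show "mkdv_solution (\<lambda>x t. darboux2 (u (x - c * t)) (eigenval i) (eigenval j) (p i x t) (q i x t) (p j x t) (q j x t))"
      by (rule mkdv_darboux2[OF background_mkdv[OF sol[OF i]] solution_lax[OF sol[OF i]] solution_nz[OF sol[OF i]]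
            solution_lax[OF sol[OF j]] solution_nz[OF sol[OF j]] ne(1)])
    show "unif_on_circle {i, j} (\<lambda>E. darboux2_shift (eigenval i) (eigenval j) (fst (E i)) (snd (E i)) (fst (E j)) (snd (E j)))"
      by (rule unif_darboux2_shift[OF ne(1)])
    show "darboux2 (u (x - c * t)) (eigenval i) (eigenval j) (p i x t) (q i x t) (p j x t) (q j x t) = u (x - c * t)
      + darboux2_shift (eigenval i) (eigenval j) (fst (growing_dir (p i) (q i) x t)) (snd (growing_dir (p i) (q i) x t)) (fst (growing_dir (p j) (q j) x t)) (snd (growing_dir (p j) (q j) x t))" for x t
      unfolding darboux2_eq_shift[OF solution_nz[OF sol[OF i]] solution_nz[OF sol[OF j]]] growing_dir_def by simp
    show "sym_wave k u1 u2 u3 u4 z = u z + darboux2_shift (eigenval i) (eigenval j) (fst (periodic_dir i z)) (snd (periodic_dir i z)) (fst (periodic_dir j z)) (snd (periodic_dir j z))" for z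
      by (rule background_2[OF wave_ode[OF sol[OF i]] ijk, symmetric])
    show "darboux2_shift (eigenval i) (eigenval j) (fst (E i)) (snd (E i)) (fst (E j)) (snd (E j)) = (\<Sum>j\<in>{i, j}. 2 * eigenval j * snd (E j))"
      if "\<And>n. n \<in> {i, j} \<Longrightarrow> fst (E n) = 0 \<and> (snd (E n))\<^sup>2 = 1" for E
      using that[of i] that[of j] darboux2_shift_axis[OF _ _ ne(1)] ij by simp
  qed (use i j in auto)
qed

lemma solitons_3:
  "adds_algebraic_solitons
    (\<lambda>x t. darboux3 (u (x - c * t)) (eigenval 1) (eigenval 2) (eigenval 3) (p 1 x t) (q 1 x t) (p 2 x t) (q 2 x t) (p 3 x t) (q 3 x t))
    (\<lambda>x t. - u (x - c * t)) {1, 2, 3} speed \<xi>"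
proof (rule adds_solitons[where F = "\<lambda>E. darboux3_shift (eigenval 1) (eigenval 2) (eigenval 3) (fst (E 1)) (snd (E 1)) (fst (E 2)) (snd (E 2)) (fst (E 3)) (snd (E 3))"
      and V = "\<lambda>z. - u z"])
  have s: "second_solution u c e (eigenval 1) (p 1) (q 1)" "second_solution u c e (eigenval 2) (p 2) (q 2)"
    "second_solution u c e (eigenval 3) (p 3) (q 3)" by (rule sol; simp)+
  show "mkdv_solution (\<lambda>x t. darboux3 (u (x - c * t)) (eigenval 1) (eigenval 2) (eigenval 3) (p 1 x t) (q 1 x t) (p 2 x t) (q 2 x t) (p 3 x t) (q 3 x t))"
    by (rule mkdv_darboux3[OF background_mkdv[OF s(1)] solution_lax[OF s(1)] solution_nz[OF s(1)]
          solution_lax[OF s(2)] solution_nz[OF s(2)] solution_lax[OF s(3)] solution_nz[OF s(3)] eigenval_sq_ne])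
  show "unif_on_circle {1, 2, 3} (\<lambda>E. darboux3_shift (eigenval 1) (eigenval 2) (eigenval 3) (fst (E 1)) (snd (E 1)) (fst (E 2)) (snd (E 2)) (fst (E 3)) (snd (E 3)))"
    by (rule unif_darboux3_shift[OF eigenval_sq_ne])
  show "darboux3 (u (x - c * t)) (eigenval 1) (eigenval 2) (eigenval 3) (p 1 x t) (q 1 x t) (p 2 x t) (q 2 x t) (p 3 x t) (q 3 x t)
    = u (x - c * t) + darboux3_shift (eigenval 1) (eigenval 2) (eigenval 3) (fst (growing_dir (p 1) (q 1) x t)) (snd (growing_dir (p 1) (q 1) x t))
      (fst (growing_dir (p 2) (q 2) x t)) (snd (growing_dir (p 2) (q 2) x t)) (fst (growing_dir (p 3) (q 3) x t)) (snd (growing_dir (p 3) (q 3) x t))" for x t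
    unfolding darboux3_eq_shift[OF solution_nz[OF s(1)] solution_nz[OF s(2)] solution_nz[OF s(3)]] growing_dir_def fst_conv snd_conv ..
  have eigenval: "eigenval 1 = l1" "eigenval 2 = l2" "eigenval 3 = l3" unfolding eigenval_def by simp_all
  show "- u z = u z + darboux3_shift (eigenval 1) (eigenval 2) (eigenval 3) (fst (periodic_dir 1 z)) (snd (periodic_dir 1 z)) (fst (periodic_dir 2 z)) (snd (periodic_dir 2 z)) (fst (periodic_dir 3 z)) (snd (periodic_dir 3 z))" for z
    unfolding eigenval by (rule background_3[OF wave_ode[OF s(1)], symmetric])
  show "darboux3_shift (eigenval 1) (eigenval 2) (eigenval 3) (fst (E 1)) (snd (E 1)) (fst (E 2)) (snd (E 2)) (fst (E 3)) (snd (E 3))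
      = (\<Sum>j\<in>{1, 2, 3}. 2 * eigenval j * snd (E j))"
    if "\<And>n. n \<in> {1, 2, 3} \<Longrightarrow> fst (E n) = 0 \<and> (snd (E n))\<^sup>2 = 1" for E
  proof -
    have E: "fst (E 1) = 0" "fst (E 2) = 0" "fst (E 3) = 0" "(snd (E 1))\<^sup>2 = 1" "(snd (E 2))\<^sup>2 = 1" "(snd (E 3))\<^sup>2 = 1"
      using that by simp_all
    show ?thesis unfolding E(1-3) darboux3_shift_axis[OF E(4-6) eigenval_sq_ne] by simp
  qed
  show "darboux3_shift (eigenval 1) (eigenval 2) (eigenval 3) (fst (E 1)) (snd (E 1)) (fst (E 2)) (snd (E 2)) (fst (E 3)) (snd (E 3))
      = darboux3_shift (eigenval 1) (eigenval 2) (eigenval 3) (fst (E' 1)) (snd (E' 1)) (fst (E' 2)) (snd (E' 2)) (fst (E' 3)) (snd (E' 3))"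
    if "\<And>k. k \<in> {1, 2, 3} \<Longrightarrow> E k = E' k" for E E' :: "nat \<Rightarrow> real \<times> real"
    using that by simp
qed simp

end

end

text \<open>The speeds are chosen before the solutions and the phases: they depend only on the wave,
  and any phases will do, since a speed fixes only the direction of its line.\<close>

theorem theorem5:
  fixes u1 u2 u3 u4 c e :: real
    and u :: "real \<Rightarrow> real"
    and lam :: "nat \<Rightarrow> real"
  assumes "u4 < u3" and "u3 < u2" and "u2 < u1"
    and "u1 + u2 + u3 + u4 = 0"
    and "u1 + u2 \<noteq> 0" and "u1 + u3 \<noteq> 0" and "u2 + u3 \<noteq> 0"
    and u: "u = wave u1 u2 u3 u4"
    and c: "c = wave_c u1 u2 u3 u4"
    and e: "e = wave_e u1 u2 u3 u4"
    and lam: "lam 1 = (u1 + u2) / 2" "lam 2 = (u1 + u3) / 2" "lam 3 = (u2 + u3) / 2"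
    and "period_mean (wave_period u1 u2 u3 u4)
           (\<lambda>y. (lam 1)\<^sup>2 * (u1 * u2 + u3 * u4 + 2 * (u y)\<^sup>2) / (e + 4 * (lam 1)\<^sup>2 * u y)\<^sup>2) \<noteq> 0"
    and "period_mean (wave_period u1 u2 u3 u4)
           (\<lambda>y. (lam 2)\<^sup>2 * (u1 * u3 + u2 * u4 + 2 * (u y)\<^sup>2) / (e + 4 * (lam 2)\<^sup>2 * u y)\<^sup>2) \<noteq> 0"
    and "period_mean (wave_period u1 u2 u3 u4)
           (\<lambda>y. (lam 3)\<^sup>2 * (u1 * u4 + u2 * u3 + 2 * (u y)\<^sup>2) / (e + 4 * (lam 3)\<^sup>2 * u y)\<^sup>2) \<noteq> 0"
  shows "\<exists>s :: nat \<Rightarrow> real. (\<forall>j\<in>{1,2,3}. s j \<noteq> c) \<and>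
    (\<forall>(p :: nat \<Rightarrow> real \<Rightarrow> real \<Rightarrow> real) (q :: nat \<Rightarrow> real \<Rightarrow> real \<Rightarrow> real) (\<xi> :: nat \<Rightarrow> real).
      (\<forall>j\<in>{1,2,3}. second_solution u c e (lam j) (p j) (q j)) \<longrightarrow>
        (\<forall>j\<in>{1,2,3}.
           lax_solution (\<lambda>x t. u (x - c * t)) (lam j) (p j) (q j) \<and>
           linearly_growing_except_line (p j) (q j) (s j) (\<xi> j)) \<and>
        (\<forall>j\<in>{1,2,3}.
           adds_algebraic_solitons
             (\<lambda>x t. darboux1 (u (x - c * t)) (lam j) (p j x t) (q j x t))
             (\<lambda>x t. - sym_wave j u1 u2 u3 u4 (x - c * t)) {j} s \<xi>) \<and>
        (\<forall>i j k. {i, j, k} = {1,2,3} \<longrightarrow>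
           adds_algebraic_solitons
             (\<lambda>x t. darboux2 (u (x - c * t)) (lam i) (lam j) (p i x t) (q i x t) (p j x t) (q j x t))
             (\<lambda>x t. sym_wave k u1 u2 u3 u4 (x - c * t)) {i, j} s \<xi>) \<and>
        adds_algebraic_solitons
          (\<lambda>x t. darboux3 (u (x - c * t)) (lam 1) (lam 2) (lam 3)
             (p 1 x t) (q 1 x t) (p 2 x t) (q 2 x t) (p 3 x t) (q 3 x t))
          (\<lambda>x t. - u (x - c * t)) {1,2,3} s \<xi>)"
proof -
  interpret W: wave_parameters "(u1 + u2) / 2" "(u1 + u3) / 2" "(u2 + u3) / 2"
    using assms(1-7) by unfold_locales (simp_all add: field_simps)
  \<comment> \<open>The zero sum turns the half sums back into the given u1, ..., u4.\<close>
  have U: "W.u1 = u1" "W.u2 = u2" "W.u3 = u3" "W.u4 = u4"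
    using assms(4) by (simp_all add: field_simps)
  note facts = W.speed_ne_c W.solution_lax W.solution_growth W.solitons_1 W.solitons_2 W.solitons_3
  note facts' = facts[unfolded U, folded c e, folded u]
  have eigenval: "W.eigenval j = lam j" if "j \<in> {1, 2, 3}" for j
    using that lam unfolding W.eigenval_def by auto
  show ?thesis
  proof (intro exI[of _ W.speed] conjI allI impI)
    show "\<forall>j\<in>{1,2,3}. W.speed j \<noteq> c" using facts'(1) by blast
    fix p q :: "nat \<Rightarrow> real \<Rightarrow> real \<Rightarrow> real" and \<xi> :: "nat \<Rightarrow> real"
    assume sols: "\<forall>j\<in>{1,2,3}. second_solution u c e (lam j) (p j) (q j)"
    have sol: "second_solution u c e (W.eigenval j) (p j) (q j)" if "j \<in> {1, 2, 3}" for j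
      unfolding eigenval[OF that] by (rule bspec[OF sols that])
    show "\<forall>j\<in>{1,2,3}. lax_solution (\<lambda>x t. u (x - c * t)) (lam j) (p j) (q j) \<and>
        linearly_growing_except_line (p j) (q j) (W.speed j) (\<xi> j)"
    proof
      fix j :: nat assume j: "j \<in> {1, 2, 3}"
      show "lax_solution (\<lambda>x t. u (x - c * t)) (lam j) (p j) (q j) \<and>
          linearly_growing_except_line (p j) (q j) (W.speed j) (\<xi> j)"
        using facts'(2,3)[OF sol[OF j]] unfolding eigenval[OF j] by (rule conjI)
    qed
    show "\<forall>j\<in>{1,2,3}. adds_algebraic_solitons (\<lambda>x t. darboux1 (u (x - c * t)) (lam j) (p j x t) (q j x t))
        (\<lambda>x t. - sym_wave j u1 u2 u3 u4 (x - c * t)) {j} W.speed \<xi>"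
    proof
      fix j :: nat assume j: "j \<in> {1, 2, 3}"
      show "adds_algebraic_solitons (\<lambda>x t. darboux1 (u (x - c * t)) (lam j) (p j x t) (q j x t))
          (\<lambda>x t. - sym_wave j u1 u2 u3 u4 (x - c * t)) {j} W.speed \<xi>"
        using facts'(4)[of p q j, OF sol j] unfolding eigenval[OF j] .
    qed
    show "adds_algebraic_solitons
        (\<lambda>x t. darboux2 (u (x - c * t)) (lam i) (lam j) (p i x t) (q i x t) (p j x t) (q j x t))
        (\<lambda>x t. sym_wave k u1 u2 u3 u4 (x - c * t)) {i, j} W.speed \<xi>"
      if ijk: "{i, j, k} = {1, 2, 3}" for i j k
    proof -
      have "i \<in> {1, 2, 3}" "j \<in> {1, 2, 3}" using ijk by blast+
      then show ?thesis using facts'(5)[of p q i j k, OF sol ijk] by (simp only: eigenval)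
    qed
    show "adds_algebraic_solitons
        (\<lambda>x t. darboux3 (u (x - c * t)) (lam 1) (lam 2) (lam 3) (p 1 x t) (q 1 x t) (p 2 x t) (q 2 x t) (p 3 x t) (q 3 x t))
        (\<lambda>x t. - u (x - c * t)) {1,2,3} W.speed \<xi>"
      using facts'(6)[of p q, OF sol] eigenval[of 1] eigenval[of 2] eigenval[of 3] by simp
  qed
qed

end
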